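(* Let $V_h\times Q_h$ be finite element spaces with properties (1)--(4). Let $X_h=\{v_h\in V_h:(\nabla\cdot v_h,q_h)=0\ \forall q_h\in Q_h\}$ and let $X_h^\perp$ be the $L^2$-orthogonal complement of $X_h$ in $V_h$, so that every $v_h\in V_h$ decomposes uniquely as $v_h=w_h+z_h$ with $w_h\in X_h$, $z_h\in X_h^\perp$, $(w_h,z_h)=0$. This decomposition is stable in the $H^1$ norm: there is a constant $C$ independent of $h$ such that $$\|w_h\|_{H^1}+\|z_h\|_{H^1}\le C\|v_h\|_{H^1}\qquad\forall\,v_h\in V_h.$$
   Context: $(\cdot,\cdot)$ is the $L^2(D)$ inner product. **Domain.** $D\subset\mathbb R^d$, $d\in\{2,3\}$, is bounded and such that, with $\mathbb T(v,q)=\nabla v+(\nabla v)^T-q\mathbb I$ and $\mathrm n$ the outward unit normal, solutions $(v,q)$ of $v-\nabla\cdot\mathbb T(v,q)=g$, $\nabla\cdot v=0$ in $D$, $\mathbb T(v,q)\mathrm n=0$ on $\partial D$ satisfy $\|v\|_{H^2}+\|q\|_{H^1}\le C\|g\|_{L^2}$; likewise the Dirichlet problem $\Delta\eta=g$ in $D$, $\eta=0$ on $\partial D$ satisfies $\|\eta\|_{H^2}\le C\|g\|_{L^2}$. **Finite elements.** $V_h\times Q_h\subset H^1(D)^d\times L^2(D)$ is a family of finite element spaces on quasi-uniform triangulations of $D$ (fitting the boundary exactly) with mesh size $h$. With constants independent of $h$: (1) there is a projection $\Pi_h:H^1(D)^d\to V_h$ with $(\nabla\cdot(v-\Pi_hv),q_h)=0$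 for all $q_h\in Q_h$, $\|v-\Pi_hv\|_{H^m}\le Ch^{1-m}\|v\|_{H^1}$ ($m=0,1$), $\|\Pi_hv\|_{H^1}\le C\|v\|_{H^1}$; (2) for $m=1,2$: $\inf_{q_h\in Q_h}\|q-q_h\|_{L^2}\le Ch^m\|q\|_{H^m}$ for $q\in H^m(D)$, and $\inf_{q_h\in Q_h\cap H_0^1(D)}\|q-q_h\|_{L^2}\le Ch^m\|q\|_{H^m}$ for $q\in H^m(D)\cap H_0^1(D)$; (3) $\|v_h\|_{H^1}\le Ch^{-1}\|v_h\|_{L^2}$ for $v_h\in V_h$; (4) $\|q_h\|_{L^2}\le C\sup_{0\ne v_h\in V_h}(q_h,\nabla\cdot v_h)/\|v_h\|_{H^1}$ for $q_h\in Q_h$. *)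

theory Defs
  imports "HOL-Analysis.Analysis"
begin

text \<open>
  Functions on \<open>D\<close> are represented by total functions on \<open>real^'d\<close> of which only the values on \<open>D\<close>
  matter, up to null sets.  Elements of \<open>L\<^sup>2(D)\<close> and of the Sobolev spaces are thus representatives,
  and equality in these spaces is equality almost everywhere with respect to \<open>lebesgue_on D\<close>.
\<close>

section \<open>Lebesgue and Sobolev spaces\<close>

definition L2 :: "(real^'d) set \<Rightarrow> (real^'d \<Rightarrow> 'b::euclidean_space) set" where
  "L2 D = {f. f \<in> borel_measurable (lebesgue_on D) \<and>
              integrable (lebesgue_on D) (\<lambda>x. (norm (f x))\<^sup>2)}"

definition l2_inner ::
  "(real^'d) set \<Rightarrow> (real^'d \<Rightarrow> 'b::euclidean_space) \<Rightarrow> (real^'d \<Rightarrow> 'b) \<Rightarrow> real" where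
  "l2_inner D f g = (LINT x|lebesgue_on D. f x \<bullet> g x)"

definition l2_norm :: "(real^'d) set \<Rightarrow> (real^'d \<Rightarrow> 'b::euclidean_space) \<Rightarrow> real" where
  "l2_norm D f = sqrt (l2_inner D f f)"

definition partial :: "'d::finite \<Rightarrow> (real^'d \<Rightarrow> real) \<Rightarrow> real^'d \<Rightarrow> real" where
  "partial i f x = frechet_derivative f (at x) (axis i 1)"

text \<open>All partial derivatives being \<open>C\<^sup>k\<close> (hence continuous) makes the function \<open>C\<^sup>k\<^sup>+\<^sup>1\<close>.\<close>

primrec Ck :: "nat \<Rightarrow> (real^'d \<Rightarrow> real) \<Rightarrow> bool" where
  "Ck 0 f \<longleftrightarrow> continuous_on UNIV f"
| "Ck (Suc k) f \<longleftrightarrow> (\<forall>x. f differentiable at x) \<and> (\<forall>i. Ck k (partial i f))"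

definition test_functions :: "(real^'d) set \<Rightarrow> (real^'d \<Rightarrow> real) set" where
  "test_functions D = {\<phi>. (\<forall>k. Ck k \<phi>) \<and>
     compact (closure {x. \<phi> x \<noteq> 0}) \<and> closure {x. \<phi> x \<noteq> 0} \<subseteq> D}"

definition weak_partial ::
  "(real^'d) set \<Rightarrow> 'd \<Rightarrow> (real^'d \<Rightarrow> 'b::euclidean_space) \<Rightarrow> (real^'d \<Rightarrow> 'b) \<Rightarrow> bool" where
  "weak_partial D i f g \<longleftrightarrow> (\<forall>\<phi>\<in>test_functions D.
     (LINT x|lebesgue_on D. partial i \<phi> x *\<^sub>R f x) = - (LINT x|lebesgue_on D. \<phi> x *\<^sub>R g x))"

definition wpartial ::
  "(real^'d) set \<Rightarrow> 'd \<Rightarrow> (real^'d \<Rightarrow> 'b::euclidean_space) \<Rightarrow> real^'d \<Rightarrow> 'b" where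
  "wpartial D i f = (SOME g. g \<in> L2 D \<and> weak_partial D i f g)"

primrec sobolev :: "(real^'d) set \<Rightarrow> nat \<Rightarrow> (real^'d \<Rightarrow> 'b::euclidean_space) set" where
  "sobolev D 0 = L2 D"
| "sobolev D (Suc m) = {f \<in> L2 D. \<forall>i. \<exists>g\<in>sobolev D m. weak_partial D i f g}"

text \<open>
  Every ordered tuple of at most \<open>m\<close> derivatives contributes once; for \<open>m = 2\<close> the mixed second
  derivatives therefore occur twice, which gives a norm equivalent to the one over multi-indices.
\<close>

primrec sobolev_norm_sq ::
  "(real^'d) set \<Rightarrow> nat \<Rightarrow> (real^'d \<Rightarrow> 'b::euclidean_space) \<Rightarrow> real" where
  "sobolev_norm_sq D 0 f = (l2_norm D f)\<^sup>2"
| "sobolev_norm_sq D (Suc m) f =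
     (l2_norm D f)\<^sup>2 + (\<Sum>i\<in>UNIV. sobolev_norm_sq D m (wpartial D i f))"

definition sobolev_norm ::
  "(real^'d) set \<Rightarrow> nat \<Rightarrow> (real^'d \<Rightarrow> 'b::euclidean_space) \<Rightarrow> real" where
  "sobolev_norm D m f = sqrt (sobolev_norm_sq D m f)"

definition H10 :: "(real^'d) set \<Rightarrow> (real^'d \<Rightarrow> real) set" where
  "H10 D = {f \<in> sobolev D 1. \<forall>\<epsilon>>0. \<exists>\<phi>\<in>test_functions D. sobolev_norm D 1 (\<lambda>x. f x - \<phi> x) < \<epsilon>}"

definition wgrad :: "(real^'d) set \<Rightarrow> (real^'d \<Rightarrow> real) \<Rightarrow> real^'d \<Rightarrow> real^'d" where
  "wgrad D f x = (\<chi> i. wpartial D i f x)"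

definition wjacobian :: "(real^'d) set \<Rightarrow> (real^'d \<Rightarrow> real^'d) \<Rightarrow> real^'d \<Rightarrow> real^'d^'d" where
  "wjacobian D v x = (\<chi> i j. wpartial D j v x $ i)"

definition wdiv :: "(real^'d) set \<Rightarrow> (real^'d \<Rightarrow> real^'d) \<Rightarrow> real^'d \<Rightarrow> real" where
  "wdiv D v x = (\<Sum>i\<in>UNIV. wpartial D i v x $ i)"

section \<open>Regularity of the domain\<close>

definition stress ::
  "(real^'d) set \<Rightarrow> (real^'d \<Rightarrow> real^'d) \<Rightarrow> (real^'d \<Rightarrow> real) \<Rightarrow> real^'d \<Rightarrow> real^'d^'d" where
  "stress D v q x = wjacobian D v x + transpose (wjacobian D v x) - mat (q x)"

text \<open>
  Weak solutions of \<open>v - \<nabla>\<cdot>T(v,q) = g\<close>, \<open>\<nabla>\<cdot>v = 0\<close> in \<open>D\<close>, \<open>T(v,q) n = 0\<close> on \<open>\<partial>D\<close>.  The traction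
  condition is the natural boundary condition: it is expressed by admitting test fields that do not
  vanish on the boundary, so that neither traces nor the normal occur explicitly.
  The inner product on \<open>real^'d^'d\<close> is the Frobenius product.
\<close>

definition stokes_solution ::
  "(real^'d) set \<Rightarrow> (real^'d \<Rightarrow> real^'d) \<Rightarrow> (real^'d \<Rightarrow> real^'d) \<Rightarrow> (real^'d \<Rightarrow> real) \<Rightarrow> bool" where
  "stokes_solution D g v q \<longleftrightarrow> v \<in> sobolev D 1 \<and> q \<in> L2 D \<and>
     (AE x in lebesgue_on D. wdiv D v x = 0) \<and>
     (\<forall>\<phi>\<in>sobolev D 1.
        l2_inner D v \<phi> + l2_inner D (stress D v q) (wjacobian D \<phi>) = l2_inner D g \<phi>)"

definition stokes_regular :: "(real^'d) set \<Rightarrow> bool" where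
  "stokes_regular D \<longleftrightarrow> (\<exists>C. \<forall>g\<in>L2 D. \<forall>v q. stokes_solution D g v q \<longrightarrow>
     v \<in> sobolev D 2 \<and> q \<in> sobolev D 1 \<and>
     sobolev_norm D 2 v + sobolev_norm D 1 q \<le> C * l2_norm D g)"

definition dirichlet_solution ::
  "(real^'d) set \<Rightarrow> (real^'d \<Rightarrow> real) \<Rightarrow> (real^'d \<Rightarrow> real) \<Rightarrow> bool" where
  "dirichlet_solution D g \<eta> \<longleftrightarrow> \<eta> \<in> H10 D \<and>
     (\<forall>\<phi>\<in>H10 D. - l2_inner D (wgrad D \<eta>) (wgrad D \<phi>) = l2_inner D g \<phi>)"

definition dirichlet_regular :: "(real^'d) set \<Rightarrow> bool" where
  "dirichlet_regular D \<longleftrightarrow> (\<exists>C. \<forall>g\<in>L2 D. \<forall>\<eta>. dirichlet_solution D g \<eta> \<longrightarrow>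
     \<eta> \<in> sobolev D 2 \<and> sobolev_norm D 2 \<eta> \<le> C * l2_norm D g)"

section \<open>Triangulations and finite element spaces\<close>

definition ref_simplex :: "(real^'d) set" where
  "ref_simplex = convex hull (insert 0 Basis)"

text \<open>
  A triangulation is given by the set of its element maps; the cells, which may be curved, are the
  images of the reference simplex.  Two cells meet in a common proper face (possibly empty), and
  the cells fill \<open>closure D\<close> exactly, so the mesh fits the boundary.
\<close>

definition fitted_triangulation :: "(real^'d) set \<Rightarrow> (real^'d \<Rightarrow> real^'d) set \<Rightarrow> bool" where
  "fitted_triangulation D M \<longleftrightarrow> finite M \<and>
     (\<forall>F\<in>M. continuous_on ref_simplex F \<and> inj_on F ref_simplex) \<and>
     (\<Union>F\<in>M. F ` ref_simplex) = closure D \<and>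
     (\<forall>F\<in>M. \<forall>G\<in>M. F \<noteq> G \<longrightarrow>
        (\<exists>A B. A face_of ref_simplex \<and> A \<noteq> ref_simplex \<and> B face_of ref_simplex \<and> B \<noteq> ref_simplex \<and>
               F ` ref_simplex \<inter> G ` ref_simplex = F ` A \<and>
               F ` ref_simplex \<inter> G ` ref_simplex = G ` B))"

definition mesh_size :: "(real^'d \<Rightarrow> real^'d) set \<Rightarrow> real" where
  "mesh_size M = (MAX F\<in>M. diameter (F ` ref_simplex))"

definition quasi_uniform :: "real set \<Rightarrow> (real \<Rightarrow> (real^'d \<Rightarrow> real^'d) set) \<Rightarrow> bool" where
  "quasi_uniform H M \<longleftrightarrow>
     (\<exists>\<rho>>0. \<forall>h\<in>H. \<forall>F\<in>M h. \<exists>x. cball x (\<rho> * h) \<subseteq> F ` ref_simplex)"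

text \<open>
  A finite element space on the mesh \<open>M\<close>: a linear space of functions which on each cell belong to
  a local space of shape functions spanned by at most \<open>N\<close> functions.  As \<open>M\<close> is finite, such a
  space is finite-dimensional (modulo null sets).
\<close>

definition fe_space ::
  "(real^'d) set \<Rightarrow> (real^'d \<Rightarrow> real^'d) set \<Rightarrow> nat \<Rightarrow> (real^'d \<Rightarrow> 'b::euclidean_space) set \<Rightarrow> bool"
where
  "fe_space D M N V \<longleftrightarrow>
     (\<lambda>x. 0) \<in> V \<and> (\<forall>u\<in>V. \<forall>v\<in>V. (\<lambda>x. u x + v x) \<in> V) \<and> (\<forall>c. \<forall>v\<in>V. (\<lambda>x. c *\<^sub>R v x) \<in> V) \<and>
     (\<forall>F\<in>M. \<exists>B. finite B \<and> card B \<le> N \<and>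
        (\<forall>v\<in>V. \<exists>c. AE x in lebesgue_on (D \<inter> F ` ref_simplex). v x = (\<Sum>b\<in>B. c b *\<^sub>R b x)))"

section \<open>Assumptions on the spaces, for one mesh size and a given constant\<close>

definition fortin_projection ::
  "(real^'d) set \<Rightarrow> (real^'d \<Rightarrow> real^'d) set \<Rightarrow> (real^'d \<Rightarrow> real) set \<Rightarrow> real \<Rightarrow> real \<Rightarrow>
   ((real^'d \<Rightarrow> real^'d) \<Rightarrow> (real^'d \<Rightarrow> real^'d)) \<Rightarrow> bool" where
  "fortin_projection D Vh Qh h C P \<longleftrightarrow>
     (\<forall>v\<in>sobolev D 1. P v \<in> Vh) \<and>
     (\<forall>u\<in>sobolev D 1. \<forall>v\<in>sobolev D 1. \<forall>a b.
        AE x in lebesgue_on D. P (\<lambda>x. a *\<^sub>R u x + b *\<^sub>R v x) x = a *\<^sub>R P u x + b *\<^sub>R P v x) \<and>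
     (\<forall>v\<in>Vh. AE x in lebesgue_on D. P v x = v x) \<and>
     (\<forall>v\<in>sobolev D 1. \<forall>q\<in>Qh. l2_inner D (wdiv D (\<lambda>x. v x - P v x)) q = 0) \<and>
     (\<forall>v\<in>sobolev D 1. \<forall>m\<in>{0, 1}.
        sobolev_norm D m (\<lambda>x. v x - P v x) \<le> C * h ^ (1 - m) * sobolev_norm D 1 v) \<and>
     (\<forall>v\<in>sobolev D 1. sobolev_norm D 1 (P v) \<le> C * sobolev_norm D 1 v)"

definition pressure_approximation ::
  "(real^'d) set \<Rightarrow> (real^'d \<Rightarrow> real) set \<Rightarrow> real \<Rightarrow> real \<Rightarrow> bool" where
  "pressure_approximation D Qh h C \<longleftrightarrow> (\<forall>m\<in>{1, 2}.
     (\<forall>q\<in>sobolev D m.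
        (INF p\<in>Qh. l2_norm D (\<lambda>x. q x - p x)) \<le> C * h ^ m * sobolev_norm D m q) \<and>
     (\<forall>q\<in>sobolev D m \<inter> H10 D.
        (INF p\<in>Qh \<inter> H10 D. l2_norm D (\<lambda>x. q x - p x)) \<le> C * h ^ m * sobolev_norm D m q))"

definition inverse_inequality ::
  "(real^'d) set \<Rightarrow> (real^'d \<Rightarrow> real^'d) set \<Rightarrow> real \<Rightarrow> real \<Rightarrow> bool" where
  "inverse_inequality D Vh h C \<longleftrightarrow> (\<forall>v\<in>Vh. sobolev_norm D 1 v \<le> C * inverse h * l2_norm D v)"

text \<open>
  The supremum is taken in \<open>ennreal\<close>, where the empty supremum is \<open>0\<close>.  Truncating negative quotients
  to \<open>0\<close> does not change it, since \<open>v\<close> may be replaced by \<open>-v\<close>.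
\<close>

definition inf_sup_condition ::
  "(real^'d) set \<Rightarrow> (real^'d \<Rightarrow> real^'d) set \<Rightarrow> (real^'d \<Rightarrow> real) set \<Rightarrow> real \<Rightarrow> bool" where
  "inf_sup_condition D Vh Qh C \<longleftrightarrow> (\<forall>q\<in>Qh. ennreal (l2_norm D q) \<le> ennreal C *
     (SUP v\<in>{v \<in> Vh. \<not> (AE x in lebesgue_on D. v x = 0)}.
        ennreal (l2_inner D q (wdiv D v) / sobolev_norm D 1 v)))"

section \<open>The discrete Helmholtz decomposition\<close>

definition disc_div_free ::
  "(real^'d) set \<Rightarrow> (real^'d \<Rightarrow> real^'d) set \<Rightarrow> (real^'d \<Rightarrow> real) set \<Rightarrow> (real^'d \<Rightarrow> real^'d) set" where
  "disc_div_free D Vh Qh = {v \<in> Vh. \<forall>q\<in>Qh. l2_inner D (wdiv D v) q = 0}"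

definition disc_div_free_perp ::
  "(real^'d) set \<Rightarrow> (real^'d \<Rightarrow> real^'d) set \<Rightarrow> (real^'d \<Rightarrow> real) set \<Rightarrow> (real^'d \<Rightarrow> real^'d) set" where
  "disc_div_free_perp D Vh Qh = {z \<in> Vh. \<forall>w\<in>disc_div_free D Vh Qh. l2_inner D z w = 0}"

end

theory Submission
  imports Defs
begin

text \<open>
  Given \<open>v\<close> in \<open>V\<^sub>h\<close>, let \<open>\<eta>\<close> solve \<open>\<Delta>\<eta> = \<nabla>\<cdot>v\<close> with zero boundary values and put \<open>u = v - \<nabla>\<eta>\<close>, a divergence-free
  field with \<open>\<parallel>u\<parallel>\<^sub>1 \<le> C \<parallel>v\<parallel>\<^sub>1\<close>.  Then \<open>p = \<Pi>\<^sub>h u\<close> lies in \<open>X\<^sub>h\<close>, and for \<open>e = w\<^sub>h - p\<close> orthogonality of \<open>z\<^sub>h\<close> to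
  \<open>X\<^sub>h\<close> gives \<open>(e, e) = (u - p, e) + (\<nabla>\<eta>, e)\<close>.  The first term is at most \<open>C h \<parallel>v\<parallel>\<^sub>1 \<parallel>e\<parallel>\<close>.  The second equals
  \<open>-(\<eta> - q, \<nabla>\<cdot>e)\<close> for every \<open>q\<close> in \<open>Q\<^sub>h\<close>, hence is at most \<open>C h\<^sup>2 \<parallel>\<eta>\<parallel>\<^sub>2 \<parallel>e\<parallel>\<^sub>1 \<le> C h \<parallel>v\<parallel>\<^sub>1 \<parallel>e\<parallel>\<close> by the inverse
  inequality.  So \<open>\<parallel>e\<parallel> \<le> C h \<parallel>v\<parallel>\<^sub>1\<close>, and the inverse inequality once more yields \<open>\<parallel>e\<parallel>\<^sub>1 \<le> C \<parallel>v\<parallel>\<^sub>1\<close>.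
\<close>

section \<open>Smooth bump functions\<close>

text \<open>Since \<open>w\<close> is the L2-projection of \<open>v\<close> onto the discretely
  divergence-free fields, only its L2-norm is controlled for free, and the inverse inequality
  applied directly would cost a factor 1/h. A comparison field \<open>p\<close> with
  \<open>w - p\<close> of size h repairs this. It cannot approximate \<open>v\<close>, which is far
  from divergence free; but the part of \<open>v\<close> that is missed is a gradient, and a
  gradient is almost orthogonal to such fields: \<eta> vanishes on the boundary, discrete pressures
  can be subtracted from it, so h^2 is gained on \<eta> and only one h is lost on the divergence of
  \<open>e\<close>.

  Most of the work lies in the continuous problem. \<open>dirichlet_regular\<close> bounds solutions
  without supplying one, so \<eta> is built by minimising the energy over test functions, which
  takes a Poincare inequality and completeness of L2. That the divergence of the gradient of \<eta>
  equals that of \<open>v\<close> almost everywhere takes the fundamental lemma, hence bump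
  functions. As \<open>wpartial\<close> is an arbitrary choice, every linearity statement about it
  holds only up to null sets.\<close>

lemma partial_eqI:
  assumes "(f has_derivative f') (at x)"
  shows "partial i f x = f' (axis i 1)"
  unfolding partial_def using frechet_derivative_at[OF assms] by simp

lemma partial_const [simp]: "partial i (\<lambda>x. c) x = 0"
  by (rule partial_eqI[where f'="\<lambda>_. 0"]) simp

text \<open>The shape \<open>f + c * g\<close> covers sums (\<open>c = 1\<close>) and differences
  (\<open>c = -1\<close>) at once; L2 membership, inner products, weak derivatives and the discrete
  spaces are all treated in this form below.\<close>

lemma partial_lincomb:
  assumes "f differentiable at x" "g differentiable at x"
  shows "partial i (\<lambda>x. f x + c * g x) x = partial i f x + c * partial i g x"
  using has_derivative_add[OF frechet_derivative_works[THEN iffD1, OF assms(1)]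
      has_derivative_mult_right[OF frechet_derivative_works[THEN iffD1, OF assms(2)], of c]]
  by (subst partial_eqI) (auto simp: partial_def)

lemma partial_mult:
  assumes "f differentiable at x" "g differentiable at x"
  shows "partial i (\<lambda>x. f x * g x) x = f x * partial i g x + partial i f x * g x"
  using has_derivative_mult[OF frechet_derivative_works[THEN iffD1, OF assms(1)]
      frechet_derivative_works[THEN iffD1, OF assms(2)]]
  by (subst partial_eqI) (auto simp: partial_def)

lemma partial_component: "partial i (\<lambda>x. x $ i) x = 1"
  by (subst partial_eqI[where f'="\<lambda>h. h $ i"]) (auto intro!: bounded_linear_imp_has_derivative bounded_linear_vec_nth)

lemma Ck_lincomb:
  assumes "Ck k f" "Ck k g"
  shows "Ck k (\<lambda>x. f x + c * g x)"
  using assms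
proof (induction k arbitrary: f g)
  case 0
  then show ?case by (auto intro!: continuous_intros)
next
  case (Suc k)
  then have d: "\<And>x. f differentiable at x" "\<And>x. g differentiable at x" by auto
  have "partial i (\<lambda>x. f x + c * g x) = (\<lambda>x. partial i f x + c * partial i g x)" for i
    using partial_lincomb[OF d] by auto
  with Suc show ?case by (auto intro!: derivative_intros)
qed

text \<open>The functions \<open>t\<^sup>-\<^sup>k exp (-1/t)\<close>, \<open>t > 0\<close>, extended by \<open>0\<close>: their span is closed under differentiation.\<close>

definition flat :: "nat \<Rightarrow> real \<Rightarrow> real" where
  "flat k t = (if t > 0 then exp (- inverse t) * inverse t ^ k else 0)"

lemma flat_nonneg: "0 \<le> flat k t"
  by (auto simp: flat_def)

text \<open>With s = 1/t the right-hand limit is that of s^k / exp s at infinity: the exponential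
  beats every negative power of t.\<close>

lemma flat_tendsto_0: "(flat k \<longlongrightarrow> 0) (at 0)"
proof -
  have "((\<lambda>t. inverse t ^ k / exp (inverse t)) \<longlongrightarrow> (0::real)) (at_right 0)"
    by (rule filterlim_compose[OF tendsto_power_div_exp_0 filterlim_inverse_at_top_right])
  then have r: "(flat k \<longlongrightarrow> 0) (at_right 0)"
    by (rule Lim_transform_eventually)
      (auto simp: flat_def exp_minus field_simps eventually_at_right_less intro!: eventually_at_rightI[of 0 1])
  have l: "(flat k \<longlongrightarrow> 0) (at_left 0)"
    by (rule tendsto_eventually) (auto simp: flat_def eventually_at_filter)
  from r l show ?thesis by (simp add: filterlim_at_split)
qed

lemma DERIV_flat: "(flat k has_real_derivative (flat (k + 2) t - k * flat (k + 1) t)) (at t)"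
proof -
  consider "t > 0" | "t < 0" | "t = 0" by linarith
  then show ?thesis
  proof cases
    case 1
    have "((\<lambda>t. exp (- inverse t) * inverse t ^ k) has_real_derivative
        (flat (k + 2) t - k * flat (k + 1) t)) (at t)"
      using 1 by (auto intro!: derivative_eq_intros simp: flat_def)
        (cases k; simp add: field_simps)
    then show ?thesis
      by (rule has_field_derivative_transform_within_open[where S="{0<..}"])
        (use 1 in \<open>auto simp: flat_def\<close>)
  next
    case 2
    have "((\<lambda>t. 0) has_real_derivative 0) (at t)" by simp
    then have "(flat k has_real_derivative 0) (at t)"
      by (rule has_field_derivative_transform_within_open[where S="{..<0}"])
        (use 2 in \<open>auto simp: flat_def\<close>)
    then show ?thesis using 2 by (simp add: flat_def)
  next
    case 3
    \<comment> \<open>At 0 the difference quotient of \<open>flat k\<close> is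
      \<open>flat (k + 1)\<close> itself, whose limit is already known.\<close>
    have "((\<lambda>h. (flat k (0 + h) - flat k 0) / h) \<longlongrightarrow> 0) (at 0)"
      by (rule Lim_transform_eventually[OF flat_tendsto_0[of "k + 1"]])
        (auto simp: flat_def field_simps eventually_at_filter)
    then show ?thesis using 3 by (simp add: DERIV_def flat_def)
  qed
qed

text \<open>\<open>Ck k\<close> unfolds by recursion on \<open>k\<close> through partial
  derivatives, so smoothness is easiest for a class of differentiable functions closed under every
  \<open>partial i\<close>. Sums and products are included because the chain and product rules
  create them, constants for the inner derivatives.\<close>

inductive_set flat_algebra :: "(real^'d \<Rightarrow> real) set" where
  const: "(\<lambda>x. c) \<in> flat_algebra"
| flat: "(\<lambda>x. flat k (a * x $ i + b)) \<in> flat_algebra"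
| add: "f \<in> flat_algebra \<Longrightarrow> g \<in> flat_algebra \<Longrightarrow> (\<lambda>x. f x + g x) \<in> flat_algebra"
| mult: "f \<in> flat_algebra \<Longrightarrow> g \<in> flat_algebra \<Longrightarrow> (\<lambda>x. f x * g x) \<in> flat_algebra"

lemma flat_algebra_partial:
  assumes "f \<in> flat_algebra"
  shows "(\<forall>x. f differentiable at x) \<and> (\<forall>i. partial i f \<in> flat_algebra)"
  using assms
proof induction
  case (const c)
  have "partial i (\<lambda>x. c) = (\<lambda>x. 0)" for i :: 'a by auto
  then show ?case by (auto intro: flat_algebra.const)
next
  case (flat k a i b)
  have d: "((\<lambda>x. flat k (a * x $ i + b)) has_derivative
      (\<lambda>h. a * h $ i * (flat (k + 2) (a * x $ i + b) - k * flat (k + 1) (a * x $ i + b)))) (at x)" for x :: "real^'a"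
    by (rule DERIV_compose_FDERIV[OF DERIV_flat])
      (auto intro!: derivative_eq_intros bounded_linear.has_derivative[OF bounded_linear_vec_nth])
  have "partial j (\<lambda>x. flat k (a * x $ i + b)) = (\<lambda>x. (a * axis j 1 $ i) *
      (flat (k + 2) (a * x $ i + b) + (- real k) * flat (k + 1) (a * x $ i + b)))" for j
    by (rule ext, subst partial_eqI[OF d]) simp
  then have "partial j (\<lambda>x. flat k (a * x $ i + b)) \<in> flat_algebra" for j
    by (simp only:) (intro flat_algebra.mult flat_algebra.add flat_algebra.const flat_algebra.flat)
  with d show ?case
    by (auto intro: differentiableI)
next
  case (add f g)
  have "partial i (\<lambda>x. f x + g x) = (\<lambda>x. partial i f x + partial i g x)" for i
    using partial_lincomb[of f _ g i 1] add by auto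
  with add show ?case by (auto intro: flat_algebra.intros)
next
  case (mult f g)
  have "partial i (\<lambda>x. f x * g x) = (\<lambda>x. f x * partial i g x + partial i f x * g x)" for i
    using partial_mult[of f _ g i] mult by auto
  with mult show ?case by (auto intro!: flat_algebra.intros)
qed

lemma flat_algebra_Ck: "f \<in> flat_algebra \<Longrightarrow> Ck k f"
proof (induction k arbitrary: f)
  case 0
  then show ?case
    using flat_algebra_partial[OF 0] differentiable_imp_continuous_within
    by (auto simp: continuous_on_eq_continuous_at)
next
  case (Suc k)
  then show ?case using flat_algebra_partial by auto
qed

lemma flat_algebra_prod:
  "(\<And>i. i \<in> I \<Longrightarrow> f i \<in> flat_algebra) \<Longrightarrow> (\<lambda>x. \<Prod>i\<in>I. f i x) \<in> flat_algebra"
  by (induction I rule: infinite_finite_induct) (auto intro: flat_algebra.intros)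

lemma flat_algebra_compl:
  "f \<in> flat_algebra \<Longrightarrow> (\<lambda>x. 1 - f x) \<in> flat_algebra"
  using flat_algebra.add[OF flat_algebra.const[of 1] flat_algebra.mult[OF flat_algebra.const[of "- 1"]]]
  by simp

text \<open>A factor exp (-1/(n t)) tends to 1 for t > 0 and is 0 for t \<le> 0. Raising
  \<open>n\<close> thus sharpens the bump towards the indicator of the open box without moving its
  support.\<close>

definition box_bump :: "real \<Rightarrow> real^'d \<Rightarrow> real^'d \<Rightarrow> real^'d \<Rightarrow> real" where
  "box_bump n a b x = (\<Prod>i\<in>UNIV. flat 0 (n * (x $ i - a $ i)) * flat 0 (n * (b $ i - x $ i)))"

lemma box_bump_flat_algebra: "box_bump n a b \<in> flat_algebra"
proof -
  have "(\<lambda>x. flat 0 (n * (x $ i - a $ i))) \<in> flat_algebra"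
    "(\<lambda>x. flat 0 (n * (b $ i - x $ i))) \<in> flat_algebra" for i
    using flat_algebra.flat[of 0 n i "- n * a $ i"] flat_algebra.flat[of 0 "- n" i "n * b $ i"]
    by (simp_all add: algebra_simps)
  then have "(\<lambda>x. \<Prod>i\<in>UNIV. flat 0 (n * (x $ i - a $ i)) * flat 0 (n * (b $ i - x $ i)))
      \<in> flat_algebra"
    by (intro flat_algebra_prod flat_algebra.mult)
  then show ?thesis unfolding box_bump_def[abs_def] .
qed

lemma box_bump_range: "0 \<le> box_bump n a b x" "box_bump n a b x \<le> 1"
  unfolding box_bump_def
  by (auto intro!: prod_nonneg prod_le_1 mult_le_one simp: flat_nonneg)
    (auto simp: flat_def simp del: inverse_mult_distrib)

lemma box_bump_outside:
  assumes "n > 0" "x \<notin> box a b"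
  shows "box_bump n a b x = 0"
proof -
  from assms obtain i where "\<not> (a $ i < x $ i \<and> x $ i < b $ i)"
    by (auto simp: mem_box_cart)
  then have "flat 0 (n * (x $ i - a $ i)) * flat 0 (n * (b $ i - x $ i)) = 0"
    using assms(1) by (auto simp: flat_def zero_less_mult_iff)
  then show ?thesis unfolding box_bump_def by (intro prod_zero) auto
qed

lemma box_bump_tendsto_1:
  assumes "x \<in> box a b"
  shows "(\<lambda>n. box_bump (real (Suc n)) a b x) \<longlonglongrightarrow> 1"
proof -
  have *: "(\<lambda>n. flat 0 (real (Suc n) * c)) \<longlonglongrightarrow> 1" if "c > 0" for c
  proof -
    have "(\<lambda>n. exp (- (inverse c * inverse (real (Suc n))))) \<longlonglongrightarrow> exp (- (inverse c * 0))"
      by (intro tendsto_intros LIMSEQ_inverse_real_of_nat)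
    then show ?thesis using that
      by (simp add: flat_def zero_less_mult_iff mult.commute del: of_nat_Suc)
  qed
  have "(\<lambda>n. box_bump (real (Suc n)) a b x) \<longlonglongrightarrow> (\<Prod>i\<in>(UNIV::'a set). 1 * 1)"
    unfolding box_bump_def using assms
    by (intro tendsto_prod tendsto_mult *) (auto simp: mem_box_cart)
  then show ?thesis by simp
qed

text \<open>The open boxes do the covering, while the closed ones inside \<open>U\<close> will
  provide compact supports.\<close>

lemma open_UN_boxes:
  fixes U :: "(real^'d) set"
  assumes "open U"
  obtains a b :: "nat \<Rightarrow> real^'d"
  where "\<And>j. cbox (a j) (b j) \<subseteq> U" "U = (\<Union>j. box (a j) (b j))"
proof -
  define F where "F = {box a b |a b. cbox a b \<subseteq> U}"
  obtain F' where F': "F' \<subseteq> F" "countable F'" "\<Union>F' = \<Union>F"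
    using Lindelof[of F] by (auto simp: F_def)
  have "\<Union>F = U"
  proof
    show "\<Union>F \<subseteq> U" using box_subset_cbox by (fastforce simp: F_def)
    show "U \<subseteq> \<Union>F"
    proof
      fix x assume "x \<in> U"
      then obtain a b where "cbox a b \<subseteq> U" "x \<in> box a b"
        using assms by (meson open_contains_cbox)
      then show "x \<in> \<Union>F" by (auto simp: F_def)
    qed
  qed
  \<comment> \<open>The empty box, written with swapped corners, keeps the family nonempty even if
    \<open>U\<close> is empty, so that it can be enumerated by all natural numbers.\<close>
  have "{} \<in> F" unfolding F_def
    by (rule CollectI, rule exI[of _ 1], rule exI[of _ 0])
      (auto simp: set_eq_iff mem_box_cart, metis not_one_le_zero order_trans)
  define F'' where "F'' = insert {} F'"
  have c: "countable F''" "F'' \<noteq> {}" "F'' \<subseteq> F" "\<Union>F'' = U"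
    using F' \<open>{} \<in> F\<close> \<open>\<Union>F = U\<close> by (auto simp: F''_def)
  define e where "e = from_nat_into F''"
  have e: "range e = F''" unfolding e_def by (rule range_from_nat_into) (use c in auto)
  have "\<forall>j. \<exists>p. e j = box (fst p) (snd p) \<and> cbox (fst p) (snd p) \<subseteq> U"
  proof
    fix j
    have "e j \<in> F" using e c(3) by blast
    then obtain a b where "e j = box a b" "cbox a b \<subseteq> U" by (auto simp: F_def)
    then show "\<exists>p. e j = box (fst p) (snd p) \<and> cbox (fst p) (snd p) \<subseteq> U"
      by (intro exI[of _ "(a, b)"]) auto
  qed
  then obtain p where p: "\<And>j. e j = box (fst (p j)) (snd (p j))" "\<And>j. cbox (fst (p j)) (snd (p j)) \<subseteq> U"
    by metis
  show thesis
    by (rule that[of "\<lambda>j. fst (p j)" "\<lambda>j. snd (p j)"]) (use p e c(4) in auto)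
qed

lemma test_functions_approx_open:
  fixes U :: "(real^'d) set"
  assumes "open U" "U \<subseteq> D"
  obtains \<phi> where "\<And>n. \<phi> n \<in> test_functions D" "\<And>n x. 0 \<le> \<phi> n x \<and> \<phi> n x \<le> 1"
    "\<And>x. (\<lambda>n. \<phi> n x) \<longlonglongrightarrow> indicator U x"
proof -
  obtain a b :: "nat \<Rightarrow> real^'d"
    where ab: "\<And>j. cbox (a j) (b j) \<subseteq> U" "U = (\<Union>j. box (a j) (b j))"
    using open_UN_boxes[OF assms(1)] by metis
  define \<beta> where "\<beta> = (\<lambda>n j. box_bump (real (Suc n)) (a j) (b j))"
  \<comment> \<open>A smooth form of union: unlike a sum it stays in [0,1], it dominates each bump
    with \<open>j < n\<close>, and it vanishes where all of them do. The same \<open>n\<close> cuts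
    off the family and sharpens the bumps.\<close>
  define \<phi> where "\<phi> = (\<lambda>n x. 1 - (\<Prod>j<n. 1 - \<beta> n j x))"
  have \<beta>: "0 \<le> \<beta> n j x" "\<beta> n j x \<le> 1" for n j x
    unfolding \<beta>_def by (rule box_bump_range)+
  have p: "0 \<le> (\<Prod>j\<in>J. 1 - \<beta> n j x) \<and> (\<Prod>j\<in>J. 1 - \<beta> n j x) \<le> 1" for J n x
    using \<beta>[of n _ x] by (intro conjI prod_nonneg prod_le_1) auto
  have \<beta>0: "\<beta> n j x = 0" if "x \<notin> box (a j) (b j)" for n j x
    unfolding \<beta>_def using box_bump_outside[OF _ that] by simp
  have supp: "{x. \<phi> n x \<noteq> 0} \<subseteq> (\<Union>j<n. cbox (a j) (b j))" for n
  proof (rule subsetI, rule ccontr)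
    fix x assume "x \<in> {x. \<phi> n x \<noteq> 0}" and "x \<notin> (\<Union>j<n. cbox (a j) (b j))"
    then have "x \<notin> box (a j) (b j)" if "j < n" for j
      using that box_subset_cbox by blast
    then have "(\<Prod>j<n. 1 - \<beta> n j x) = (\<Prod>j<n. 1)"
      by (intro prod.cong) (auto simp: \<beta>0)
    with \<open>x \<in> _\<close> show False by (simp add: \<phi>_def)
  qed
  have comp: "compact (\<Union>j<n. cbox (a j) (b j))" for n
    by (intro compact_UN) auto
  have cl: "closure {x. \<phi> n x \<noteq> 0} \<subseteq> (\<Union>j<n. cbox (a j) (b j))" for n
    by (rule closure_minimal[OF supp compact_imp_closed[OF comp]])
  show thesis
  proof
    show "\<phi> n \<in> test_functions D" for n
    proof -
      have "\<phi> n \<in> flat_algebra"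
        unfolding \<phi>_def \<beta>_def
        by (intro flat_algebra_compl flat_algebra_prod box_bump_flat_algebra)
      then have "\<forall>k. Ck k (\<phi> n)" using flat_algebra_Ck by auto
      moreover have "compact (closure {x. \<phi> n x \<noteq> 0})"
        using bounded_subset[OF compact_imp_bounded[OF comp] supp] by simp
      moreover have "closure {x. \<phi> n x \<noteq> 0} \<subseteq> D"
        by (rule order_trans[OF cl], rule UN_least, rule order_trans[OF ab(1) assms(2)])
      ultimately show ?thesis by (simp add: test_functions_def)
    qed
    show "0 \<le> \<phi> n x \<and> \<phi> n x \<le> 1" for n x
      using p[where J="{..<n}" and n=n and x=x] by (simp add: \<phi>_def)
    show "(\<lambda>n. \<phi> n x) \<longlonglongrightarrow> indicator U x" for x
    proof (cases "x \<in> U")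
      case True
      then obtain j where j: "x \<in> box (a j) (b j)" using ab(2) by auto
      have "(\<lambda>n. \<beta> n j x) \<longlonglongrightarrow> 1" unfolding \<beta>_def by (rule box_bump_tendsto_1[OF j])
      moreover have "eventually (\<lambda>n. \<beta> n j x \<le> \<phi> n x) sequentially"
        using eventually_gt_at_top[of j]
      proof eventually_elim
        case (elim n)
        have "(\<Prod>i<n. 1 - \<beta> n i x) = (1 - \<beta> n j x) * (\<Prod>i\<in>{..<n} - {j}. 1 - \<beta> n i x)"
          using elim by (intro prod.remove) auto
        also have "\<dots> \<le> (1 - \<beta> n j x) * 1"
          using \<beta>[of n j x] p[where J="{..<n} - {j}" and n=n and x=x] by (intro mult_left_mono) auto
        finally show ?case by (simp add: \<phi>_def)
      qed
      moreover have "eventually (\<lambda>n. \<phi> n x \<le> 1) sequentially"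
        unfolding \<phi>_def using p by (intro always_eventually allI) (simp del: One_nat_def)
      ultimately have "(\<lambda>n. \<phi> n x) \<longlonglongrightarrow> 1"
        by (rule tendsto_sandwich[OF _ _ _ tendsto_const, rotated 2])
      then show ?thesis using True by simp
    next
      case False
      have "\<phi> n x = 0" for n
      proof (rule ccontr)
        assume "\<phi> n x \<noteq> 0"
        then have "x \<in> (\<Union>j<n. cbox (a j) (b j))" using supp[of n] by auto
        then show False using ab(1) False by auto
      qed
      then show ?thesis using False by simp
    qed
  qed
qed

section \<open>The space of square-integrable functions\<close>

text \<open>The quadratic is evaluated at its minimum t = -r/A; if A = 0 it is affine and can stay
  nonnegative only with r = 0. It serves both Cauchy-Schwarz and the residuals of
  near-minimisers.\<close>

lemma discriminant_nonneg:
  fixes A c r :: real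
  assumes "\<And>t. 0 \<le> c + 2 * t * r + t\<^sup>2 * A" "0 \<le> A"
  shows "r\<^sup>2 \<le> A * c"
proof (cases "A = 0")
  case True
  have "r = 0"
  proof (rule ccontr)
    assume "r \<noteq> 0"
    \<comment> \<open>This \<open>t\<close> makes the affine expression equal to -1.\<close>
    then show False using assms(1)[of "- (c + 1) / (2 * r)"] True by (simp add: field_simps)
  qed
  then show ?thesis using True by simp
next
  case False
  then have A: "A > 0" using assms(2) by simp
  have "0 \<le> c + 2 * (- r / A) * r + (- r / A)\<^sup>2 * A" by (rule assms(1))
  also have "\<dots> = c - r\<^sup>2 / A" using A by (simp add: field_simps power2_eq_square)
  finally show ?thesis using A by (simp add: field_simps)
qed

lemma L2_D: "f \<in> L2 D \<Longrightarrow> f \<in> borel_measurable (lebesgue_on D)"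
  "f \<in> L2 D \<Longrightarrow> integrable (lebesgue_on D) (\<lambda>x. (norm (f x))\<^sup>2)"
  by (auto simp: L2_def)

lemma L2_bound:
  fixes f :: "real^'d \<Rightarrow> 'b::euclidean_space"
  assumes "f \<in> borel_measurable (lebesgue_on D)" "integrable (lebesgue_on D) g"
    "\<And>x. x \<in> D \<Longrightarrow> (norm (f x))\<^sup>2 \<le> g x"
  shows "f \<in> L2 D"
  unfolding L2_def
proof (safe intro!: assms(1) Bochner_Integration.integrable_bound[OF assms(2)])
  show "(\<lambda>x. (norm (f x))\<^sup>2) \<in> borel_measurable (lebesgue_on D)"
    using assms(1) by measurable
  show "AE x in lebesgue_on D. norm ((norm (f x))\<^sup>2) \<le> norm (g x)"
    using assms(3) by (intro AE_I2) (fastforce intro: order_trans)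
qed

lemma norm_add_scaleR_sq_le:
  fixes x y :: "'b::real_inner"
  shows "(norm (x + c *\<^sub>R y))\<^sup>2 \<le> 2 * (norm x)\<^sup>2 + 2 * c\<^sup>2 * (norm y)\<^sup>2"
proof -
  have "0 \<le> (norm (x - c *\<^sub>R y))\<^sup>2" by simp
  then show ?thesis
    by (simp add: power2_norm_eq_inner inner_add inner_diff inner_commute)
      (simp add: power2_eq_square algebra_simps)
qed

lemma L2_lincomb:
  assumes "f \<in> L2 D" "g \<in> L2 D"
  shows "(\<lambda>x. f x + c *\<^sub>R g x) \<in> L2 D"
proof (rule L2_bound)
  note [measurable] = L2_D(1)[OF assms(1)] L2_D(1)[OF assms(2)]
  show "(\<lambda>x. f x + c *\<^sub>R g x) \<in> borel_measurable (lebesgue_on D)" by measurable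
  show "integrable (lebesgue_on D) (\<lambda>x. 2 * (norm (f x))\<^sup>2 + 2 * c\<^sup>2 * (norm (g x))\<^sup>2)"
    using L2_D(2)[OF assms(1)] L2_D(2)[OF assms(2)] by auto
qed (rule norm_add_scaleR_sq_le)

lemma L2_zero [simp]: "(\<lambda>x. 0) \<in> L2 D"
  by (auto simp: L2_def)

lemma L2_diff:
  assumes "f \<in> L2 D" "g \<in> L2 D"
  shows "(\<lambda>x. f x - g x) \<in> L2 D"
  using L2_lincomb[OF assms, of "-1"] by simp

lemma L2_scaleR: "g \<in> L2 D \<Longrightarrow> (\<lambda>x. c *\<^sub>R g x) \<in> L2 D"
  using L2_lincomb[OF L2_zero, of g D c] by simp

lemma L2_inner_integrable:
  assumes "f \<in> L2 D" "g \<in> L2 D"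
  shows "integrable (lebesgue_on D) (\<lambda>x. f x \<bullet> g x)"
proof (rule Bochner_Integration.integrable_bound)
  note [measurable] = L2_D(1)[OF assms(1)] L2_D(1)[OF assms(2)]
  show "integrable (lebesgue_on D) (\<lambda>x. (norm (f x))\<^sup>2 + (norm (g x))\<^sup>2)"
    using L2_D(2)[OF assms(1)] L2_D(2)[OF assms(2)] by auto
  show "(\<lambda>x. f x \<bullet> g x) \<in> borel_measurable (lebesgue_on D)" by measurable
  have "\<bar>f x \<bullet> g x\<bar> \<le> (norm (f x))\<^sup>2 + (norm (g x))\<^sup>2" for x
  proof -
    have "\<bar>f x \<bullet> g x\<bar> \<le> norm (f x) * norm (g x)" by (rule Cauchy_Schwarz_ineq2)
    moreover have "0 \<le> norm (f x) * norm (g x)" by simp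
    ultimately show ?thesis using sum_squares_bound[of "norm (f x)" "norm (g x)"] by linarith
  qed
  then show "AE x in lebesgue_on D. norm (f x \<bullet> g x) \<le> norm ((norm (f x))\<^sup>2 + (norm (g x))\<^sup>2)"
    by (intro AE_I2) simp
qed

lemma L2_component:
  assumes "f \<in> L2 D"
  shows "(\<lambda>x. f x \<bullet> b) \<in> L2 D"
proof (rule L2_bound)
  note [measurable] = L2_D(1)[OF assms]
  show "(\<lambda>x. f x \<bullet> b) \<in> borel_measurable (lebesgue_on D)" by measurable
  show "integrable (lebesgue_on D) (\<lambda>x. (norm (f x))\<^sup>2 * (norm b)\<^sup>2)"
    using L2_D(2)[OF assms] by auto
  show "(norm (f x \<bullet> b))\<^sup>2 \<le> (norm (f x))\<^sup>2 * (norm b)\<^sup>2" for x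
    using Cauchy_Schwarz_ineq2[of "f x" b]
    by (metis norm_ge_zero power_mono power_mult_distrib real_norm_def)
qed

lemma L2_nth: "f \<in> L2 D \<Longrightarrow> (\<lambda>x. f x $ i) \<in> L2 D"
  for f :: "real^'d \<Rightarrow> real^'n"
  using L2_component[of f D "axis i 1"] by (simp add: inner_axis)

lemma L2_sum: "(\<And>i. i \<in> I \<Longrightarrow> f i \<in> L2 D) \<Longrightarrow> (\<lambda>x. \<Sum>i\<in>I. f i x) \<in> L2 D"
  by (induction I rule: infinite_finite_induct)
    (auto dest: L2_lincomb[of _ D _ 1, simplified])

lemma L2_vec:
  fixes f :: "'n::finite \<Rightarrow> real^'d \<Rightarrow> real"
  assumes "\<And>i. f i \<in> L2 D"
  shows "(\<lambda>x. \<chi> i. f i x) \<in> L2 D"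
proof (rule L2_bound)
  have "(\<lambda>x. \<Sum>i\<in>UNIV. f i x *\<^sub>R axis i (1::real)) \<in> borel_measurable (lebesgue_on D)"
    using L2_D(1)[OF assms] by (intro borel_measurable_sum borel_measurable_scaleR) auto
  moreover have "(\<lambda>x. \<Sum>i\<in>UNIV. f i x *\<^sub>R axis i (1::real)) = (\<lambda>x. \<chi> i. f i x)"
    by (auto simp: vec_eq_iff axis_def if_distrib cong: if_cong)
  ultimately show "(\<lambda>x. \<chi> i. f i x) \<in> borel_measurable (lebesgue_on D)" by simp
  show "integrable (lebesgue_on D) (\<lambda>x. \<Sum>i\<in>UNIV. (norm (f i x))\<^sup>2)"
    using L2_D(2)[OF assms] by auto
qed (simp add: power2_norm_eq_inner inner_vec_def flip: power2_eq_square)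

section \<open>The L2 inner product and norm\<close>

lemma l2_inner_commute: "l2_inner D f g = l2_inner D g f"
  by (simp add: l2_inner_def inner_commute)

lemma l2_inner_lincomb:
  assumes "f \<in> L2 D" "g \<in> L2 D" "k \<in> L2 D"
  shows "l2_inner D (\<lambda>x. f x + c *\<^sub>R g x) k = l2_inner D f k + c * l2_inner D g k"
  using L2_inner_integrable[OF assms(1,3)] L2_inner_integrable[OF assms(2,3)]
  by (simp add: l2_inner_def inner_add_left)

lemma l2_inner_diff:
  assumes "f \<in> L2 D" "g \<in> L2 D" "k \<in> L2 D"
  shows "l2_inner D (\<lambda>x. f x - g x) k = l2_inner D f k - l2_inner D g k"
  using l2_inner_lincomb[OF assms, of "-1"] by simp

lemma l2_inner_sum:
  assumes "\<And>i. i \<in> I \<Longrightarrow> f i \<in> L2 D" "k \<in> L2 D"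
  shows "l2_inner D (\<lambda>x. \<Sum>i\<in>I. f i x) k = (\<Sum>i\<in>I. l2_inner D (f i) k)"
  unfolding l2_inner_def inner_sum_left
  by (rule Bochner_Integration.integral_sum) (use assms L2_inner_integrable in blast)

lemma l2_inner_nonneg [simp]: "0 \<le> l2_inner D f f"
  unfolding l2_inner_def by (rule integral_nonneg_AE) auto

lemma l2_norm_nonneg [simp]: "0 \<le> l2_norm D f"
  by (simp add: l2_norm_def)

lemma l2_norm_sq: "(l2_norm D f)\<^sup>2 = l2_inner D f f"
  by (simp add: l2_norm_def)

lemma l2_inner_cong_AE:
  assumes "f \<in> L2 D" "g \<in> L2 D" "f' \<in> L2 D" "g' \<in> L2 D"
    "AE x in lebesgue_on D. f x = f' x" "AE x in lebesgue_on D. g x = g' x"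
  shows "l2_inner D f g = l2_inner D f' g'"
  unfolding l2_inner_def
proof (rule integral_cong_AE)
  note [measurable] = assms(1-4)[THEN L2_D(1)]
  show "(\<lambda>x. f x \<bullet> g x) \<in> borel_measurable (lebesgue_on D)"
    "(\<lambda>x. f' x \<bullet> g' x) \<in> borel_measurable (lebesgue_on D)" by measurable
qed (use assms(5,6) in eventually_elim, simp)

lemma l2_norm_cong_AE:
  assumes "f \<in> L2 D" "f' \<in> L2 D" "AE x in lebesgue_on D. f x = f' x"
  shows "l2_norm D f = l2_norm D f'"
  unfolding l2_norm_def using l2_inner_cong_AE[OF assms(1,1,2,2,3,3)] by simp

lemma l2_inner_self_eq_0:
  assumes "f \<in> L2 D" "l2_inner D f f = 0"
  shows "AE x in lebesgue_on D. f x = 0"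
proof -
  have "AE x in lebesgue_on D. f x \<bullet> f x = 0"
    using integral_nonneg_eq_0_iff_AE[OF L2_inner_integrable[OF assms(1,1)]] assms(2)
    by (simp add: l2_inner_def)
  then show ?thesis by simp
qed

lemma l2_inner_quadratic:
  assumes "f \<in> L2 D" "g \<in> L2 D"
  shows "l2_inner D (\<lambda>x. f x + c *\<^sub>R g x) (\<lambda>x. f x + c *\<^sub>R g x)
    = l2_inner D f f + 2 * c * l2_inner D f g + c\<^sup>2 * l2_inner D g g"
proof -
  let ?s = "\<lambda>x. f x + c *\<^sub>R g x"
  have s: "?s \<in> L2 D" by (rule L2_lincomb[OF assms])
  have "l2_inner D ?s ?s = l2_inner D f ?s + c * l2_inner D g ?s"
    by (rule l2_inner_lincomb[OF assms s])
  also have "l2_inner D f ?s = l2_inner D f f + c * l2_inner D g f"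
    by (subst l2_inner_commute) (rule l2_inner_lincomb[OF assms assms(1)])
  also have "l2_inner D g ?s = l2_inner D f g + c * l2_inner D g g"
    by (subst l2_inner_commute) (rule l2_inner_lincomb[OF assms assms(2)])
  finally show ?thesis
    by (simp add: l2_inner_commute[of D g f] algebra_simps power2_eq_square)
qed

lemma l2_inner_le_norm:
  assumes "f \<in> L2 D" "g \<in> L2 D"
  shows "\<bar>l2_inner D f g\<bar> \<le> l2_norm D f * l2_norm D g"
proof -
  have "0 \<le> l2_inner D f f + 2 * t * l2_inner D f g + t\<^sup>2 * l2_inner D g g" for t
    using l2_inner_nonneg unfolding l2_inner_quadratic[OF assms, symmetric] .
  then have "(l2_inner D f g)\<^sup>2 \<le> l2_inner D g g * l2_inner D f f"
    by (rule discriminant_nonneg) simp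
  also have "\<dots> = (l2_norm D f * l2_norm D g)\<^sup>2"
    by (simp add: power_mult_distrib l2_norm_sq)
  finally show ?thesis
    by (simp add: abs_le_square_iff[symmetric] abs_mult)
qed

text \<open>The square of \<open>f - c g\<close> is nonnegative, as in the parallelogram law. This
  replaces the triangle inequality and is the origin of the factors 2 in the H1 bounds
  below.\<close>

lemma l2_norm_lincomb_sq_le:
  assumes "f \<in> L2 D" "g \<in> L2 D"
  shows "(l2_norm D (\<lambda>x. f x + c *\<^sub>R g x))\<^sup>2 \<le> 2 * (l2_norm D f)\<^sup>2 + 2 * c\<^sup>2 * (l2_norm D g)\<^sup>2"
proof -
  have "0 \<le> l2_inner D f f + 2 * (- c) * l2_inner D f g + (- c)\<^sup>2 * l2_inner D g g"
    using l2_inner_nonneg unfolding l2_inner_quadratic[OF assms, symmetric] .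
  then show ?thesis
    unfolding l2_norm_sq l2_inner_quadratic[OF assms] by (simp add: algebra_simps)
qed

lemma l2_norm_eq_nn_integral:
  assumes "f \<in> L2 D"
  shows "ennreal ((l2_norm D f)\<^sup>2) = (\<integral>\<^sup>+x. ennreal ((norm (f x))\<^sup>2) \<partial>lebesgue_on D)"
  using L2_D(2)[OF assms]
  by (subst nn_integral_eq_integral) (auto simp: l2_norm_sq l2_inner_def power2_norm_eq_inner)

lemma L2_nn_integralI:
  assumes "f \<in> borel_measurable (lebesgue_on D)"
    "(\<integral>\<^sup>+x. ennreal ((norm (f x))\<^sup>2) \<partial>lebesgue_on D) < \<infinity>"
  shows "f \<in> L2 D"
  using assms by (auto simp: L2_def integrable_iff_bounded)

text \<open>
  The Riesz representation theorem in an incomplete space: a sequence of near-minimisers of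
  \<open>a u u - 2 * l u\<close> is Cauchy and represents \<open>l\<close> in the limit.
\<close>

lemma riesz_sequence:
  fixes a :: "('x \<Rightarrow> real) \<Rightarrow> ('x \<Rightarrow> real) \<Rightarrow> real" and l :: "('x \<Rightarrow> real) \<Rightarrow> real"
  assumes T: "(\<lambda>x. 0) \<in> T" "\<And>u v c. u \<in> T \<Longrightarrow> v \<in> T \<Longrightarrow> (\<lambda>x. u x + c * v x) \<in> T"
    and a: "\<And>u v w c. u \<in> T \<Longrightarrow> v \<in> T \<Longrightarrow> w \<in> T \<Longrightarrow> a (\<lambda>x. u x + c * v x) w = a u w + c * a v w"
      "\<And>u v. u \<in> T \<Longrightarrow> v \<in> T \<Longrightarrow> a u v = a v u" "\<And>u. u \<in> T \<Longrightarrow> 0 \<le> a u u"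
    and l: "\<And>u v c. u \<in> T \<Longrightarrow> v \<in> T \<Longrightarrow> l (\<lambda>x. u x + c * v x) = l u + c * l v"
      "\<And>u. u \<in> T \<Longrightarrow> (l u)\<^sup>2 \<le> K * a u u" "0 \<le> K"
  obtains \<phi> :: "nat \<Rightarrow> 'x \<Rightarrow> real" where "\<And>n. \<phi> n \<in> T"
    "\<And>n v. v \<in> T \<Longrightarrow> (a (\<phi> n) v - l v)\<^sup>2 \<le> a v v / Suc n"
    "\<And>m n. a (\<lambda>x. \<phi> m x - \<phi> n x) (\<lambda>x. \<phi> m x - \<phi> n x) \<le> 2 / Suc m + 2 / Suc n"
proof -
  define q where "q = (\<lambda>u. a u u - 2 * l u)"
  have q: "q (\<lambda>x. u x + t * v x) = q u + 2 * t * (a u v - l v) + t\<^sup>2 * a v v"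
    if [simp]: "u \<in> T" "v \<in> T" for u v t
  proof -
    have "a (\<lambda>x. u x + t * v x) (\<lambda>x. u x + t * v x)
      = a u (\<lambda>x. u x + t * v x) + t * a v (\<lambda>x. u x + t * v x)" by (simp add: a(1) T)
    also have "a u (\<lambda>x. u x + t * v x) = a u u + t * a v u"
      by (subst a(2)) (simp_all add: a(1) T)
    also have "a v (\<lambda>x. u x + t * v x) = a u v + t * a v v"
      by (subst a(2)) (simp_all add: a(1) T)
    finally show ?thesis
      by (simp add: q_def l(1) a(2)[of v u] algebra_simps power2_eq_square)
  qed
  \<comment> \<open>Boundedness of \<open>l\<close> enters here: (K - a u u)^2 \<ge> 0 bounds 2 sqrt
    (K * a u u) by \<open>K + a u u\<close>.\<close>
  have lower: "- K \<le> q u" if "u \<in> T" for u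
  proof -
    have "(2 * l u)\<^sup>2 \<le> 4 * (K * a u u)" using l(2)[OF that] by (simp add: power_mult_distrib)
    also have "\<dots> \<le> (K + a u u)\<^sup>2"
      using zero_le_power2[of "K - a u u"] by (simp add: power2_eq_square algebra_simps)
    finally have "2 * l u \<le> K + a u u"
      by (rule power2_le_imp_le) (use l(3) a(3)[OF that] in auto)
    then show ?thesis by (simp add: q_def)
  qed
  define m where "m = (INF u\<in>T. q u)"
  have bdd: "bdd_below (q ` T)" using lower by (intro bdd_belowI2) auto
  have m: "m \<le> q u" if "u \<in> T" for u
    unfolding m_def using bdd that by (rule cINF_lower)
  have "\<exists>u\<in>T. q u < m + 1 / Suc n" for n
    using cInf_lessD[of "q ` T" "m + 1 / Suc n"] T(1) by (auto simp: m_def)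
  then obtain \<phi> where \<phi>: "\<And>n. \<phi> n \<in> T" "\<And>n. q (\<phi> n) < m + 1 / Suc n" by metis
  \<comment> \<open>Along the line \<open>\<phi> n + t v\<close> the functional never drops below
    \<open>m\<close>, yet it starts within 1/(n+1) of it. The discriminant of this quadratic in
    \<open>t\<close> bounds its linear coefficient, the residual.\<close>
  have res: "(a (\<phi> n) v - l v)\<^sup>2 \<le> a v v / Suc n" if "v \<in> T" for n v
  proof -
    have "(a (\<phi> n) v - l v)\<^sup>2 \<le> a v v * (1 / Suc n)"
    proof (rule discriminant_nonneg[OF _ a(3)[OF that]])
      fix t
      have "m \<le> q (\<phi> n) + 2 * t * (a (\<phi> n) v - l v) + t\<^sup>2 * a v v"
        using m[OF T(2)[OF \<phi>(1) that]] q[OF \<phi>(1) that] by metis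
      then show "0 \<le> 1 / Suc n + 2 * t * (a (\<phi> n) v - l v) + t\<^sup>2 * a v v"
        using \<phi>(2)[of n] by linarith
    qed
    then show ?thesis by simp
  qed
  \<comment> \<open>\<open>a d d\<close> is the difference of the residuals of
    \<open>\<phi> m\<close> and \<open>\<phi> n\<close>, both tested with \<open>d\<close> itself.
    Each square is at most a multiple of \<open>a d d\<close>, so one factor \<open>a d d\<close>
    cancels.\<close>
  have cauchy: "a (\<lambda>x. \<phi> m x - \<phi> n x) (\<lambda>x. \<phi> m x - \<phi> n x) \<le> 2 / Suc m + 2 / Suc n" for m n
  proof -
    define d where "d = (\<lambda>x. \<phi> m x + (- 1) * \<phi> n x)"
    have d: "d \<in> T" unfolding d_def by (rule T(2)[OF \<phi>(1) \<phi>(1)])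
    have "a d d = a (\<phi> m) d + (- 1) * a (\<phi> n) d"
      unfolding d_def by (rule a(1)[OF \<phi>(1) \<phi>(1)]) (use d in \<open>simp add: d_def\<close>)
    then have "a d d = (a (\<phi> m) d - l d) + (l d - a (\<phi> n) d)" by simp
    then have "(a d d)\<^sup>2 \<le> 2 * (a (\<phi> m) d - l d)\<^sup>2 + 2 * (a (\<phi> n) d - l d)\<^sup>2"
      using zero_le_power2[of "(a (\<phi> m) d - l d) - (l d - a (\<phi> n) d)"]
      by (simp only: power2_eq_square) (simp add: algebra_simps)
    also have "\<dots> \<le> 2 * (a d d / Suc m) + 2 * (a d d / Suc n)"
      using res[OF d] by (intro add_mono mult_left_mono) auto
    also have "\<dots> = a d d * (2 / Suc m + 2 / Suc n)" by (simp add: algebra_simps)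
    finally have *: "a d d * a d d \<le> a d d * (2 / Suc m + 2 / Suc n)"
      by (simp only: power2_eq_square)
    have "a d d \<le> 2 / Suc m + 2 / Suc n"
    proof (cases "a d d = 0")
      case False
      then have "0 < a d d" using a(3)[OF d] by simp
      then show ?thesis using mult_le_cancel_left_pos * by blast
    qed simp
    then show ?thesis by (simp add: d_def)
  qed
  show thesis using that \<phi>(1) res cauchy by blast
qed

text \<open>The weighted inequality f \<le> 2^n f^2 + 2^(-n) trades the square for a first power.
  With integrals of f^2 below 4^(-n) and finite total measure, both terms sum to something finite,
  so the series has finite integral.\<close>

lemma (in finite_measure) summable_AE_if_geometric_square:
  fixes f :: "nat \<Rightarrow> 'a \<Rightarrow> real"
  assumes [measurable]: "\<And>n. f n \<in> borel_measurable M" and nn: "\<And>n x. 0 \<le> f n x"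
    and b: "\<And>n. (\<integral>\<^sup>+x. ennreal ((f n x)\<^sup>2) \<partial>M) \<le> ennreal ((1 / 4) ^ n)"
  shows "AE x in M. summable (\<lambda>n. f n x)"
proof -
  define m where "m = measure M (space M)"
  have pt: "f n x \<le> 2 ^ n * (f n x)\<^sup>2 + (1 / 2) ^ n" for n x
  proof -
    have "0 \<le> 2 ^ n * (f n x - (1/2)^n / 2)\<^sup>2" by simp
    also have "\<dots> = 2 ^ n * (f n x)\<^sup>2 - f n x + (1/2)^n / 4"
      by (simp add: power2_eq_square algebra_simps power_one_over)
    also have "\<dots> \<le> 2 ^ n * (f n x)\<^sup>2 - f n x + (1/2)^n" by simp
    finally show ?thesis by simp
  qed
  have I: "(\<integral>\<^sup>+x. ennreal (f n x) \<partial>M) \<le> ennreal ((1 + m) * (1 / 2) ^ n)" for n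
  proof -
    have "(\<integral>\<^sup>+x. ennreal (f n x) \<partial>M) \<le> (\<integral>\<^sup>+x. ennreal (2 ^ n) * ennreal ((f n x)\<^sup>2) + ennreal ((1 / 2) ^ n) \<partial>M)"
      using pt by (intro nn_integral_mono) (simp flip: ennreal_mult ennreal_plus)
    also have "\<dots> = ennreal (2 ^ n) * (\<integral>\<^sup>+x. ennreal ((f n x)\<^sup>2) \<partial>M) + ennreal ((1 / 2) ^ n) * emeasure M (space M)"
      by (subst nn_integral_add) (auto simp: nn_integral_cmult)
    also have "\<dots> \<le> ennreal (2 ^ n) * ennreal ((1 / 4) ^ n) + ennreal ((1 / 2) ^ n) * ennreal m"
      using b[of n] by (intro add_mono mult_left_mono) (auto simp: m_def emeasure_eq_measure)
    also have "\<dots> = ennreal (2 ^ n * (1 / 4) ^ n + (1 / 2) ^ n * m)"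
      by (simp add: m_def flip: ennreal_mult ennreal_plus)
    also have "(2::real) ^ n * (1 / 4) ^ n + (1 / 2) ^ n * m = (1 + m) * (1 / 2) ^ n"
      by (simp add: algebra_simps flip: power_mult_distrib)
    finally show ?thesis .
  qed
  have "(\<integral>\<^sup>+x. (\<Sum>n. ennreal (f n x)) \<partial>M) = (\<Sum>n. \<integral>\<^sup>+x. ennreal (f n x) \<partial>M)"
    by (rule nn_integral_suminf) auto
  also have "\<dots> \<le> (\<Sum>n. ennreal ((1 + m) * (1 / 2) ^ n))"
    by (intro suminf_le I) auto
  also have "\<dots> = ennreal (\<Sum>n. (1 + m) * (1 / 2) ^ n)"
    by (rule suminf_ennreal2) (auto simp: m_def intro!: summable_mult summable_geometric)
  also have "\<dots> < \<infinity>" by simp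
  finally have "AE x in M. (\<Sum>n. ennreal (f n x)) \<noteq> \<infinity>"
    by (intro nn_integral_PInf_AE) auto
  then show ?thesis
    by eventually_elim (use nn in \<open>auto intro: summable_suminf_not_top\<close>)
qed

text \<open>The Riesz-Fischer argument: a subsequence with geometrically small steps converges
  almost everywhere, and Fatou's lemma carries the Cauchy bounds over to its limit.\<close>

lemma L2_complete:
  fixes f :: "nat \<Rightarrow> real^'d \<Rightarrow> 'b::euclidean_space"
  assumes D: "D \<in> lmeasurable" and f: "\<And>n. f n \<in> L2 D"
    and cauchy: "\<And>e. 0 < e \<Longrightarrow> \<exists>N. \<forall>m\<ge>N. \<forall>n\<ge>N. (l2_norm D (\<lambda>x. f m x - f n x))\<^sup>2 \<le> e"
  obtains g where "g \<in> L2 D" "(\<lambda>n. l2_norm D (\<lambda>x. f n x - g x)) \<longlonglongrightarrow> 0"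
proof -
  interpret finite_measure "lebesgue_on D" by (rule finite_measure_lebesgue_on[OF D])
  note [measurable] = f[THEN L2_D(1)]
  obtain N where N: "\<And>k m n. N k \<le> m \<Longrightarrow> N k \<le> n \<Longrightarrow> (l2_norm D (\<lambda>x. f m x - f n x))\<^sup>2 \<le> (1 / 4) ^ k"
    using cauchy[of "(1 / 4) ^ _"] by (simp) metis
  \<comment> \<open>Partial sums give a monotone sequence of indices above \<open>N k\<close>; the
    summand 1 gives \<open>k \<le> r k\<close>, so that late members of the subsequence are also
    late in the original sequence.\<close>
  define r where "r = (\<lambda>k. \<Sum>j\<le>k. N j + 1)"
  have rN: "N k \<le> r k" for k unfolding r_def
    by (rule order_trans[OF _ member_le_sum[of k]]) auto
  have rS: "r k \<le> r (Suc k)" for k by (simp add: r_def)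
  have rk: "k \<le> r k" for k by (induction k) (auto simp: r_def)
  define h where "h = (\<lambda>k. f (r k))"
  have [measurable]: "h k \<in> borel_measurable (lebesgue_on D)" for k by (simp add: h_def)
  have "AE x in lebesgue_on D. summable (\<lambda>k. norm (h (Suc k) x - h k x))"
  proof (rule summable_AE_if_geometric_square)
    fix k
    have "(\<integral>\<^sup>+x. ennreal ((norm (h (Suc k) x - h k x))\<^sup>2) \<partial>lebesgue_on D)
        = ennreal ((l2_norm D (\<lambda>x. h (Suc k) x - h k x))\<^sup>2)"
      unfolding h_def by (rule l2_norm_eq_nn_integral[symmetric]) (intro L2_diff f)
    also have "\<dots> \<le> ennreal ((1 / 4) ^ k)"
      unfolding h_def using rN[of k] rS[of k] by (intro ennreal_leI N) auto
    finally show "(\<integral>\<^sup>+x. ennreal ((norm (h (Suc k) x - h k x))\<^sup>2) \<partial>lebesgue_on D) \<le> ennreal ((1 / 4) ^ k)" .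
  qed auto
  then have "AE x in lebesgue_on D. convergent (\<lambda>k. h k x)"
  proof eventually_elim
    case (elim x)
    then have "summable (\<lambda>k. h (Suc k) x - h k x)" by (rule summable_norm_cancel)
    then have "convergent (\<lambda>n. \<Sum>k<n. h (Suc k) x - h k x)" by (simp add: summable_iff_convergent)
    then have "convergent (\<lambda>n. h n x - h 0 x)" by (simp only: sum_lessThan_telescope[of "\<lambda>k. h k x"])
    then have "convergent (\<lambda>n. (h n x - h 0 x) + h 0 x)" by (intro convergent_add convergent_const)
    then show ?case by simp
  qed
  then have conv: "AE x in lebesgue_on D. (\<lambda>k. h k x) \<longlonglongrightarrow> lim (\<lambda>k. h k x)"
    by eventually_elim (simp add: convergent_LIMSEQ_iff)
  define g where "g = (\<lambda>x. lim (\<lambda>k. h k x))"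
  have [measurable]: "g \<in> borel_measurable (lebesgue_on D)"
    unfolding g_def by (rule borel_measurable_lim_metric) simp
  \<comment> \<open>The limit is taken in the second index only. The estimate therefore holds for
    the whole sequence, and it yields both membership of \<open>g\<close> in L2 and convergence to
    it.\<close>
  have fatou: "(\<integral>\<^sup>+x. ennreal ((norm (f n x - g x))\<^sup>2) \<partial>lebesgue_on D) \<le> ennreal ((1 / 4) ^ k)"
    if "N k \<le> n" for n k
  proof -
    have "(\<integral>\<^sup>+x. ennreal ((norm (f n x - g x))\<^sup>2) \<partial>lebesgue_on D)
        = (\<integral>\<^sup>+x. liminf (\<lambda>j. ennreal ((norm (f n x - h j x))\<^sup>2)) \<partial>lebesgue_on D)"
    proof (rule nn_integral_cong_AE)
      show "AE x in lebesgue_on D. ennreal ((norm (f n x - g x))\<^sup>2)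
          = liminf (\<lambda>j. ennreal ((norm (f n x - h j x))\<^sup>2))"
        using conv
      proof eventually_elim
        case (elim x)
        have "(\<lambda>j. ennreal ((norm (f n x - h j x))\<^sup>2)) \<longlonglongrightarrow> ennreal ((norm (f n x - g x))\<^sup>2)"
          unfolding g_def by (intro tendsto_intros elim)
        then show ?case by (rule lim_imp_Liminf[symmetric, rotated]) simp
      qed
    qed
    also have "\<dots> \<le> liminf (\<lambda>j. \<integral>\<^sup>+x. ennreal ((norm (f n x - h j x))\<^sup>2) \<partial>lebesgue_on D)"
      by (rule nn_integral_liminf) measurable
    also have "\<dots> \<le> liminf (\<lambda>j. ennreal ((1 / 4) ^ k))"
    proof (rule Liminf_mono)
      show "\<forall>\<^sub>F j in sequentially. (\<integral>\<^sup>+x. ennreal ((norm (f n x - h j x))\<^sup>2) \<partial>lebesgue_on D) \<le> ennreal ((1 / 4) ^ k)"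
        using eventually_ge_at_top[of "N k"]
      proof eventually_elim
        case (elim j)
        have "(\<integral>\<^sup>+x. ennreal ((norm (f n x - h j x))\<^sup>2) \<partial>lebesgue_on D)
            = ennreal ((l2_norm D (\<lambda>x. f n x - h j x))\<^sup>2)"
          unfolding h_def by (rule l2_norm_eq_nn_integral[symmetric]) (intro L2_diff f)
        also have "\<dots> \<le> ennreal ((1 / 4) ^ k)"
          unfolding h_def using rk[of j] elim that by (intro ennreal_leI N) auto
        finally show ?case .
      qed
    qed
    also have "\<dots> = ennreal ((1 / 4) ^ k)" by (simp add: Liminf_const)
    finally show ?thesis .
  qed
  have d: "(\<lambda>x. f n x - g x) \<in> L2 D" if "N k \<le> n" for n k
    by (rule L2_nn_integralI) (use fatou[OF that] in \<open>auto intro: le_less_trans\<close>)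
  have "(\<lambda>x. f (N 0) x - (f (N 0) x - g x)) \<in> L2 D"
    by (rule L2_diff[OF f d]) auto
  then have g: "g \<in> L2 D" by simp
  have small: "(l2_norm D (\<lambda>x. f n x - g x))\<^sup>2 \<le> (1 / 4) ^ k" if "N k \<le> n" for n k
    using fatou[OF that] l2_norm_eq_nn_integral[OF d[OF that]] by (metis ennreal_le_iff zero_le_power zero_le_divide_1_iff zero_le_numeral)
  have "(\<lambda>n. (l2_norm D (\<lambda>x. f n x - g x))\<^sup>2) \<longlonglongrightarrow> 0"
  proof (rule LIMSEQ_I)
    fix e :: real assume "0 < e"
    then obtain k where k: "(1 / 4 :: real) ^ k < e"
      using real_arch_pow_inv[of e "1 / 4"] by auto
    show "\<exists>n0. \<forall>n\<ge>n0. norm ((l2_norm D (\<lambda>x. f n x - g x))\<^sup>2 - 0) < e"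
      using small[of k] k by (intro exI[of _ "N k"]) fastforce
  qed
  then have "(\<lambda>n. sqrt ((l2_norm D (\<lambda>x. f n x - g x))\<^sup>2)) \<longlonglongrightarrow> sqrt 0"
    by (rule tendsto_real_sqrt)
  then show thesis using that[OF g] by simp
qed

section \<open>Integration by parts and the fundamental lemma of the calculus of variations\<close>

lemma test_functions_0 [simp]: "(\<lambda>x. 0) \<in> test_functions D"
proof -
  have "(\<lambda>x::real^'a. 0::real) \<in> flat_algebra" by (rule flat_algebra.const)
  then show ?thesis using flat_algebra_Ck by (auto simp: test_functions_def)
qed

lemma test_functions_lincomb:
  assumes "\<phi> \<in> test_functions D" "\<psi> \<in> test_functions D"
  shows "(\<lambda>x. \<phi> x + c * \<psi> x) \<in> test_functions D"
proof -
  let ?K = "closure {x. \<phi> x \<noteq> 0} \<union> closure {x. \<psi> x \<noteq> 0}"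
  have K: "compact ?K" "?K \<subseteq> D" using assms by (auto simp: test_functions_def)
  have "{x. \<phi> x + c * \<psi> x \<noteq> 0} \<subseteq> ?K"
    using closure_subset[of "{x. \<phi> x \<noteq> 0}"] closure_subset[of "{x. \<psi> x \<noteq> 0}"]
    by (smt (verit) Un_iff mem_Collect_eq mult_eq_0_iff subset_iff)
  then have cl: "closure {x. \<phi> x + c * \<psi> x \<noteq> 0} \<subseteq> ?K"
    by (rule closure_minimal[OF _ compact_imp_closed[OF K(1)]])
  then have "compact (closure {x. \<phi> x + c * \<psi> x \<noteq> 0})"
    using bounded_subset[OF compact_imp_bounded[OF K(1)] cl] by (simp add: compact_eq_bounded_closed)
  with cl K(2) assms show ?thesis by (auto simp: test_functions_def intro: Ck_lincomb)
qed

lemma test_functionsD: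
  assumes "\<phi> \<in> test_functions D"
  shows "continuous_on UNIV \<phi>" "\<phi> differentiable at x" "continuous_on UNIV (partial i \<phi>)"
proof -
  have "Ck 0 \<phi>" "Ck (Suc 0) \<phi>" using assms unfolding test_functions_def by blast+
  then show "continuous_on UNIV \<phi>" "\<phi> differentiable at x" "continuous_on UNIV (partial i \<phi>)" by auto
qed

lemma partial_line_derivative:
  assumes "\<And>x. u differentiable at x"
  shows "((\<lambda>t. u (x + t *\<^sub>R axis i 1)) has_real_derivative partial i u (x + t *\<^sub>R axis i 1)) (at t)"
proof -
  let ?y = "x + t *\<^sub>R axis i 1"
  have d: "(u has_derivative frechet_derivative u (at ?y)) (at ?y)"
    using assms frechet_derivative_works by blast
  have "((\<lambda>t. u (x + t *\<^sub>R axis i 1)) has_derivative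
      (\<lambda>h. frechet_derivative u (at ?y) (h *\<^sub>R axis i 1))) (at t)"
    by (rule has_derivative_compose[of "\<lambda>t. x + t *\<^sub>R axis i 1" _ t _ u])
      (auto intro!: derivative_eq_intros d)
  moreover have "frechet_derivative u (at ?y) (h *\<^sub>R axis i 1) = partial i u ?y * h" for h
    using linear_frechet_derivative[OF assms, of ?y] by (simp add: linear_cmul partial_def)
  ultimately show ?thesis by (simp add: has_field_derivative_def)
qed

lemma lborel_integral_translation:
  fixes u :: "'a::euclidean_space \<Rightarrow> real"
  assumes [measurable]: "u \<in> borel_measurable borel"
  shows "(LINT x|lborel. u (c + x)) = (LINT x|lborel. u x)"
proof -
  have "(LINT x|lborel. u x) = (LINT x|distr lborel borel ((+) c). u x)"
    by (simp add: lborel_distr_plus)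
  also have "\<dots> = (LINT x|lborel. u (c + x))"
    by (rule integral_distr) auto
  finally show ?thesis ..
qed

text \<open>
  The difference quotients in direction \<open>i\<close> have integral \<open>0\<close> by translation invariance and converge
  dominatedly to the partial derivative.
\<close>

lemma integral_partial_eq_0:
  fixes u :: "real^'d \<Rightarrow> real"
  assumes u: "\<And>x. u differentiable at x" "continuous_on UNIV (partial i u)"
    and K: "compact K" "\<And>x. x \<notin> K \<Longrightarrow> u x = 0"
  shows "(LINT x|lborel. partial i u x) = 0"
proof -
  define e where "e = axis i (1::real)"
  have ne: "norm e = 1" by (simp add: e_def)
  have cu: "continuous_on UNIV u"
    using u(1) by (auto intro!: continuous_at_imp_continuous_on differentiable_imp_continuous_within)
  then have [measurable]: "u \<in> borel_measurable borel" by (rule borel_measurable_continuous_onI)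
  have [measurable]: "partial i u \<in> borel_measurable borel"
    using u(2) by (rule borel_measurable_continuous_onI)
  have p0: "partial i u x = 0" if "x \<notin> K" for x
  proof (rule partial_eqI)
    show "(u has_derivative (\<lambda>_. 0)) (at x)"
      by (rule has_derivative_transform_within_open[of "\<lambda>_. 0" _ _ _ "- K"])
        (use that K in \<open>auto intro: compact_imp_closed\<close>)
  qed
  have "bounded (partial i u ` K)"
    using u(2) K(1) by (auto intro!: compact_imp_bounded compact_continuous_image elim: continuous_on_subset)
  then obtain B where "B > 0" and "\<And>x. x \<in> K \<Longrightarrow> \<bar>partial i u x\<bar> \<le> B"
    unfolding bounded_pos by auto
  then have B: "\<bar>partial i u x\<bar> \<le> B" for x using p0[of x] by (cases "x \<in> K") auto
  obtain R where R: "\<And>x. x \<in> K \<Longrightarrow> norm x \<le> R"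
    using compact_imp_bounded[OF K(1)] by (auto simp: bounded_iff)
  define s where "s = (\<lambda>n. inverse (real (Suc n)))"
  have s: "0 < s n" "s n \<le> 1" for n by (auto simp: s_def field_simps)
  define d where "d = (\<lambda>n x. (u (x + s n *\<^sub>R e) - u x) / s n)"
  have [measurable]: "d n \<in> borel_measurable borel" for n unfolding d_def by measurable
  \<comment> \<open>By the mean value theorem a difference quotient is a value of the partial
    derivative. Steps of length at most 1 keep all supports inside one ball, which gives an
    integrable majorant.\<close>
  have db: "\<bar>d n x\<bar> \<le> B * indicator (cball 0 (R + 1)) x" for n x
  proof (cases "x \<in> cball 0 (R + 1)")
    case True
    obtain t where "u (x + s n *\<^sub>R e) - u (x + 0 *\<^sub>R e) = (s n - 0) * partial i u (x + t *\<^sub>R e)"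
      using MVT2[OF s(1)[of n], of "\<lambda>t. u (x + t *\<^sub>R e)" "\<lambda>t. partial i u (x + t *\<^sub>R e)"]
        partial_line_derivative[OF u(1)] unfolding e_def by blast
    then have "d n x = partial i u (x + t *\<^sub>R e)" using s(1)[of n] by (simp add: d_def)
    then show ?thesis using B True by simp
  next
    case False
    have "norm x \<le> norm (x + s n *\<^sub>R e) + norm (s n *\<^sub>R e)"
      using norm_triangle_ineq4[of "x + s n *\<^sub>R e" "s n *\<^sub>R e"] by simp
    then have "R < norm (x + s n *\<^sub>R e)" "R < norm x" using False ne s[of n] by (auto simp: dist_norm)
    then have "x + s n *\<^sub>R e \<notin> K" "x \<notin> K" using R by force+
    then show ?thesis using K(2) False by (simp add: d_def)
  qed
  have dl: "(\<lambda>n. d n x) \<longlonglongrightarrow> partial i u x" for x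
  proof -
    have "((\<lambda>h. (u (x + h *\<^sub>R e) - u x) / h) \<longlongrightarrow> partial i u x) (at 0)"
      using partial_line_derivative[OF u(1), of x i 0] by (simp add: DERIV_def e_def)
    moreover have "filterlim s (at 0) sequentially"
      unfolding filterlim_at s_def using LIMSEQ_inverse_real_of_nat by simp
    ultimately show ?thesis unfolding d_def by (rule filterlim_compose)
  qed
  have ind: "integrable lborel (\<lambda>x::real^'d. B * indicator (cball 0 (R + 1)) x)"
    by (intro integrable_mult_right integrable_real_indicator)
      (auto intro!: emeasure_bounded_finite[unfolded infinity_ennreal_def])
  have iu: "integrable lborel u"
  proof -
    have "integrable lborel (\<lambda>x. indicator K x *\<^sub>R u x)"
      by (rule borel_integrable_compact[OF K(1) continuous_on_subset[OF cu]]) simp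
    moreover have "(\<lambda>x. indicator K x *\<^sub>R u x) = u" using K(2) by (fastforce simp: indicator_def)
    ultimately show ?thesis by simp
  qed
  have d0: "(LINT x|lborel. d n x) = 0" for n
  proof -
    have "integrable (distr lborel borel ((+) (s n *\<^sub>R e))) u" using iu by (simp add: lborel_distr_plus)
    then have "integrable lborel (\<lambda>x. u (s n *\<^sub>R e + x))" by (subst (asm) integrable_distr_eq) auto
    then have i2: "integrable lborel (\<lambda>x. u (x + s n *\<^sub>R e))" by (simp add: add.commute)
    have "(LINT x|lborel. d n x) = ((LINT x|lborel. u (x + s n *\<^sub>R e)) - (LINT x|lborel. u x)) / s n"
      unfolding d_def using i2 iu by simp
    also have "(LINT x|lborel. u (x + s n *\<^sub>R e)) = (LINT x|lborel. u x)"
      using lborel_integral_translation[of u "s n *\<^sub>R e"] by (simp add: add.commute)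
    finally show ?thesis by simp
  qed
  have "(\<lambda>n. LINT x|lborel. d n x) \<longlonglongrightarrow> (LINT x|lborel. partial i u x)"
    by (rule integral_dominated_convergence[OF _ _ ind]) (use dl db in auto)
  then show ?thesis using d0 LIMSEQ_unique[OF tendsto_const[of 0]] by simp
qed

section \<open>Function spaces on a bounded open set\<close>

locale bounded_domain =
  fixes D :: "(real^'d) set"
  assumes open_D: "open D" and bounded_D: "bounded D"
begin

lemma lmeasurable_D: "D \<in> lmeasurable"
  by (rule lmeasurable_open[OF bounded_D open_D])

sublocale finite_measure "lebesgue_on D"
  by (rule finite_measure_lebesgue_on[OF lmeasurable_D])

lemma measurable_continuous:
  fixes f :: "real^'d \<Rightarrow> 'b::euclidean_space"
  assumes "continuous_on UNIV f"
  shows "f \<in> borel_measurable (lebesgue_on D)"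
  using borel_measurable_continuous_onI[OF assms]
  by (simp add: measurable_completion measurable_restrict_space1)

lemma bounded_continuous:
  fixes f :: "real^'d \<Rightarrow> 'b::euclidean_space"
  assumes "continuous_on UNIV f"
  obtains B where "B \<ge> 0" "\<And>x. x \<in> D \<Longrightarrow> norm (f x) \<le> B"
proof -
  have "compact (closure D)" using bounded_D by simp
  then have "bounded (f ` closure D)"
    using assms by (auto intro!: compact_imp_bounded compact_continuous_image elim: continuous_on_subset)
  then have "bounded (f ` D)" by (rule bounded_subset) (use closure_subset in blast)
  then show thesis using that unfolding bounded_pos by (metis imageI less_imp_le)
qed

lemma L2_integrable:
  assumes "f \<in> L2 D"
  shows "integrable (lebesgue_on D) f"
proof (rule Bochner_Integration.integrable_bound)
  show "integrable (lebesgue_on D) (\<lambda>x. 1 + (norm (f x))\<^sup>2)" using L2_D(2)[OF assms] by auto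
  have "norm (f x) \<le> 1 + (norm (f x))\<^sup>2" for x
    using zero_le_power2[of "norm (f x) - 1 / 2"] by (simp add: power2_eq_square algebra_simps)
  then show "AE x in lebesgue_on D. norm (f x) \<le> norm (1 + (norm (f x))\<^sup>2)" by (intro AE_I2) simp
qed (rule L2_D(1)[OF assms])

lemma L2_continuous_mult:
  assumes "continuous_on UNIV \<phi>" "f \<in> L2 D"
  shows "(\<lambda>x. \<phi> x *\<^sub>R f x) \<in> L2 D"
proof -
  obtain B where B: "B \<ge> 0" "\<And>x. x \<in> D \<Longrightarrow> norm (\<phi> x) \<le> B" using bounded_continuous[OF assms(1)] by metis
  note [measurable] = measurable_continuous[OF assms(1)] L2_D(1)[OF assms(2)]
  show ?thesis
  proof (rule L2_bound)
    show "(\<lambda>x. \<phi> x *\<^sub>R f x) \<in> borel_measurable (lebesgue_on D)" by measurable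
    show "integrable (lebesgue_on D) (\<lambda>x. B\<^sup>2 * (norm (f x))\<^sup>2)" using L2_D(2)[OF assms(2)] by auto
    show "(norm (\<phi> x *\<^sub>R f x))\<^sup>2 \<le> B\<^sup>2 * (norm (f x))\<^sup>2" if "x \<in> D" for x
      using B(2)[OF that] by (auto simp: power_mult_distrib intro!: mult_right_mono abs_le_square_iff[THEN iffD1])
  qed
qed

lemma L2_continuous:
  fixes f :: "real^'d \<Rightarrow> 'b::euclidean_space"
  assumes "continuous_on UNIV f"
  shows "f \<in> L2 D"
proof -
  obtain B where B: "B \<ge> 0" "\<And>x. x \<in> D \<Longrightarrow> norm (f x) \<le> B" using bounded_continuous[OF assms(1)] by metis
  show ?thesis
    by (rule L2_bound[OF measurable_continuous[OF assms], where g="\<lambda>_. B\<^sup>2"])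
      (auto intro: power_mono B)
qed

lemma test_L2:
  assumes "\<phi> \<in> test_functions D"
  shows "\<phi> \<in> L2 D" "partial i \<phi> \<in> L2 D"
  using test_functionsD[OF assms] L2_continuous by auto

lemma integrable_continuous_mult:
  "continuous_on UNIV \<phi> \<Longrightarrow> f \<in> L2 D \<Longrightarrow> integrable (lebesgue_on D) (\<lambda>x. \<phi> x *\<^sub>R f x)"
  by (intro L2_integrable L2_continuous_mult)

text \<open>The product of \<open>f\<close> with a test function has compact support inside
  \<open>D\<close>, so the integral of its partial derivative over the whole space vanishes and
  equals the one over \<open>D\<close>. No boundary condition on \<open>f\<close> enters.\<close>

lemma classical_weak_partial:
  fixes f :: "real^'d \<Rightarrow> real"
  assumes f: "\<And>x. f differentiable at x" "continuous_on UNIV (partial i f)"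
  shows "weak_partial D i f (partial i f)"
  unfolding weak_partial_def
proof
  fix \<phi> assume "\<phi> \<in> test_functions D"
  note \<phi> = this test_functionsD[OF this]
  define u where "u = (\<lambda>x. \<phi> x * f x)"
  have cf: "continuous_on UNIV f"
    using f(1) by (auto intro!: continuous_at_imp_continuous_on differentiable_imp_continuous_within)
  have pu: "partial i u = (\<lambda>x. \<phi> x * partial i f x + partial i \<phi> x * f x)"
    unfolding u_def using partial_mult[OF \<phi>(3) f(1)] by auto
  have cpu: "continuous_on UNIV (partial i u)"
    unfolding pu by (intro continuous_intros \<phi> f cf)
  let ?K = "closure {x. \<phi> x \<noteq> 0}"
  have K: "compact ?K" "?K \<subseteq> D" using \<phi>(1) by (auto simp: test_functions_def)
  have uK: "u x = 0" if "x \<notin> ?K" for x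
    using that closure_subset[of "{x. \<phi> x \<noteq> 0}"] by (auto simp: u_def)
  have puK: "partial i u x = 0" if "x \<notin> ?K" for x
  proof (rule partial_eqI)
    show "(u has_derivative (\<lambda>_. 0)) (at x)"
      by (rule has_derivative_transform_within_open[of "\<lambda>_. 0" _ _ _ "- ?K"])
        (use that uK in auto)
  qed
  have "0 = (LINT x|lborel. partial i u x)"
    using integral_partial_eq_0[of u i, OF _ cpu K(1) uK] \<phi>(3) f(1) by (simp add: u_def)
  also have "\<dots> = (LINT x|lebesgue. partial i u x)"
    by (rule integral_completion[symmetric]) (use borel_measurable_continuous_onI[OF cpu] in simp)
  also have "\<dots> = (LINT x|lebesgue. indicator D x *\<^sub>R partial i u x)"
    by (intro Bochner_Integration.integral_cong) (use puK K(2) in \<open>auto simp: indicator_def\<close>)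
  also have "\<dots> = (LINT x|lebesgue_on D. partial i u x)"
    using lmeasurable_D by (subst integral_restrict_space) auto
  also have "\<dots> = (LINT x|lebesgue_on D. \<phi> x *\<^sub>R partial i f x) + (LINT x|lebesgue_on D. partial i \<phi> x *\<^sub>R f x)"
    unfolding pu using integrable_continuous_mult[OF \<phi>(2) L2_continuous[OF f(2)]]
      integrable_continuous_mult[OF \<phi>(4) L2_continuous[OF cf]] by simp
  finally show "(LINT x|lebesgue_on D. partial i \<phi> x *\<^sub>R f x) = - (LINT x|lebesgue_on D. \<phi> x *\<^sub>R partial i f x)"
    by simp
qed

lemma test_weak_partial: "\<phi> \<in> test_functions D \<Longrightarrow> weak_partial D i \<phi> (partial i \<phi>)"
  using classical_weak_partial test_functionsD by blast

text \<open>Obtained by integrating \<open>\<partial>\<^sub>i (x\<^sub>i \<phi>\<^sup>2) = \<phi>\<^sup>2 + 2 x\<^sub>i \<phi> \<partial>\<^sub>i \<phi>\<close> over the bounded set \<open>D\<close>.\<close>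

lemma poincare:
  obtains C where "C \<ge> 0"
    "\<And>\<phi> i. \<phi> \<in> test_functions D \<Longrightarrow> l2_norm D \<phi> \<le> C * l2_norm D (partial i \<phi>)"
proof -
  obtain R where R: "R > 0" "\<And>x. x \<in> D \<Longrightarrow> norm x \<le> R"
    using bounded_D unfolding bounded_pos by auto
  have "l2_norm D \<phi> \<le> 2 * R * l2_norm D (partial i \<phi>)" if \<phi>: "\<phi> \<in> test_functions D" for \<phi> i
  proof -
    note \<phi>' = test_functionsD[OF \<phi>]
    let ?X = "\<lambda>x. x $ i * partial i \<phi> x"
    have X: "?X \<in> L2 D" by (intro L2_continuous continuous_intros \<phi>')
    have dn: "(\<lambda>x::real^'d. x $ i) differentiable at x" for x
      by (rule bounded_linear_imp_differentiable[OF bounded_linear_vec_nth])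
    have p: "partial i (\<lambda>x. x $ i * \<phi> x) = (\<lambda>x. ?X x + \<phi> x)"
      using partial_mult[OF dn \<phi>'(2)] by (auto simp: partial_component)
    \<comment> \<open>The function \<phi> plays two roles: a factor of the differentiated function
      here, and the test function in the next step.\<close>
    have "weak_partial D i (\<lambda>x. x $ i * \<phi> x) (partial i (\<lambda>x. x $ i * \<phi> x))"
      by (rule classical_weak_partial) (auto simp: p intro!: continuous_intros \<phi>' differentiable_mult dn)
    then have "(LINT x|lebesgue_on D. partial i \<phi> x * (x $ i * \<phi> x)) = - (LINT x|lebesgue_on D. \<phi> x * (?X x + \<phi> x))"
      using \<phi> by (auto simp: weak_partial_def p)
    moreover have "(LINT x|lebesgue_on D. partial i \<phi> x * (x $ i * \<phi> x)) = l2_inner D \<phi> ?X"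
      by (simp add: l2_inner_def mult_ac)
    moreover have "(LINT x|lebesgue_on D. \<phi> x * (?X x + \<phi> x)) = l2_inner D \<phi> ?X + l2_inner D \<phi> \<phi>"
      using L2_inner_integrable[OF test_L2(1)[OF \<phi>] X]
        L2_inner_integrable[OF test_L2(1)[OF \<phi>] test_L2(1)[OF \<phi>]]
      by (simp add: l2_inner_def ring_distribs)
    ultimately have "(l2_norm D \<phi>)\<^sup>2 = - 2 * l2_inner D \<phi> ?X" by (simp add: l2_norm_sq)
    also have "\<dots> \<le> 2 * (l2_norm D \<phi> * l2_norm D ?X)"
      using l2_inner_le_norm[OF test_L2(1)[OF \<phi>] X] by linarith
    finally have 1: "l2_norm D \<phi> * l2_norm D \<phi> \<le> l2_norm D \<phi> * (2 * l2_norm D ?X)"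
      by (simp add: power2_eq_square)
    have 2: "l2_norm D ?X \<le> R * l2_norm D (partial i \<phi>)"
    proof (rule power2_le_imp_le)
      have "l2_inner D ?X ?X \<le> (LINT x|lebesgue_on D. R\<^sup>2 * (partial i \<phi> x \<bullet> partial i \<phi> x))"
        unfolding l2_inner_def
      proof (rule integral_mono)
        fix x assume "x \<in> space (lebesgue_on D)"
        then have "\<bar>x $ i\<bar> \<le> R" using R(2)[of x] component_le_norm_cart[of x i] by simp
        then have "(x $ i)\<^sup>2 \<le> R\<^sup>2" using R(1) by (simp add: abs_le_square_iff[symmetric])
        then have "(x $ i)\<^sup>2 * (partial i \<phi> x)\<^sup>2 \<le> R\<^sup>2 * (partial i \<phi> x)\<^sup>2" by (rule mult_right_mono) simp
        then show "?X x \<bullet> ?X x \<le> R\<^sup>2 * (partial i \<phi> x \<bullet> partial i \<phi> x)"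
          by (simp add: power2_eq_square mult_ac)
      qed (use L2_inner_integrable[OF X X] L2_inner_integrable[OF test_L2(2)[OF \<phi>] test_L2(2)[OF \<phi>]] in auto)
      also have "\<dots> = R\<^sup>2 * l2_inner D (partial i \<phi>) (partial i \<phi>)" by (simp add: l2_inner_def)
      finally show "(l2_norm D ?X)\<^sup>2 \<le> (R * l2_norm D (partial i \<phi>))\<^sup>2"
        by (simp add: l2_norm_sq power_mult_distrib)
      show "0 \<le> R * l2_norm D (partial i \<phi>)" using R(1) by simp
    qed
    show ?thesis
    proof (cases "l2_norm D \<phi> = 0")
      case True
      then show ?thesis using R(1) by simp
    next
      case False
      then have "l2_norm D \<phi> > 0" using l2_norm_nonneg[of D \<phi>] by linarith
      then have "l2_norm D \<phi> \<le> 2 * l2_norm D ?X" using 1 by (simp only: mult_le_cancel_left_pos)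
      then show ?thesis using 2 by linarith
    qed
  qed
  then show thesis using that[of "2 * R"] R(1) by simp
qed

section \<open>The fundamental lemma of the calculus of variations\<close>

lemma integral_open_eq_0:
  fixes g :: "real^'d \<Rightarrow> real"
  assumes g: "integrable (lebesgue_on D) g"
    and t: "\<And>\<phi>. \<phi> \<in> test_functions D \<Longrightarrow> (LINT x|lebesgue_on D. \<phi> x * g x) = 0"
    and U: "open U" "U \<subseteq> D"
  shows "(LINT x|lebesgue_on D. indicator U x * g x) = 0"
proof -
  obtain \<phi> where \<phi>: "\<And>n. \<phi> n \<in> test_functions D" "\<And>n x. 0 \<le> \<phi> n x \<and> \<phi> n x \<le> 1"
    "\<And>x. (\<lambda>n. \<phi> n x) \<longlonglongrightarrow> indicator U x"
    using test_functions_approx_open[OF U] by blast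
  have [measurable]: "\<phi> n \<in> borel_measurable (lebesgue_on D)" for n
    by (rule measurable_continuous[OF test_functionsD(1)[OF \<phi>(1)]])
  have [measurable]: "g \<in> borel_measurable (lebesgue_on D)" using g by auto
  have [measurable]: "(indicator U :: _ \<Rightarrow> real) \<in> borel_measurable (lebesgue_on D)"
    by (rule borel_measurable_LIMSEQ_metric[OF _ \<phi>(3)]) simp
  have "(\<lambda>n. LINT x|lebesgue_on D. \<phi> n x * g x) \<longlonglongrightarrow> (LINT x|lebesgue_on D. indicator U x * g x)"
  proof (rule integral_dominated_convergence[where w="\<lambda>x. \<bar>g x\<bar>"])
    show "AE x in lebesgue_on D. (\<lambda>n. \<phi> n x * g x) \<longlonglongrightarrow> indicator U x * g x"
      by (intro AE_I2 tendsto_intros \<phi>)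
    show "AE x in lebesgue_on D. norm (\<phi> n x * g x) \<le> \<bar>g x\<bar>" for n
      using \<phi>(2) by (intro AE_I2) (auto simp: abs_mult intro: mult_left_le_one_le)
  qed (use g in auto)
  then show ?thesis using t[OF \<phi>(1)] LIMSEQ_unique[OF tendsto_const[of 0]] by simp
qed

text \<open>
  Up to a null set, \<open>{g > 0}\<close> is a countable decreasing intersection of open sets, over each of which
  \<open>g\<close> has integral \<open>0\<close>.
\<close>

lemma AE_nonpos_if_test_integrals_0:
  fixes g :: "real^'d \<Rightarrow> real"
  assumes g: "integrable (lebesgue_on D) g"
    and t: "\<And>\<phi>. \<phi> \<in> test_functions D \<Longrightarrow> (LINT x|lebesgue_on D. \<phi> x * g x) = 0"
  shows "AE x in lebesgue_on D. g x \<le> 0"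
proof -
  have Dl: "D \<in> sets lebesgue" using lmeasurable_D by auto
  have [measurable]: "g \<in> borel_measurable (lebesgue_on D)" using g by auto
  define A where "A = {x \<in> D. g x > 0}"
  have "A \<in> sets (lebesgue_on D)"
  proof -
    have "{x \<in> space (lebesgue_on D). g x > 0} \<in> sets (lebesgue_on D)" by measurable
    then show ?thesis by (simp add: A_def)
  qed
  then have AL: "A \<in> sets lebesgue" using Dl by (simp add: sets_restrict_space_iff)
  obtain C T where CT: "gdelta C" "T \<in> null_sets lebesgue" "A \<union> T = C" "disjnt A T"
    using lebesgue_set_almost_gdelta[OF AL] by metis
  from CT(1) obtain F :: "nat \<Rightarrow> _" where F: "\<And>n. open (F n)" "C = (\<Inter>n. F n)"
    by (auto elim!: gdelta.cases)
  define U where "U = (\<lambda>n. D \<inter> (\<Inter>k\<le>n. F k))"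
  have oU: "open (U n)" for n unfolding U_def using open_D F(1) by (intro open_Int open_INT) auto
  have Ul: "(\<lambda>n. indicator (U n) x :: real) \<longlonglongrightarrow> indicator (D \<inter> C) x" for x
  proof (cases "x \<in> D \<inter> C")
    case True
    then have "x \<in> U n" for n by (auto simp: U_def F(2))
    then show ?thesis using True by simp
  next
    case False
    then consider "x \<notin> D" | k where "x \<notin> F k" by (auto simp: F(2))
    then have "\<exists>k. \<forall>n\<ge>k. x \<notin> U n" by cases (auto simp: U_def)
    then have "eventually (\<lambda>n. (indicator (U n) x :: real) = 0) sequentially"
      unfolding eventually_sequentially by (auto simp: indicator_def)
    then have "(\<lambda>n. indicator (U n) x :: real) \<longlonglongrightarrow> 0" by (rule tendsto_eventually)
    then show ?thesis using False by simp
  qed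
  have [measurable]: "(indicator (U n) :: _ \<Rightarrow> real) \<in> borel_measurable (lebesgue_on D)" for n
  proof -
    have "U n \<in> sets (lebesgue_on D)"
      using oU Dl by (auto simp: sets_restrict_space_iff U_def[symmetric]) (auto simp: U_def)
    then show ?thesis by simp
  qed
  have [measurable]: "(indicator (D \<inter> C) :: _ \<Rightarrow> real) \<in> borel_measurable (lebesgue_on D)"
    by (rule borel_measurable_LIMSEQ_metric[OF _ Ul]) simp
  have "(\<lambda>n. LINT x|lebesgue_on D. indicator (U n) x * g x) \<longlonglongrightarrow> (LINT x|lebesgue_on D. indicator (D \<inter> C) x * g x)"
  proof (rule integral_dominated_convergence[where w="\<lambda>x. \<bar>g x\<bar>"])
    show "AE x in lebesgue_on D. (\<lambda>n. indicator (U n) x * g x) \<longlonglongrightarrow> indicator (D \<inter> C) x * g x"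
      by (intro AE_I2 tendsto_intros Ul)
    show "AE x in lebesgue_on D. norm (indicator (U n) x * g x) \<le> \<bar>g x\<bar>" for n
      by (intro AE_I2) (auto simp: indicator_def)
  qed (use g in auto)
  moreover have "(LINT x|lebesgue_on D. indicator (U n) x * g x) = 0" for n
    by (rule integral_open_eq_0[OF g t oU]) (auto simp: U_def)
  ultimately have C0: "(LINT x|lebesgue_on D. indicator (D \<inter> C) x * g x) = 0"
    using LIMSEQ_unique[OF tendsto_const[of 0]] by simp
  \<comment> \<open>Off the null set \<open>T\<close>, membership in \<open>C\<close> means exactly
    \<open>g x > 0\<close>, so the integrand is the positive part of \<open>g\<close>; being
    nonnegative with integral 0, it vanishes almost everywhere.\<close>
  have AEC: "AE x in lebesgue_on D. indicator (D \<inter> C) x * g x = max (g x) 0"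
  proof -
    have "AE x in lebesgue. x \<notin> T" using CT(2) by (rule AE_not_in)
    then have "AE x in lebesgue. x \<in> D \<longrightarrow> indicator (D \<inter> C) x * g x = max (g x) 0"
      by eventually_elim (use CT(3) in \<open>auto simp: indicator_def A_def\<close>)
    then show ?thesis using Dl by (simp add: AE_restrict_space_iff)
  qed
  have "(LINT x|lebesgue_on D. max (g x) 0) = 0"
    using integral_cong_AE[OF _ _ AEC] C0 by simp
  then have "AE x in lebesgue_on D. max (g x) 0 = 0"
    using g by (subst (asm) integral_nonneg_eq_0_iff_AE) auto
  then show ?thesis by eventually_elim (simp add: max_def split: if_splits)
qed

text \<open>Reduces to the scalar one-sided statement, applied to both signs of each of the finitely
  many coordinates.\<close>

lemma AE_zero_if_test_integrals_0:
  fixes g :: "real^'d \<Rightarrow> 'b::euclidean_space"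
  assumes g: "integrable (lebesgue_on D) g"
    and t: "\<And>\<phi>. \<phi> \<in> test_functions D \<Longrightarrow> (LINT x|lebesgue_on D. \<phi> x *\<^sub>R g x) = 0"
  shows "AE x in lebesgue_on D. g x = 0"
proof -
  have i: "integrable (lebesgue_on D) (\<lambda>x. \<phi> x *\<^sub>R g x)" if "\<phi> \<in> test_functions D" for \<phi>
  proof -
    note \<phi> = test_functionsD(1)[OF that]
    obtain B where B: "B \<ge> 0" "\<And>x. x \<in> D \<Longrightarrow> norm (\<phi> x) \<le> B" using bounded_continuous[OF \<phi>] by metis
    note [measurable] = measurable_continuous[OF \<phi>] borel_measurable_integrable[OF g]
    show ?thesis
      by (rule Bochner_Integration.integrable_bound[of _ "\<lambda>x. B *\<^sub>R g x"])
        (use g B in \<open>auto intro!: AE_I2 mult_right_mono\<close>)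
  qed
  have tb: "(LINT x|lebesgue_on D. \<phi> x * (g x \<bullet> b)) = 0" if "\<phi> \<in> test_functions D" for \<phi> b
    using integral_inner_left[of b "lebesgue_on D" "\<lambda>x. \<phi> x *\<^sub>R g x"] i[OF that] t[OF that] by simp
  have "AE x in lebesgue_on D. g x \<bullet> b = 0" for b
  proof -
    have "AE x in lebesgue_on D. g x \<bullet> b \<le> 0"
      by (rule AE_nonpos_if_test_integrals_0) (use g tb in auto)
    moreover have "AE x in lebesgue_on D. - (g x \<bullet> b) \<le> 0"
      by (rule AE_nonpos_if_test_integrals_0) (use g tb in auto)
    ultimately show ?thesis by eventually_elim simp
  qed
  then have "AE x in lebesgue_on D. \<forall>b\<in>Basis. g x \<bullet> b = 0"
    by (intro AE_finite_allI) auto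
  then show ?thesis by eventually_elim (simp add: euclidean_all_zero_iff)
qed

end

section \<open>Weak derivatives and the Dirichlet problem\<close>

lemma l2_inner_tendsto:
  assumes "\<And>n. f n \<in> L2 D" "g \<in> L2 D" "k \<in> L2 D"
    and lim: "(\<lambda>n. l2_norm D (\<lambda>x. f n x - g x)) \<longlonglongrightarrow> 0"
  shows "(\<lambda>n. l2_inner D (f n) k) \<longlonglongrightarrow> l2_inner D g k"
proof -
  have b: "norm (l2_inner D (f n) k - l2_inner D g k) \<le> l2_norm D (\<lambda>x. f n x - g x) * l2_norm D k" for n
    using l2_inner_le_norm[OF L2_diff[OF assms(1,2)] assms(3)] assms(1-3)
    by (simp add: l2_inner_diff)
  have "(\<lambda>n. l2_norm D (\<lambda>x. f n x - g x) * l2_norm D k) \<longlonglongrightarrow> 0"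
    using tendsto_mult_right[OF lim, of "l2_norm D k"] by (simp add: mult.commute)
  then have "(\<lambda>n. l2_inner D (f n) k - l2_inner D g k) \<longlonglongrightarrow> 0"
    by (rule Lim_null_comparison[rotated]) (use b in auto)
  then show ?thesis by (simp add: LIM_zero_iff)
qed

lemma l2_inner_vec:
  fixes f g :: "'n::finite \<Rightarrow> real^'d \<Rightarrow> real"
  assumes "\<And>i. f i \<in> L2 D" "\<And>i. g i \<in> L2 D"
  shows "l2_inner D (\<lambda>x. \<chi> i. f i x) (\<lambda>x. \<chi> i. g i x) = (\<Sum>i\<in>UNIV. l2_inner D (f i) (g i))"
  unfolding l2_inner_def inner_vec_def
  using L2_inner_integrable[OF assms(1) assms(2)] by simp

lemma l2_norm_vec_sq:
  fixes f :: "'n::finite \<Rightarrow> real^'d \<Rightarrow> real"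
  assumes "\<And>i. f i \<in> L2 D"
  shows "(l2_norm D (\<lambda>x. \<chi> i. f i x))\<^sup>2 = (\<Sum>i\<in>UNIV. (l2_norm D (f i))\<^sup>2)"
  using l2_inner_vec[OF assms assms] by (simp add: l2_norm_sq)

lemma l2_norm_nth_le:
  fixes f :: "real^'d \<Rightarrow> real^'n"
  assumes "f \<in> L2 D"
  shows "l2_norm D (\<lambda>x. f x $ i) \<le> l2_norm D f"
proof (rule power2_le_imp_le)
  have "(l2_norm D (\<lambda>x. f x $ i))\<^sup>2 \<le> (\<Sum>i\<in>UNIV. (l2_norm D (\<lambda>x. f x $ i))\<^sup>2)"
    by (rule member_le_sum) auto
  also have "\<dots> = (l2_norm D f)\<^sup>2"
    using l2_norm_vec_sq[of "\<lambda>i x. f x $ i", OF L2_nth[OF assms]] by simp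
  finally show "(l2_norm D (\<lambda>x. f x $ i))\<^sup>2 \<le> (l2_norm D f)\<^sup>2" .
qed simp

lemma integral_vec_nth:
  fixes f :: "'x \<Rightarrow> real^'n"
  assumes "integrable M f"
  shows "(LINT x|M. f x) $ i = (LINT x|M. f x $ i)"
  by (rule integral_bounded_linear[OF bounded_linear_vec_nth assms, symmetric])

text \<open>The components of \<open>wgrad\<close> are chosen representatives and linear only almost
  everywhere. The energy form in the Riesz argument must be linear exactly, hence the classical
  gradient for test functions.\<close>

definition cgrad :: "(real^'d \<Rightarrow> real) \<Rightarrow> real^'d \<Rightarrow> real^'d" where
  "cgrad \<phi> x = (\<chi> i. partial i \<phi> x)"

lemma sobolev_norm_1_sq:
  "(sobolev_norm D 1 f)\<^sup>2 = (l2_norm D f)\<^sup>2 + (\<Sum>i\<in>UNIV. (l2_norm D (wpartial D i f))\<^sup>2)"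
  unfolding sobolev_norm_def by (simp add: sum_nonneg)

lemma sobolev_norm_nonneg [simp]: "0 \<le> sobolev_norm D m f"
proof -
  have "0 \<le> sobolev_norm_sq D m f"
    by (induction m arbitrary: f) (auto intro!: sum_nonneg add_nonneg_nonneg)
  then show ?thesis by (simp add: sobolev_norm_def)
qed

lemma l2_norm_le_sobolev_norm: "l2_norm D f \<le> sobolev_norm D 1 f"
  by (rule power2_le_imp_le, unfold sobolev_norm_1_sq) (auto intro: sum_nonneg)

context bounded_domain
begin

lemma weak_partial_unique:
  assumes "weak_partial D i f g" "weak_partial D i f g'" "g \<in> L2 D" "g' \<in> L2 D"
  shows "AE x in lebesgue_on D. g x = g' x"
proof -
  have "AE x in lebesgue_on D. g x - g' x = 0"
  proof (rule AE_zero_if_test_integrals_0)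
    show "integrable (lebesgue_on D) (\<lambda>x. g x - g' x)"
      using L2_integrable[OF L2_diff[OF assms(3,4)]] .
    fix \<phi> assume \<phi>: "\<phi> \<in> test_functions D"
    then have "(LINT x|lebesgue_on D. \<phi> x *\<^sub>R g x) = (LINT x|lebesgue_on D. \<phi> x *\<^sub>R g' x)"
      using assms(1)[unfolded weak_partial_def, THEN bspec, OF \<phi>]
        assms(2)[unfolded weak_partial_def, THEN bspec, OF \<phi>] by simp
    then show "(LINT x|lebesgue_on D. \<phi> x *\<^sub>R (g x - g' x)) = 0"
      using integrable_continuous_mult[OF test_functionsD(1)[OF \<phi>] assms(3)]
        integrable_continuous_mult[OF test_functionsD(1)[OF \<phi>] assms(4)]
      by (simp add: scaleR_diff_right)
  qed
  then show ?thesis by simp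
qed

lemma weak_partial_lincomb:
  assumes "weak_partial D i f g" "weak_partial D i f' g'"
    and "f \<in> L2 D" "f' \<in> L2 D" "g \<in> L2 D" "g' \<in> L2 D"
  shows "weak_partial D i (\<lambda>x. f x + c *\<^sub>R f' x) (\<lambda>x. g x + c *\<^sub>R g' x)"
  unfolding weak_partial_def
proof
  fix \<phi> assume \<phi>: "\<phi> \<in> test_functions D"
  note c = integrable_continuous_mult[OF test_functionsD(1)[OF \<phi>]]
    integrable_continuous_mult[OF test_functionsD(3)[OF \<phi>]]
  have s: "a *\<^sub>R (p + c *\<^sub>R q) = a *\<^sub>R p + c *\<^sub>R (a *\<^sub>R q)" for a and p q :: 'a
    by (simp add: scaleR_add_right mult.commute)
  show "(LINT x|lebesgue_on D. partial i \<phi> x *\<^sub>R (f x + c *\<^sub>R f' x))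
      = - (LINT x|lebesgue_on D. \<phi> x *\<^sub>R (g x + c *\<^sub>R g' x))"
    unfolding s
    using assms(1,2) \<phi> c[OF assms(3)] c[OF assms(4)] c[OF assms(5)] c[OF assms(6)]
    by (simp add: weak_partial_def del: scaleR_scaleR)
qed

lemma weak_partial_cong_AE:
  assumes "weak_partial D i f g" "f \<in> L2 D" "f' \<in> L2 D" "AE x in lebesgue_on D. f x = f' x"
  shows "weak_partial D i f' g"
  unfolding weak_partial_def
proof
  fix \<phi> assume \<phi>: "\<phi> \<in> test_functions D"
  note [measurable] = measurable_continuous[OF test_functionsD(3)[OF \<phi>]]
    assms(2,3)[THEN L2_D(1)]
  have "(LINT x|lebesgue_on D. partial i \<phi> x *\<^sub>R f' x) = (LINT x|lebesgue_on D. partial i \<phi> x *\<^sub>R f x)"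
    by (rule integral_cong_AE) (use assms(4) in auto)
  then show "(LINT x|lebesgue_on D. partial i \<phi> x *\<^sub>R f' x) = - (LINT x|lebesgue_on D. \<phi> x *\<^sub>R g x)"
    using assms(1) \<phi> by (simp add: weak_partial_def)
qed

lemma weak_partial_vec:
  fixes f g :: "'n::finite \<Rightarrow> real^'d \<Rightarrow> real"
  assumes "\<And>i. weak_partial D j (f i) (g i)" "\<And>i. f i \<in> L2 D" "\<And>i. g i \<in> L2 D"
  shows "weak_partial D j (\<lambda>x. \<chi> i. f i x) (\<lambda>x. \<chi> i. g i x)"
  unfolding weak_partial_def
proof
  fix \<phi> assume \<phi>: "\<phi> \<in> test_functions D"
  have i: "integrable (lebesgue_on D) (\<lambda>x. partial j \<phi> x *\<^sub>R (\<chi> i. f i x))"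
    "integrable (lebesgue_on D) (\<lambda>x. \<phi> x *\<^sub>R (\<chi> i. g i x))"
    by (intro integrable_continuous_mult test_functionsD[OF \<phi>] L2_vec assms)+
  show "(LINT x|lebesgue_on D. partial j \<phi> x *\<^sub>R (\<chi> i. f i x)) = - (LINT x|lebesgue_on D. \<phi> x *\<^sub>R (\<chi> i. g i x))"
    using assms(1) \<phi> by (simp add: vec_eq_iff integral_vec_nth i weak_partial_def)
qed

lemma sobolev_1_iff: "f \<in> sobolev D 1 \<longleftrightarrow> f \<in> L2 D \<and> (\<forall>i. \<exists>g\<in>L2 D. weak_partial D i f g)"
  by simp

lemma sobolev_1_L2: "f \<in> sobolev D 1 \<Longrightarrow> f \<in> L2 D"
  by (simp add: sobolev_1_iff)

text \<open>The choice made in \<open>wpartial\<close> is fixed only up to null sets. Any known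
  square-integrable weak derivative can replace it almost everywhere, and this is the only way its
  values are accessed.\<close>

lemma wpartial_eq:
  assumes "weak_partial D i f g" "g \<in> L2 D"
  shows "wpartial D i f \<in> L2 D" "weak_partial D i f (wpartial D i f)"
    "AE x in lebesgue_on D. wpartial D i f x = g x"
proof -
  have "wpartial D i f \<in> L2 D \<and> weak_partial D i f (wpartial D i f)"
    unfolding wpartial_def by (rule someI[of _ g]) (use assms in auto)
  then show *: "wpartial D i f \<in> L2 D" "weak_partial D i f (wpartial D i f)" by auto
  show "AE x in lebesgue_on D. wpartial D i f x = g x"
    by (rule weak_partial_unique[OF *(2) assms(1) *(1) assms(2)])
qed

lemma wpartial:
  assumes "f \<in> sobolev D 1"
  shows "wpartial D i f \<in> L2 D" "weak_partial D i f (wpartial D i f)"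
  using assms wpartial_eq unfolding sobolev_1_iff by blast+

text \<open>Almost-everywhere equality is assumed because that is all a given splitting of
  \<open>v\<close> provides. Besides \<open>c = 1\<close> and \<open>c = -1\<close>, the case
  \<open>c = 0\<close> moves membership from one representative to another.\<close>

lemma sobolev_1_lincomb_AE:
  assumes "f \<in> L2 D" "u \<in> sobolev D 1" "v \<in> sobolev D 1"
    "AE x in lebesgue_on D. f x = u x + c *\<^sub>R v x"
  shows "f \<in> sobolev D 1"
    "AE x in lebesgue_on D. wpartial D i f x = wpartial D i u x + c *\<^sub>R wpartial D i v x"
    "sobolev_norm D 1 f \<le> 2 * (sobolev_norm D 1 u + \<bar>c\<bar> * sobolev_norm D 1 v)"
proof -
  note uv = assms(2,3)[THEN sobolev_1_L2]
  have w: "weak_partial D i f (\<lambda>x. wpartial D i u x + c *\<^sub>R wpartial D i v x)" for i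
  proof (rule weak_partial_cong_AE)
    show "weak_partial D i (\<lambda>x. u x + c *\<^sub>R v x) (\<lambda>x. wpartial D i u x + c *\<^sub>R wpartial D i v x)"
      by (intro weak_partial_lincomb wpartial assms uv)
    show "AE x in lebesgue_on D. u x + c *\<^sub>R v x = f x" using assms(4) by eventually_elim simp
  qed (intro L2_lincomb uv assms)+
  have l: "(\<lambda>x. wpartial D i u x + c *\<^sub>R wpartial D i v x) \<in> L2 D" for i
    by (intro L2_lincomb wpartial assms)
  show "f \<in> sobolev D 1" using w l assms(1) unfolding sobolev_1_iff by blast
  show "AE x in lebesgue_on D. wpartial D i f x = wpartial D i u x + c *\<^sub>R wpartial D i v x" for i
    by (rule wpartial_eq[OF w l])
  have "(l2_norm D f)\<^sup>2 \<le> 2 * (l2_norm D u)\<^sup>2 + 2 * c\<^sup>2 * (l2_norm D v)\<^sup>2"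
    using l2_norm_lincomb_sq_le[OF uv] l2_norm_cong_AE[OF assms(1) L2_lincomb[OF uv] assms(4)] by simp
  moreover have "(l2_norm D (wpartial D i f))\<^sup>2 \<le> 2 * (l2_norm D (wpartial D i u))\<^sup>2 + 2 * c\<^sup>2 * (l2_norm D (wpartial D i v))\<^sup>2" for i
    using l2_norm_lincomb_sq_le[OF wpartial(1)[OF assms(2)] wpartial(1)[OF assms(3)]]
      l2_norm_cong_AE[OF wpartial_eq(1)[OF w l] l wpartial_eq(3)[OF w l]] by simp
  ultimately have "(l2_norm D f)\<^sup>2 + (\<Sum>i\<in>UNIV. (l2_norm D (wpartial D i f))\<^sup>2)
      \<le> (2 * (l2_norm D u)\<^sup>2 + 2 * c\<^sup>2 * (l2_norm D v)\<^sup>2)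
        + (\<Sum>i\<in>UNIV. 2 * (l2_norm D (wpartial D i u))\<^sup>2 + 2 * c\<^sup>2 * (l2_norm D (wpartial D i v))\<^sup>2)"
    by (intro add_mono sum_mono)
  also have "\<dots> = 2 * (sobolev_norm D 1 u)\<^sup>2 + 2 * c\<^sup>2 * (sobolev_norm D 1 v)\<^sup>2"
    unfolding sobolev_norm_1_sq by (simp add: sum.distrib algebra_simps flip: sum_distrib_left)
  finally have "(sobolev_norm D 1 f)\<^sup>2 \<le> 2 * (sobolev_norm D 1 u)\<^sup>2 + 2 * c\<^sup>2 * (sobolev_norm D 1 v)\<^sup>2"
    unfolding sobolev_norm_1_sq[of D f] .
  also have "\<dots> \<le> (2 * (sobolev_norm D 1 u + \<bar>c\<bar> * sobolev_norm D 1 v))\<^sup>2"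
  proof -
    have "0 \<le> sobolev_norm D 1 u * (\<bar>c\<bar> * sobolev_norm D 1 v)" by (intro mult_nonneg_nonneg) auto
    moreover have "0 \<le> (sobolev_norm D 1 u)\<^sup>2 + c\<^sup>2 * (sobolev_norm D 1 v)\<^sup>2" by simp
    moreover have "(2 * (sobolev_norm D 1 u + \<bar>c\<bar> * sobolev_norm D 1 v))\<^sup>2
        = 4 * (sobolev_norm D 1 u)\<^sup>2 + 4 * (c\<^sup>2 * (sobolev_norm D 1 v)\<^sup>2)
          + 8 * (sobolev_norm D 1 u * (\<bar>c\<bar> * sobolev_norm D 1 v))"
      by (simp add: power_mult_distrib power2_sum)
    ultimately show ?thesis by linarith
  qed
  finally show "sobolev_norm D 1 f \<le> 2 * (sobolev_norm D 1 u + \<bar>c\<bar> * sobolev_norm D 1 v)"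
    by (rule power2_le_imp_le) (auto intro!: mult_nonneg_nonneg add_nonneg_nonneg)
qed

section \<open>The weak divergence\<close>

lemma wdiv_L2: "v \<in> sobolev D 1 \<Longrightarrow> wdiv D v \<in> L2 D"
  unfolding wdiv_def[abs_def] by (intro L2_sum L2_nth wpartial)

lemma wdiv_lincomb_AE:
  assumes "f \<in> L2 D" "u \<in> sobolev D 1" "v \<in> sobolev D 1"
    "AE x in lebesgue_on D. f x = u x + c *\<^sub>R v x"
  shows "AE x in lebesgue_on D. wdiv D f x = wdiv D u x + c *\<^sub>R wdiv D v x"
proof -
  have "AE x in lebesgue_on D. \<forall>i. wpartial D i f x = wpartial D i u x + c *\<^sub>R wpartial D i v x"
    using sobolev_1_lincomb_AE(2)[OF assms] by (simp add: AE_all_countable)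
  then show ?thesis
    by eventually_elim (simp add: wdiv_def sum.distrib sum_distrib_left)
qed

lemma l2_norm_wdiv_le:
  assumes "v \<in> sobolev D 1"
  shows "l2_norm D (wdiv D v) \<le> real CARD('d) * sobolev_norm D 1 v"
proof (rule power2_le_imp_le)
  let ?n = "real CARD('d)"
  note L = wpartial(1)[OF assms]
  have "(l2_norm D (wdiv D v))\<^sup>2 = (LINT x|lebesgue_on D. (wdiv D v x)\<^sup>2)"
    unfolding l2_norm_sq l2_inner_def by (simp add: power2_eq_square)
  also have "\<dots> \<le> (LINT x|lebesgue_on D. ?n * (\<Sum>i\<in>UNIV. wpartial D i v x \<bullet> wpartial D i v x))"
  proof (rule integral_mono)
    show "integrable (lebesgue_on D) (\<lambda>x. (wdiv D v x)\<^sup>2)"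
      using L2_D(2)[OF wdiv_L2[OF assms]] by simp
    show "integrable (lebesgue_on D) (\<lambda>x. ?n * (\<Sum>i\<in>UNIV. wpartial D i v x \<bullet> wpartial D i v x))"
      by (intro integrable_mult_right Bochner_Integration.integrable_sum L2_inner_integrable L)
    fix x
    have "(wdiv D v x)\<^sup>2 \<le> (\<Sum>i\<in>UNIV. (wpartial D i v x $ i)\<^sup>2) * ?n"
      unfolding wdiv_def by (rule sum_squared_le_sum_of_squares)
    also have "\<dots> \<le> (\<Sum>i\<in>UNIV. wpartial D i v x \<bullet> wpartial D i v x) * ?n"
    proof (intro mult_right_mono sum_mono)
      fix i
      show "(wpartial D i v x $ i)\<^sup>2 \<le> wpartial D i v x \<bullet> wpartial D i v x"
        unfolding inner_vec_def using member_le_sum[of i UNIV "\<lambda>j. (wpartial D i v x $ j)\<^sup>2"]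
        by (simp add: power2_eq_square)
    qed simp
    finally show "(wdiv D v x)\<^sup>2 \<le> ?n * (\<Sum>i\<in>UNIV. wpartial D i v x \<bullet> wpartial D i v x)"
      by (simp add: mult.commute)
  qed
  also have "\<dots> = ?n * (\<Sum>i\<in>UNIV. (l2_norm D (wpartial D i v))\<^sup>2)"
    by (simp add: l2_norm_sq l2_inner_def L2_inner_integrable[OF L L])
  also have "\<dots> \<le> ?n * (sobolev_norm D 1 v)\<^sup>2"
    unfolding sobolev_norm_1_sq by (intro mult_left_mono) auto
  \<comment> \<open>The sum of squares gives the constant sqrt d; enlarging it to d keeps square
    roots out of the later constants.\<close>
  also have "\<dots> \<le> ?n\<^sup>2 * (sobolev_norm D 1 v)\<^sup>2"
    by (intro mult_right_mono) (auto simp: power2_eq_square)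
  finally show "(l2_norm D (wdiv D v))\<^sup>2 \<le> (?n * sobolev_norm D 1 v)\<^sup>2"
    by (simp add: power_mult_distrib)
qed simp

section \<open>Gradients and integration by parts\<close>

lemma cgrad_L2: "\<phi> \<in> test_functions D \<Longrightarrow> cgrad \<phi> \<in> L2 D"
  unfolding cgrad_def[abs_def] by (intro L2_vec test_L2)

lemma cgrad_lincomb:
  assumes "\<phi> \<in> test_functions D" "\<psi> \<in> test_functions D"
  shows "cgrad (\<lambda>x. \<phi> x + c * \<psi> x) = (\<lambda>x. cgrad \<phi> x + c *\<^sub>R cgrad \<psi> x)"
  using partial_lincomb[OF test_functionsD(2)[OF assms(1)] test_functionsD(2)[OF assms(2)]]
  by (auto simp: cgrad_def vec_eq_iff)

lemma wgrad_L2: "f \<in> sobolev D 1 \<Longrightarrow> wgrad D f \<in> L2 D"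
  unfolding wgrad_def[abs_def] by (intro L2_vec wpartial)

text \<open>The weak derivative of the vector field \<open>v\<close> in direction \<open>i\<close>
  is an identity between vectors; its \<open>i\<close>-th components are summed over
  \<open>i\<close>.\<close>

lemma integration_by_parts_test:
  assumes \<phi>: "\<phi> \<in> test_functions D" and v: "v \<in> sobolev D 1"
  shows "l2_inner D (cgrad \<phi>) v = - l2_inner D \<phi> (wdiv D v)"
proof -
  have i: "integrable (lebesgue_on D) (\<lambda>x. partial i \<phi> x *\<^sub>R v x)"
    "integrable (lebesgue_on D) (\<lambda>x. \<phi> x *\<^sub>R wpartial D i v x)" for i
    by (intro integrable_continuous_mult test_functionsD[OF \<phi>] sobolev_1_L2 wpartial v)+
  have "(LINT x|lebesgue_on D. partial i \<phi> x * v x $ i) = - (LINT x|lebesgue_on D. \<phi> x * wpartial D i v x $ i)" for i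
  proof -
    have "(LINT x|lebesgue_on D. partial i \<phi> x *\<^sub>R v x) $ i = (- (LINT x|lebesgue_on D. \<phi> x *\<^sub>R wpartial D i v x)) $ i"
      using wpartial(2)[OF v] \<phi> by (simp add: weak_partial_def)
    then show ?thesis by (simp add: integral_vec_nth i)
  qed
  note eq = this
  have i': "integrable (lebesgue_on D) (\<lambda>x. partial i \<phi> x * v x $ i)"
    "integrable (lebesgue_on D) (\<lambda>x. \<phi> x * wpartial D i v x $ i)" for i
    using L2_inner_integrable[OF test_L2(2)[OF \<phi>] L2_nth[OF sobolev_1_L2[OF v]]]
      L2_inner_integrable[OF test_L2(1)[OF \<phi>] L2_nth[OF wpartial(1)[OF v]]] by auto
  have "l2_inner D (cgrad \<phi>) v = (\<Sum>i\<in>UNIV. LINT x|lebesgue_on D. partial i \<phi> x * v x $ i)"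
    by (simp add: l2_inner_def inner_vec_def cgrad_def i')
  also have "\<dots> = - (LINT x|lebesgue_on D. \<phi> x * wdiv D v x)"
    by (simp add: eq wdiv_def sum_distrib_left i' sum_negf)
  finally show ?thesis by (simp add: l2_inner_def)
qed

lemma test_sobolev_1:
  assumes "\<phi> \<in> test_functions D"
  shows "\<phi> \<in> sobolev D 1" "AE x in lebesgue_on D. wgrad D \<phi> x = cgrad \<phi> x"
proof -
  note w = test_weak_partial[OF assms] test_L2[OF assms]
  show "\<phi> \<in> sobolev D 1" unfolding sobolev_1_iff using w by blast
  have "AE x in lebesgue_on D. \<forall>i. wpartial D i \<phi> x = partial i \<phi> x"
    using wpartial_eq(3)[OF w(1,3)] by (simp add: AE_all_countable)
  then show "AE x in lebesgue_on D. wgrad D \<phi> x = cgrad \<phi> x"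
    by eventually_elim (simp add: wgrad_def cgrad_def)
qed

text \<open>Converts the H1 distance in the definition of \<open>H10\<close> into two L2 distances,
  with the classical gradient on the test side. Both the density argument and the construction of
  the Dirichlet solution work with these.\<close>

lemma sobolev_norm_diff_test:
  assumes f: "f \<in> sobolev D 1" and \<phi>: "\<phi> \<in> test_functions D"
  shows "(sobolev_norm D 1 (\<lambda>x. f x - \<phi> x))\<^sup>2
    = (l2_norm D (\<lambda>x. f x - \<phi> x))\<^sup>2 + (l2_norm D (\<lambda>x. wgrad D f x - cgrad \<phi> x))\<^sup>2"
proof -
  note \<phi>' = test_sobolev_1(1)[OF \<phi>]
  let ?d = "\<lambda>x. f x - \<phi> x"
  have L: "?d \<in> L2 D" by (intro L2_diff sobolev_1_L2 f \<phi>')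
  note d = sobolev_1_lincomb_AE[OF L f \<phi>', of "-1", simplified]
  have "(\<Sum>i\<in>UNIV. (l2_norm D (wpartial D i ?d))\<^sup>2) = (l2_norm D (wgrad D ?d))\<^sup>2"
    unfolding wgrad_def[abs_def] using wpartial(1)[of ?d] d(1)
    by (intro l2_norm_vec_sq[symmetric]) simp
  also have "l2_norm D (wgrad D ?d) = l2_norm D (\<lambda>x. wgrad D f x - cgrad \<phi> x)"
  proof (rule l2_norm_cong_AE)
    have "AE x in lebesgue_on D. \<forall>i. wpartial D i ?d x = wpartial D i f x - wpartial D i \<phi> x"
      using d(2) by (simp add: AE_all_countable)
    then show "AE x in lebesgue_on D. wgrad D ?d x = wgrad D f x - cgrad \<phi> x"
      using test_sobolev_1(2)[OF \<phi>] by eventually_elim (simp add: wgrad_def vec_eq_iff)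
    show "wgrad D ?d \<in> L2 D" "(\<lambda>x. wgrad D f x - cgrad \<phi> x) \<in> L2 D"
      using d(1) by (auto intro!: L2_diff wgrad_L2 cgrad_L2 f \<phi>)
  qed
  finally show ?thesis by (simp only: sobolev_norm_1_sq)
qed

text \<open>The expression is linear and H1-continuous in \<eta>, so vanishing on test functions
  extends to \<open>H10 D\<close>. General \<open>A\<close> and \<open>B\<close> cover integration
  by parts (a field and its divergence) and the weak Dirichlet equation (a gradient and the
  right-hand side).\<close>

lemma H10_density:
  assumes \<eta>: "\<eta> \<in> H10 D" and A: "A \<in> L2 D" and B: "B \<in> L2 D"
    and t: "\<And>\<phi>. \<phi> \<in> test_functions D \<Longrightarrow> l2_inner D (cgrad \<phi>) A + l2_inner D \<phi> B = 0"
  shows "l2_inner D (wgrad D \<eta>) A + l2_inner D \<eta> B = 0"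
proof (rule ccontr)
  let ?r = "l2_inner D (wgrad D \<eta>) A + l2_inner D \<eta> B"
  assume "?r \<noteq> 0"
  \<comment> \<open>Small enough that an error \<open>e\<close> in value and gradient changes the
    expression by less than \<open>\<bar>?r\<bar>\<close>; the summand 1 makes this strict and the
    denominator positive.\<close>
  define e where "e = \<bar>?r\<bar> / (l2_norm D A + l2_norm D B + 1)"
  have p: "l2_norm D A + l2_norm D B + 1 > 0" by (simp add: add_nonneg_pos)
  then have "e > 0" using \<open>?r \<noteq> 0\<close> by (simp add: e_def)
  have s: "\<eta> \<in> sobolev D 1" using \<eta> by (simp add: H10_def)
  obtain \<phi> where \<phi>: "\<phi> \<in> test_functions D" "sobolev_norm D 1 (\<lambda>x. \<eta> x - \<phi> x) < e"
    using \<eta> \<open>e > 0\<close> by (auto simp: H10_def)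
  let ?d = "\<lambda>x. \<eta> x - \<phi> x" and ?g = "\<lambda>x. wgrad D \<eta> x - cgrad \<phi> x"
  have L: "?d \<in> L2 D" "?g \<in> L2 D"
    by (intro L2_diff wgrad_L2 cgrad_L2 sobolev_1_L2 test_L2 s \<phi>)+
  have "(l2_norm D ?g)\<^sup>2 \<le> (sobolev_norm D 1 ?d)\<^sup>2"
    using sobolev_norm_diff_test[OF s \<phi>(1)] by simp
  then have g: "l2_norm D ?g \<le> e" using \<phi>(2)
    by (meson less_imp_le order_trans power2_le_imp_le sobolev_norm_nonneg)
  have d: "l2_norm D ?d \<le> e" using l2_norm_le_sobolev_norm[of D ?d] \<phi>(2) by simp
  have "?r = l2_inner D ?g A + l2_inner D ?d B"
    using t[OF \<phi>(1)] l2_inner_diff[OF wgrad_L2[OF s] cgrad_L2[OF \<phi>(1)] A]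
      l2_inner_diff[OF sobolev_1_L2[OF s] test_L2(1)[OF \<phi>(1)] B] by simp
  also have "\<bar>\<dots>\<bar> \<le> l2_norm D ?g * l2_norm D A + l2_norm D ?d * l2_norm D B"
    using l2_inner_le_norm[OF L(2) A] l2_inner_le_norm[OF L(1) B] by linarith
  also have "\<dots> \<le> e * l2_norm D A + e * l2_norm D B"
    using g d by (intro add_mono mult_right_mono) auto
  also have "\<dots> < e * (l2_norm D A + l2_norm D B + 1)" using \<open>e > 0\<close> by (simp add: algebra_simps)
  also have "\<dots> = \<bar>?r\<bar>" using p by (simp add: e_def)
  finally show False by simp
qed

lemma integration_by_parts_H10:
  assumes \<eta>: "\<eta> \<in> H10 D" and v: "v \<in> sobolev D 1"
  shows "l2_inner D (wgrad D \<eta>) v = - l2_inner D \<eta> (wdiv D v)"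
  using H10_density[OF \<eta> sobolev_1_L2[OF v] wdiv_L2[OF v]] integration_by_parts_test[OF _ v] by simp

section \<open>Existence and strong form for the Dirichlet problem\<close>

text \<open>Poincare makes the linear functional bounded for the energy form, and makes the
  near-minimisers Cauchy in L2 together with their gradients; completeness then gives a limit of
  each. The equation is repeated for test functions with classical gradients, the form needed to
  recover the divergence of the gradient pointwise.\<close>

lemma dirichlet_existence:
  assumes g: "g \<in> L2 D"
  obtains \<eta> where "dirichlet_solution D g \<eta>"
    "\<And>\<phi>. \<phi> \<in> test_functions D \<Longrightarrow> l2_inner D (cgrad \<phi>) (wgrad D \<eta>) = - l2_inner D \<phi> g"
proof -
  let ?T = "test_functions D"
  define a where "a = (\<lambda>u v. l2_inner D (cgrad u) (cgrad v))"
  \<comment> \<open>The minus sign comes from integrating the Laplacian by parts: the energy form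
    represents the negative right-hand side.\<close>
  define l where "l = (\<lambda>u. - l2_inner D u g)"
  obtain C where C: "C \<ge> 0" "\<And>\<phi> i. \<phi> \<in> ?T \<Longrightarrow> l2_norm D \<phi> \<le> C * l2_norm D (partial i \<phi>)"
    using poincare by metis
  have pc: "l2_norm D \<phi> \<le> C * l2_norm D (cgrad \<phi>)" if "\<phi> \<in> ?T" for \<phi>
  proof -
    \<comment> \<open>\<open>undefined\<close> is just some coordinate direction: Poincare holds
      with the derivative in any single one.\<close>
    have "l2_norm D (partial undefined \<phi>) \<le> l2_norm D (cgrad \<phi>)"
      using l2_norm_nth_le[OF cgrad_L2[OF that], of undefined] by (simp add: cgrad_def)
    then show ?thesis using C(2)[OF that, of undefined] mult_left_mono[OF _ C(1)] by fastforce
  qed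
  have aT: "a (\<lambda>x. u x + c * v x) w = a u w + c * a v w" if "u \<in> ?T" "v \<in> ?T" "w \<in> ?T" for u v w c
    using that by (simp add: a_def cgrad_lincomb l2_inner_lincomb cgrad_L2)
  have lT: "l (\<lambda>x. u x + c * v x) = l u + c * l v" if "u \<in> ?T" "v \<in> ?T" for u v c
    using l2_inner_lincomb[OF test_L2(1)[OF that(1)] test_L2(1)[OF that(2)] g, of c]
    by (simp add: l_def)
  have lb: "(l u)\<^sup>2 \<le> (C\<^sup>2 * (l2_norm D g)\<^sup>2) * a u u" if "u \<in> ?T" for u
  proof -
    have "\<bar>l u\<bar> \<le> l2_norm D u * l2_norm D g"
      unfolding l_def using l2_inner_le_norm[OF test_L2(1)[OF that] g] by simp
    also have "\<dots> \<le> C * l2_norm D (cgrad u) * l2_norm D g"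
      by (intro mult_right_mono pc that) simp
    finally have "\<bar>l u\<bar>\<^sup>2 \<le> (C * l2_norm D (cgrad u) * l2_norm D g)\<^sup>2"
      by (rule power_mono) simp
    then show ?thesis by (simp add: power_mult_distrib a_def l2_norm_sq mult_ac)
  qed
  have sym: "a u v = a v u" and nn: "0 \<le> a u u" for u v
    by (simp_all add: a_def l2_inner_commute)
  obtain \<phi> where \<phi>: "\<And>n. \<phi> n \<in> ?T" "\<And>n v. v \<in> ?T \<Longrightarrow> (a (\<phi> n) v - l v)\<^sup>2 \<le> a v v / Suc n"
    "\<And>m n. a (\<lambda>x. \<phi> m x - \<phi> n x) (\<lambda>x. \<phi> m x - \<phi> n x) \<le> 2 / Suc m + 2 / Suc n"
    by (rule riesz_sequence[of ?T a l, OF test_functions_0 test_functions_lincomb aT sym nn lT lb])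
      (auto intro: that)
  have dT: "(\<lambda>x. \<phi> m x - \<phi> n x) \<in> ?T" for m n
    using test_functions_lincomb[OF \<phi>(1)[of m] \<phi>(1)[of n], of "-1"] by simp
  have dg: "cgrad (\<lambda>x. \<phi> m x - \<phi> n x) = (\<lambda>x. cgrad (\<phi> m) x - cgrad (\<phi> n) x)" for m n
    using cgrad_lincomb[OF \<phi>(1)[of m] \<phi>(1)[of n], of "-1"] by simp
  \<comment> \<open>Used with \<open>K = C\<^sup>2\<close> for the functions, where Poincare costs
    this factor, and with \<open>K = 1\<close> for the gradients.\<close>
  have small: "\<exists>N. \<forall>m\<ge>N. \<forall>n\<ge>N. (2 / Suc m + 2 / Suc n) * K \<le> e" if "0 < e" "0 \<le> K" for e K :: real
  proof -
    obtain N :: nat where N: "4 * K / e < real N" using reals_Archimedean2 by blast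
    have b: "2 / Suc m * K \<le> e / 2" if "N \<le> m" for m
    proof -
      have "4 * K \<le> e * Suc m" using N that \<open>0 < e\<close>
        by (simp add: divide_simps mult.commute) (smt (verit) mult_left_mono of_nat_mono mult.commute)
      then show ?thesis by (simp add: field_simps)
    qed
    have "(2 / Suc m + 2 / Suc n) * K \<le> e" if "N \<le> m" "N \<le> n" for m n
      using add_mono[OF b[OF that(1)] b[OF that(2)]] by (simp only: distrib_right)
    then show ?thesis by blast
  qed
  have cg: "(l2_norm D (\<lambda>x. cgrad (\<phi> m) x - cgrad (\<phi> n) x))\<^sup>2 \<le> 2 / Suc m + 2 / Suc n" for m n
    using \<phi>(3)[of m n] by (simp add: a_def dg l2_norm_sq)
  have c0: "(l2_norm D (\<lambda>x. \<phi> m x - \<phi> n x))\<^sup>2 \<le> (2 / Suc m + 2 / Suc n) * C\<^sup>2" for m n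
  proof -
    have "(l2_norm D (\<lambda>x. \<phi> m x - \<phi> n x))\<^sup>2 \<le> (C * l2_norm D (\<lambda>x. cgrad (\<phi> m) x - cgrad (\<phi> n) x))\<^sup>2"
      using pc[OF dT] by (intro power_mono) (auto simp: dg)
    also have "\<dots> \<le> C\<^sup>2 * (2 / Suc m + 2 / Suc n)"
      unfolding power_mult_distrib using cg by (rule mult_left_mono) simp
    finally show ?thesis by (simp only: mult.commute)
  qed
  have "\<exists>N. \<forall>m\<ge>N. \<forall>n\<ge>N. (l2_norm D (\<lambda>x. \<phi> m x - \<phi> n x))\<^sup>2 \<le> e" if "0 < e" for e
    using small[OF that, of "C\<^sup>2"] c0 by (meson order_trans zero_le_power2)
  then obtain \<eta> where \<eta>: "\<eta> \<in> L2 D" "(\<lambda>n. l2_norm D (\<lambda>x. \<phi> n x - \<eta> x)) \<longlonglongrightarrow> 0"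
    using L2_complete[of D \<phi>, OF lmeasurable_D test_L2(1)[OF \<phi>(1)]] by blast
  have "\<exists>N. \<forall>m\<ge>N. \<forall>n\<ge>N. (l2_norm D (\<lambda>x. cgrad (\<phi> m) x - cgrad (\<phi> n) x))\<^sup>2 \<le> e" if "0 < e" for e
    using small[OF that, of 1] cg unfolding mult_1_right by (meson order_trans zero_le_one)
  then obtain G where G: "G \<in> L2 D" "(\<lambda>n. l2_norm D (\<lambda>x. cgrad (\<phi> n) x - G x)) \<longlonglongrightarrow> 0"
    using L2_complete[of D "\<lambda>n. cgrad (\<phi> n)", OF lmeasurable_D cgrad_L2[OF \<phi>(1)]] by blast
  \<comment> \<open>Both sides of the weak-derivative identity for \<open>\<phi> n\<close> are L2
    inner products with a fixed function, so they pass to the limit and identify \<open>G\<close> as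
    the gradient of \<eta>.\<close>
  have wp: "weak_partial D i \<eta> (\<lambda>x. G x $ i)" for i
    unfolding weak_partial_def
  proof
    fix \<psi> assume \<psi>: "\<psi> \<in> ?T"
    have "(\<lambda>n. l2_norm D (\<lambda>x. partial i (\<phi> n) x - G x $ i)) \<longlonglongrightarrow> 0"
    proof (rule tendsto_sandwich[OF _ _ tendsto_const G(2)])
      show "\<forall>\<^sub>F n in sequentially. l2_norm D (\<lambda>x. partial i (\<phi> n) x - G x $ i) \<le> l2_norm D (\<lambda>x. cgrad (\<phi> n) x - G x)"
        using l2_norm_nth_le[OF L2_diff[OF cgrad_L2[OF \<phi>(1)] G(1)], where i=i] by (simp add: cgrad_def)
    qed simp
    then have 1: "(\<lambda>n. l2_inner D (partial i (\<phi> n)) \<psi>) \<longlonglongrightarrow> l2_inner D (\<lambda>x. G x $ i) \<psi>"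
      by (intro l2_inner_tendsto test_L2 \<phi> \<psi> L2_nth G)
    have 2: "(\<lambda>n. l2_inner D (\<phi> n) (partial i \<psi>)) \<longlonglongrightarrow> l2_inner D \<eta> (partial i \<psi>)"
      by (intro l2_inner_tendsto test_L2 \<phi> \<psi> \<eta>)
    have "l2_inner D (\<phi> n) (partial i \<psi>) = - l2_inner D (partial i (\<phi> n)) \<psi>" for n
      using test_weak_partial[OF \<phi>(1)] \<psi> by (simp add: weak_partial_def l2_inner_def mult.commute)
    then have "(\<lambda>n. - l2_inner D (partial i (\<phi> n)) \<psi>) \<longlonglongrightarrow> l2_inner D \<eta> (partial i \<psi>)"
      using 2 by simp
    then have "l2_inner D \<eta> (partial i \<psi>) = - l2_inner D (\<lambda>x. G x $ i) \<psi>"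
      using tendsto_minus[OF 1] LIMSEQ_unique by blast
    then show "(LINT x|lebesgue_on D. partial i \<psi> x *\<^sub>R \<eta> x) = - (LINT x|lebesgue_on D. \<psi> x *\<^sub>R (G x $ i))"
      by (simp add: l2_inner_def mult.commute)
  qed
  have s: "\<eta> \<in> sobolev D 1" unfolding sobolev_1_iff using \<eta>(1) wp L2_nth[OF G(1)] by blast
  have "AE x in lebesgue_on D. \<forall>i. wpartial D i \<eta> x = G x $ i"
    using wpartial_eq(3)[OF wp L2_nth[OF G(1)]] by (simp add: AE_all_countable)
  then have wG: "AE x in lebesgue_on D. wgrad D \<eta> x = G x"
    by eventually_elim (simp add: wgrad_def vec_eq_iff)
  \<comment> \<open>The near-minimisers are test functions, so the sequence that defines \<eta> also
    witnesses the zero boundary values.\<close>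
  have "\<eta> \<in> H10 D"
    unfolding H10_def
  proof (intro CollectI conjI allI impI s)
    fix e :: real assume "0 < e"
    have nc: "l2_norm D (\<lambda>x. p x - q x) = l2_norm D (\<lambda>x. q x - p x)" for p q :: "real^'d \<Rightarrow> 'z::euclidean_space"
      by (simp add: l2_norm_def l2_inner_def inner_diff inner_commute algebra_simps)
    have "l2_norm D (\<lambda>x. wgrad D \<eta> x - cgrad (\<phi> n) x) = l2_norm D (\<lambda>x. G x - cgrad (\<phi> n) x)" for n
      by (rule l2_norm_cong_AE) (use wG in \<open>auto intro!: L2_diff wgrad_L2 cgrad_L2 s \<phi> G\<close>)
    then have eq: "(sobolev_norm D 1 (\<lambda>x. \<eta> x - \<phi> n x))\<^sup>2
        = (l2_norm D (\<lambda>x. \<phi> n x - \<eta> x))\<^sup>2 + (l2_norm D (\<lambda>x. cgrad (\<phi> n) x - G x))\<^sup>2" for n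
      unfolding sobolev_norm_diff_test[OF s \<phi>(1)] by (simp add: nc[of \<eta>] nc[of G])
    have "(\<lambda>n. (sobolev_norm D 1 (\<lambda>x. \<eta> x - \<phi> n x))\<^sup>2) \<longlonglongrightarrow> 0\<^sup>2 + 0\<^sup>2"
      unfolding eq by (intro tendsto_intros \<eta> G)
    then have "\<forall>\<^sub>F n in sequentially. (sobolev_norm D 1 (\<lambda>x. \<eta> x - \<phi> n x))\<^sup>2 < e\<^sup>2"
      by (rule order_tendstoD(2)) (use \<open>0 < e\<close> in simp)
    then obtain n where "(sobolev_norm D 1 (\<lambda>x. \<eta> x - \<phi> n x))\<^sup>2 < e\<^sup>2"
      by (auto simp: eventually_sequentially)
    then have "sobolev_norm D 1 (\<lambda>x. \<eta> x - \<phi> n x) < e"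
      using \<open>0 < e\<close> power2_less_imp_less by fastforce
    then show "\<exists>\<phi>\<in>?T. sobolev_norm D 1 (\<lambda>x. \<eta> x - \<phi> x) < e" using \<phi>(1) by blast
  qed
  have test: "l2_inner D (cgrad \<psi>) (wgrad D \<eta>) = - l2_inner D \<psi> g" if \<psi>: "\<psi> \<in> ?T" for \<psi>
  proof -
    have 1: "(\<lambda>n. a (\<phi> n) \<psi>) \<longlonglongrightarrow> l2_inner D G (cgrad \<psi>)"
      unfolding a_def by (intro l2_inner_tendsto cgrad_L2 \<phi> \<psi> G)
    have "(\<lambda>n. (a (\<phi> n) \<psi> - l \<psi>)\<^sup>2) \<longlonglongrightarrow> 0"
    proof (rule Lim_null_comparison)
      show "\<forall>\<^sub>F n in sequentially. norm ((a (\<phi> n) \<psi> - l \<psi>)\<^sup>2) \<le> a \<psi> \<psi> * inverse (real (Suc n))"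
        using \<phi>(2)[OF \<psi>] by (simp add: divide_inverse del: of_nat_Suc)
      show "(\<lambda>n. a \<psi> \<psi> * inverse (real (Suc n))) \<longlonglongrightarrow> 0"
        using tendsto_mult_left[OF LIMSEQ_inverse_real_of_nat, of "a \<psi> \<psi>"] by simp
    qed
    moreover have "(\<lambda>n. (a (\<phi> n) \<psi> - l \<psi>)\<^sup>2) \<longlonglongrightarrow> (l2_inner D G (cgrad \<psi>) - l \<psi>)\<^sup>2"
      by (intro tendsto_intros 1)
    ultimately have "(l2_inner D G (cgrad \<psi>) - l \<psi>)\<^sup>2 = 0" using LIMSEQ_unique by blast
    then have "l2_inner D G (cgrad \<psi>) = - l2_inner D \<psi> g" by (simp add: l_def)
    moreover have "l2_inner D (wgrad D \<eta>) (cgrad \<psi>) = l2_inner D G (cgrad \<psi>)"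
      by (rule l2_inner_cong_AE[OF wgrad_L2[OF s] cgrad_L2[OF \<psi>] G(1) cgrad_L2[OF \<psi>] wG]) simp
    ultimately show ?thesis by (simp add: l2_inner_commute)
  qed
  have "dirichlet_solution D g \<eta>"
    unfolding dirichlet_solution_def
  proof (intro conjI ballI \<open>\<eta> \<in> H10 D\<close>)
    fix \<psi> assume "\<psi> \<in> H10 D"
    then have "l2_inner D (wgrad D \<psi>) (wgrad D \<eta>) + l2_inner D \<psi> g = 0"
      by (rule H10_density[OF _ wgrad_L2[OF s] g]) (simp add: test)
    then show "- l2_inner D (wgrad D \<eta>) (wgrad D \<psi>) = l2_inner D g \<psi>"
      by (simp add: l2_inner_commute)
  qed
  then show thesis using that test by blast
qed

text \<open>\<open>sobolev D 2\<close> only promises some first derivatives in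
  \<open>sobolev D 1\<close>; uniqueness moves this to the chosen ones. As
  \<open>sobolev_norm_sq D 2\<close> counts ordered pairs of derivatives, it is exactly the squared
  L2 norm of \<eta> plus the squared H1 norm of the gradient.\<close>

lemma sobolev_2_wgrad:
  assumes "\<eta> \<in> sobolev D 2"
  shows "\<eta> \<in> sobolev D 1" "wgrad D \<eta> \<in> sobolev D 1"
    "sobolev_norm D 1 (wgrad D \<eta>) \<le> sobolev_norm D 2 \<eta>"
proof -
  have h: "\<eta> \<in> L2 D" "\<exists>g\<in>sobolev D 1. weak_partial D i \<eta> g" for i
    using assms by (auto simp: numeral_2_eq_2)
  then show s: "\<eta> \<in> sobolev D 1" unfolding sobolev_1_iff using sobolev_1_L2 by blast
  have p: "wpartial D i \<eta> \<in> sobolev D 1" for i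
  proof -
    obtain g where g: "g \<in> sobolev D 1" "weak_partial D i \<eta> g" using h(2) by blast
    have "AE x in lebesgue_on D. wpartial D i \<eta> x = g x + 0 *\<^sub>R g x"
      using wpartial_eq(3)[OF g(2) sobolev_1_L2[OF g(1)]] by simp
    then show ?thesis using sobolev_1_lincomb_AE(1)[OF wpartial(1)[OF s] g(1) g(1)] by blast
  qed
  have L: "wpartial D j (wpartial D i \<eta>) \<in> L2 D" for i j by (rule wpartial(1)[OF p])
  have w: "weak_partial D j (wgrad D \<eta>) (\<lambda>x. \<chi> i. wpartial D j (wpartial D i \<eta>) x)" for j
    unfolding wgrad_def[abs_def] by (intro weak_partial_vec wpartial s p)
  have V: "(\<lambda>x. \<chi> i. wpartial D j (wpartial D i \<eta>) x) \<in> L2 D" for j by (rule L2_vec[OF L])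
  show "wgrad D \<eta> \<in> sobolev D 1" unfolding sobolev_1_iff using wgrad_L2[OF s] w V by blast
  have n: "(l2_norm D (wpartial D j (wgrad D \<eta>)))\<^sup>2 = (\<Sum>i\<in>UNIV. (l2_norm D (wpartial D j (wpartial D i \<eta>)))\<^sup>2)" for j
    using l2_norm_cong_AE[OF wpartial_eq(1)[OF w V] V wpartial_eq(3)[OF w V]] l2_norm_vec_sq[OF L] by simp
  have n0: "(l2_norm D (wgrad D \<eta>))\<^sup>2 = (\<Sum>i\<in>UNIV. (l2_norm D (wpartial D i \<eta>))\<^sup>2)"
    unfolding wgrad_def[abs_def] by (rule l2_norm_vec_sq[OF wpartial(1)[OF s]])
  have "sobolev_norm_sq D 2 \<eta> = (l2_norm D \<eta>)\<^sup>2 + (\<Sum>i\<in>UNIV. (l2_norm D (wpartial D i \<eta>))\<^sup>2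
      + (\<Sum>j\<in>UNIV. (l2_norm D (wpartial D j (wpartial D i \<eta>)))\<^sup>2))"
    by (simp add: numeral_2_eq_2)
  also have "\<dots> = (l2_norm D \<eta>)\<^sup>2 + (sobolev_norm D 1 (wgrad D \<eta>))\<^sup>2"
    unfolding sobolev_norm_1_sq n n0 sum.distrib
    using sum.swap[of "\<lambda>i j. (l2_norm D (wpartial D j (wpartial D i \<eta>)))\<^sup>2" UNIV UNIV] by simp
  finally have "(sobolev_norm D 1 (wgrad D \<eta>))\<^sup>2 \<le> sobolev_norm_sq D 2 \<eta>" by simp
  then show "sobolev_norm D 1 (wgrad D \<eta>) \<le> sobolev_norm D 2 \<eta>"
    unfolding sobolev_norm_def[of D 2] by (rule real_le_rsqrt)
qed

text \<open>Passes from the weak to the strong form: once the gradient has weak derivatives,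
  integrating back and the fundamental lemma identify its divergence.\<close>

lemma wdiv_wgrad_AE:
  assumes "wgrad D \<eta> \<in> sobolev D 1" "g \<in> L2 D"
    "\<And>\<phi>. \<phi> \<in> test_functions D \<Longrightarrow> l2_inner D (cgrad \<phi>) (wgrad D \<eta>) = - l2_inner D \<phi> g"
  shows "AE x in lebesgue_on D. wdiv D (wgrad D \<eta>) x = g x"
proof -
  note L = wdiv_L2[OF assms(1)]
  have "AE x in lebesgue_on D. wdiv D (wgrad D \<eta>) x - g x = 0"
  proof (rule AE_zero_if_test_integrals_0)
    show "integrable (lebesgue_on D) (\<lambda>x. wdiv D (wgrad D \<eta>) x - g x)"
      by (intro L2_integrable L2_diff L assms)
    fix \<phi> assume \<phi>: "\<phi> \<in> test_functions D"
    have "l2_inner D (wdiv D (wgrad D \<eta>)) \<phi> - l2_inner D g \<phi> = 0"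
      using integration_by_parts_test[OF \<phi> assms(1)] assms(3)[OF \<phi>] by (simp add: l2_inner_commute)
    then show "(LINT x|lebesgue_on D. \<phi> x *\<^sub>R (wdiv D (wgrad D \<eta>) x - g x)) = 0"
      using l2_inner_diff[OF L assms(2) test_L2(1)[OF \<phi>]] by (simp add: l2_inner_def mult.commute)
  qed
  then show ?thesis by simp
qed

end

section \<open>The discrete Helmholtz decomposition\<close>

text \<open>Gaussian elimination by induction on the equations: an equation with a nonzero pivot
  removes one unknown and itself, which preserves the strict inequality of cardinalities.\<close>

lemma homogeneous_system_nontrivial_solution:
  fixes c :: "'j \<Rightarrow> 'b \<Rightarrow> real"
  assumes "finite B" "finite J" "card B < card J"
  obtains a where "\<exists>j\<in>J. a j \<noteq> 0" "\<And>b. b \<in> B \<Longrightarrow> (\<Sum>j\<in>J. a j * c j b) = 0"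
proof -
  have "\<exists>a. (\<exists>j\<in>J. a j \<noteq> 0) \<and> (\<forall>b\<in>B. (\<Sum>j\<in>J. a j * c j b) = 0)"
    using assms
  proof (induction B arbitrary: J c rule: finite_induct)
    case empty
    then obtain j where "j \<in> J" by (metis card.empty card_gt_0_iff ex_in_conv)
    then show ?case by (intro exI[of _ "\<lambda>_. 1"]) auto
  next
    case (insert b B)
    show ?case
    proof (cases "\<forall>j\<in>J. c j b = 0")
      case True
      obtain a where a: "\<exists>j\<in>J. a j \<noteq> 0" "\<forall>b\<in>B. (\<Sum>j\<in>J. a j * c j b) = 0"
        using insert.IH[of J c] insert.prems insert.hyps by auto
      moreover have "(\<Sum>j\<in>J. a j * c j b) = 0" by (rule sum.neutral) (use True in auto)
      ultimately show ?thesis by auto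
    next
      case False
      then obtain k where k: "k \<in> J" "c k b \<noteq> 0" by auto
      define J' where "J' = J - {k}"
      have J': "finite J'" "J = insert k J'" "k \<notin> J'" using k insert.prems by (auto simp: J'_def)
      have "card B < card J'" using insert.prems insert.hyps J' by simp
      then obtain a where a: "\<exists>j\<in>J'. a j \<noteq> 0"
        "\<forall>b'\<in>B. (\<Sum>j\<in>J'. a j * (c j b' - c j b / c k b * c k b')) = 0"
        using insert.IH[OF J'(1), of "\<lambda>j b'. c j b' - c j b / c k b * c k b'"] by auto
      \<comment> \<open>The value of the eliminated unknown \<open>k\<close> forced by equation
        \<open>b\<close>.\<close>
      define t where "t = - (\<Sum>j\<in>J'. a j * c j b) / c k b"
      define a' where "a' = a(k := t)"
      have split: "(\<Sum>j\<in>J. a' j * c j b') = t * c k b' + (\<Sum>j\<in>J'. a j * c j b')" for b'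
      proof -
        have "(\<Sum>j\<in>J'. a' j * c j b') = (\<Sum>j\<in>J'. a j * c j b')"
          by (rule sum.cong) (use J'(3) in \<open>auto simp: a'_def\<close>)
        then show ?thesis using J' by (simp add: a'_def)
      qed
      have "(\<Sum>j\<in>J. a' j * c j b') = 0" if "b' \<in> B" for b'
      proof -
        have "0 = (\<Sum>j\<in>J'. a j * c j b') - (\<Sum>j\<in>J'. a j * c j b) / c k b * c k b'"
          using a(2) that by (simp add: algebra_simps sum_subtractf sum_distrib_left sum_divide_distrib)
        then show ?thesis by (simp add: split t_def)
      qed
      moreover have "(\<Sum>j\<in>J. a' j * c j b) = 0" using k(2) by (simp add: split t_def)
      moreover have "\<exists>j\<in>J. a' j \<noteq> 0" using a(1) J' by (auto simp: a'_def)
      ultimately show ?thesis by auto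
    qed
  qed
  then show thesis using that by blast
qed

text \<open>Finite dimension is expressed through the length of such systems: a finite element space
  may contain many modifications of one function on null sets, so as a space of functions it need
  not have a finite basis.\<close>

definition l2_orthonormal ::
  "(real^'d) set \<Rightarrow> nat \<Rightarrow> (nat \<Rightarrow> real^'d \<Rightarrow> 'b::euclidean_space) \<Rightarrow> bool" where
  "l2_orthonormal D n e \<longleftrightarrow> (\<forall>i<n. \<forall>j<n. l2_inner D (e i) (e j) = of_bool (i = j))"

lemma l2_inner_scaleR: "l2_inner D (\<lambda>x. c *\<^sub>R f x) g = c * l2_inner D f g"
  by (simp add: l2_inner_def)

lemma l2_inner_orthonormal_sum:
  assumes "l2_orthonormal D n e" "\<And>i. i < n \<Longrightarrow> e i \<in> L2 D" "k < n"
  shows "l2_inner D (\<lambda>x. \<Sum>i<n. a i *\<^sub>R e i x) (e k) = a k"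
proof -
  have "l2_inner D (\<lambda>x. \<Sum>i<n. a i *\<^sub>R e i x) (e k) = (\<Sum>i<n. l2_inner D (\<lambda>x. a i *\<^sub>R e i x) (e k))"
    using assms by (intro l2_inner_sum L2_scaleR) auto
  also have "\<dots> = (\<Sum>i<n. if i = k then a k else 0)"
    using assms by (intro sum.cong) (auto simp: l2_inner_scaleR l2_orthonormal_def)
  finally show ?thesis using assms(3) by simp
qed

lemma fe_space_lincomb:
  assumes "fe_space D M N V" "u \<in> V" "v \<in> V"
  shows "(\<lambda>x. u x + c *\<^sub>R v x) \<in> V"
proof -
  have add: "\<forall>u\<in>V. \<forall>v\<in>V. (\<lambda>x. u x + v x) \<in> V" and scale: "\<forall>c. \<forall>v\<in>V. (\<lambda>x. c *\<^sub>R v x) \<in> V"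
    using assms(1) unfolding fe_space_def by - (elim conjE, assumption)+
  show ?thesis by (rule add[rule_format, OF assms(2) scale[rule_format, OF assms(3)]])
qed

text \<open>At most \<open>card M * N\<close> local coefficients describe an element of
  \<open>V\<close> almost everywhere. A longer system has a nontrivial combination whose
  coefficients all cancel, which vanishes almost everywhere and contradicts orthonormality.\<close>

lemma fe_space_orthonormal_bound:
  fixes D :: "(real^'d) set"
  assumes D: "open D" and M: "fitted_triangulation D M" and V: "fe_space D M N V" "V \<subseteq> L2 D"
    and e: "l2_orthonormal D n e" "\<And>i. i < n \<Longrightarrow> e i \<in> V"
  shows "n \<le> card M * N"
proof (rule ccontr)
  assume "\<not> n \<le> card M * N"
  have fM: "finite M" using M by (simp add: fitted_triangulation_def)
  have "\<forall>F\<in>M. \<exists>B. finite B \<and> card B \<le> N \<and> (\<forall>v\<in>V. \<exists>c. AE x in lebesgue_on (D \<inter> F ` ref_simplex).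
      v x = (\<Sum>b\<in>B. c b *\<^sub>R b x))"
    using V(1) unfolding fe_space_def by (elim conjE)
  from bchoice[OF this] obtain B where B: "\<And>F. F \<in> M \<Longrightarrow> finite (B F) \<and> card (B F) \<le> N"
    and "\<forall>F\<in>M. \<forall>v\<in>V. \<exists>c. AE x in lebesgue_on (D \<inter> F ` ref_simplex). v x = (\<Sum>b\<in>B F. c b *\<^sub>R b x)"
    by blast
  then have "\<forall>F\<in>M. \<exists>c. \<forall>v\<in>V. AE x in lebesgue_on (D \<inter> F ` ref_simplex). v x = (\<Sum>b\<in>B F. c v b *\<^sub>R b x)"
    by (intro ballI bchoice) blast
  from bchoice[OF this] obtain c where c: "\<And>F v. F \<in> M \<Longrightarrow> v \<in> V \<Longrightarrow>
      AE x in lebesgue_on (D \<inter> F ` ref_simplex). v x = (\<Sum>b\<in>B F. c F v b *\<^sub>R b x)"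
    by blast
  have "card (Sigma M B) = (\<Sum>F\<in>M. card (B F))" using fM B by simp
  also have "\<dots> \<le> card M * N" using sum_bounded_above[of M "\<lambda>F. card (B F)" N] B by simp
  finally have "card (Sigma M B) < card {..<n}" using \<open>\<not> n \<le> card M * N\<close> by simp
  moreover have "finite (Sigma M B)" using fM B by auto
  \<comment> \<open>The coefficients \<open>c F v\<close> are chosen separately for each
    \<open>v\<close>, with no linearity in \<open>v\<close>; hence the equations combine those of
    the individual \<open>e j\<close>.\<close>
  ultimately obtain a where a: "\<exists>j\<in>{..<n}. a j \<noteq> 0"
    "\<And>p. p \<in> Sigma M B \<Longrightarrow> (\<Sum>j<n. a j * c (fst p) (e j) (snd p)) = 0"
    using homogeneous_system_nontrivial_solution[of "Sigma M B" "{..<n}" "\<lambda>j p. c (fst p) (e j) (snd p)"]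
    by auto
  define s where "s = (\<lambda>x. \<Sum>j<n. a j *\<^sub>R e j x)"
  have eL: "e j \<in> L2 D" if "j < n" for j using e(2)[OF that] V(2) by auto
  have sL: "s \<in> L2 D" unfolding s_def by (intro L2_sum L2_scaleR eL) auto
  have Dl: "D \<in> sets lebesgue" using D by auto
  have cell: "AE x in lebesgue. x \<in> D \<inter> F ` ref_simplex \<longrightarrow> s x = 0" if "F \<in> M" for F
  proof -
    have "compact (F ` ref_simplex)"
      using M that unfolding fitted_triangulation_def ref_simplex_def
      by (intro compact_continuous_image finite_imp_compact_convex_hull) auto
    then have ml: "D \<inter> F ` ref_simplex \<in> sets lebesgue"
      by (intro sets.Int[OF Dl] fmeasurableD[OF lmeasurable_compact])
    have "AE x in lebesgue_on (D \<inter> F ` ref_simplex). \<forall>j\<in>{..<n}. e j x = (\<Sum>b\<in>B F. c F (e j) b *\<^sub>R b x)"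
      by (intro AE_finite_allI c that e(2)) auto
    then have "AE x in lebesgue_on (D \<inter> F ` ref_simplex). s x = 0"
    proof eventually_elim
      case (elim x)
      have "s x = (\<Sum>j<n. \<Sum>b\<in>B F. (a j * c F (e j) b) *\<^sub>R b x)"
        unfolding s_def using elim by (intro sum.cong) (auto simp: scaleR_sum_right)
      also have "\<dots> = (\<Sum>b\<in>B F. (\<Sum>j<n. a j * c F (e j) b) *\<^sub>R b x)"
        by (subst sum.swap) (simp add: scaleR_sum_left)
      also have "\<dots> = 0" using a(2)[of "(F, _)"] that by (intro sum.neutral) auto
      finally show ?case .
    qed
    then show ?thesis using ml by (simp add: AE_restrict_space_iff)
  qed
  have "AE x in lebesgue. \<forall>F\<in>M. x \<in> D \<inter> F ` ref_simplex \<longrightarrow> s x = 0"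
    by (intro AE_finite_allI fM cell)
  then have "AE x in lebesgue. x \<in> D \<longrightarrow> s x = 0"
  proof eventually_elim
    case (elim x)
    have "D \<subseteq> (\<Union>F\<in>M. F ` ref_simplex)"
      using M closure_subset by (auto simp: fitted_triangulation_def)
    then show ?case using elim by blast
  qed
  then have s0: "AE x in lebesgue_on D. s x = 0" using Dl by (simp add: AE_restrict_space_iff)
  have "a k = 0" if "k < n" for k
  proof -
    have "a k = l2_inner D s (e k)"
      unfolding s_def using l2_inner_orthonormal_sum[OF e(1) eL that] by simp
    also have "\<dots> = l2_inner D (\<lambda>x. 0) (e k)"
      by (rule l2_inner_cong_AE[OF sL eL L2_zero eL s0]) (use that in auto)
    finally show ?thesis by (simp add: l2_inner_def)
  qed
  then show False using a(1) by auto
qed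

text \<open>An orthonormal system of maximal length replaces a basis: the remainder of an element of
  \<open>X\<close> after projection has norm 0, since otherwise its normalisation would extend the
  system.\<close>

lemma l2_projection_exists:
  fixes v :: "real^'d \<Rightarrow> 'b::euclidean_space"
  assumes X: "X \<subseteq> L2 D" "(\<lambda>x. 0) \<in> X" "\<And>u w c. u \<in> X \<Longrightarrow> w \<in> X \<Longrightarrow> (\<lambda>x. u x + c *\<^sub>R w x) \<in> X"
    and bound: "\<And>n e. l2_orthonormal D n e \<Longrightarrow> (\<And>i. i < n \<Longrightarrow> e i \<in> X) \<Longrightarrow> n \<le> K"
    and v: "v \<in> L2 D"
  obtains w where "w \<in> X" "\<And>u. u \<in> X \<Longrightarrow> l2_inner D (\<lambda>x. v x - w x) u = 0"
proof -
  define P where "P = (\<lambda>n. \<exists>e :: nat \<Rightarrow> real^'d \<Rightarrow> 'b. l2_orthonormal D n e \<and> (\<forall>i<n. e i \<in> X))"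
  have "P 0" by (auto simp: P_def l2_orthonormal_def)
  moreover have "\<forall>n. P n \<longrightarrow> n \<le> K" using bound by (auto simp: P_def)
  ultimately obtain n where n: "P n" "\<And>m. P m \<Longrightarrow> m \<le> n"
    using Greatest_le_nat[of P _ K] GreatestI_nat[of P 0 K] by blast
  then obtain e where e: "l2_orthonormal D n e" "\<And>i. i < n \<Longrightarrow> e i \<in> X" by (auto simp: P_def)
  have eL: "e i \<in> L2 D" if "i < n" for i using e(2)[OF that] X(1) by auto
  define proj where "proj = (\<lambda>u x. \<Sum>i<n. l2_inner D u (e i) *\<^sub>R e i x)"
  have projX: "proj u \<in> X" for u
  proof -
    have "(\<lambda>x. \<Sum>i\<in>I. l2_inner D u (e i) *\<^sub>R e i x) \<in> X" if "I \<subseteq> {..<n}" for I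
      using finite_subset[OF that finite_lessThan] that
    proof (induction I rule: finite_induct)
      case (insert i I)
      then show ?case using X(3)[of "\<lambda>x. \<Sum>i\<in>I. l2_inner D u (e i) *\<^sub>R e i x" "e i"] e(2)
        by (simp add: add.commute)
    qed (simp add: X)
    then show ?thesis unfolding proj_def by auto
  qed
  then have projL: "proj u \<in> L2 D" for u using X(1) by auto
  define res where "res = (\<lambda>u x. u x - proj u x)"
  have resL: "res u \<in> L2 D" if "u \<in> L2 D" for u
    unfolding res_def by (intro L2_diff projL that)
  have orth: "l2_inner D (res u) (e k) = 0" if "u \<in> L2 D" "k < n" for u k
    unfolding res_def using l2_inner_diff[OF that(1) projL eL[OF that(2)]]
      l2_inner_orthonormal_sum[OF e(1) eL that(2)] by (simp add: proj_def)
  have null: "l2_inner D (res u) (res u) = 0" if u: "u \<in> X" for u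
  proof (rule ccontr)
    assume "l2_inner D (res u) (res u) \<noteq> 0"
    then have pos: "0 < l2_norm D (res u)"
      by (simp add: l2_norm_def less_le)
    have uL: "u \<in> L2 D" using u X(1) by auto
    define f where "f = (\<lambda>x. inverse (l2_norm D (res u)) *\<^sub>R res u x)"
    have rX: "res u \<in> X" unfolding res_def using X(3)[OF u projX, of "-1" u] by simp
    have fX: "f \<in> X" unfolding f_def using X(3)[OF X(2) rX, of "inverse (l2_norm D (res u))"] by simp
    have ff: "l2_inner D f f = 1"
    proof -
      have "l2_inner D f f = inverse (l2_norm D (res u)) * l2_inner D (res u) f"
        unfolding f_def by (rule l2_inner_scaleR)
      also have "l2_inner D (res u) f = inverse (l2_norm D (res u)) * l2_inner D (res u) (res u)"
        unfolding f_def by (subst l2_inner_commute) (rule l2_inner_scaleR)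
      also have "l2_inner D (res u) (res u) = l2_norm D (res u) * l2_norm D (res u)"
        by (simp only: power2_eq_square l2_norm_sq[symmetric])
      finally show ?thesis using pos by (simp add: field_simps)
    qed
    have fe: "l2_inner D f (e k) = 0" if "k < n" for k
      unfolding f_def l2_inner_scaleR using orth[OF uL that] by simp
    have fe': "l2_inner D (e k) f = 0" if "k < n" for k
      using fe[OF that] by (subst l2_inner_commute)
    have "l2_orthonormal D (Suc n) (e(n := f))"
      unfolding l2_orthonormal_def
    proof (intro allI impI)
      fix i j assume "i < Suc n" "j < Suc n"
      then show "l2_inner D ((e(n := f)) i) ((e(n := f)) j) = of_bool (i = j)"
        by (cases "i = n"; cases "j = n")
          (simp_all add: ff fe fe' e(1)[unfolded l2_orthonormal_def, rule_format] less_Suc_eq)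
    qed
    moreover have "\<forall>i<Suc n. (e(n := f)) i \<in> X" using e(2) fX by (auto simp: less_Suc_eq)
    ultimately have "P (Suc n)" unfolding P_def by blast
    then show False using n(2) by fastforce
  qed
  \<comment> \<open>Here \<open>u\<close> is \<open>proj u\<close> plus \<open>res u\<close>. The
    residual of \<open>v\<close> is orthogonal to the span of the system, and the second part,
    though perhaps not the zero function, has norm 0.\<close>
  have "l2_inner D (res v) u = 0" if u: "u \<in> X" for u
  proof -
    have uL: "u \<in> L2 D" using u X(1) by auto
    have "l2_norm D (res u) = 0" using null[OF u] by (simp add: l2_norm_def)
    then have 1: "l2_inner D (res v) (res u) = 0"
      using l2_inner_le_norm[OF resL[OF v] resL[OF uL]] by simp
    have "l2_inner D (proj u) (res v) = (\<Sum>i<n. l2_inner D (\<lambda>x. l2_inner D u (e i) *\<^sub>R e i x) (res v))"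
      unfolding proj_def by (intro l2_inner_sum L2_scaleR eL resL v) auto
    also have "\<dots> = 0"
      using orth[OF v] by (intro sum.neutral) (auto simp: l2_inner_scaleR l2_inner_commute[of D _ "res v"])
    finally have "l2_inner D u (res v) - l2_inner D (res u) (res v) = 0"
      using l2_inner_diff[OF uL projL resL[OF v], of u] by (simp add: res_def)
    then show ?thesis using 1 by (simp add: l2_inner_commute)
  qed
  then show thesis using that[OF projX[of v]] by (simp add: res_def)
qed

context bounded_domain
begin

section \<open>Existence and uniqueness of the decomposition\<close>

lemma disc_div_free_lincomb:
  assumes V: "Vh \<subseteq> sobolev D 1" "Qh \<subseteq> L2 D" "fe_space D M N Vh"
    and u: "u \<in> disc_div_free D Vh Qh" and w: "w \<in> disc_div_free D Vh Qh"
  shows "(\<lambda>x. u x + c *\<^sub>R w x) \<in> disc_div_free D Vh Qh"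
proof -
  have uw: "u \<in> Vh" "w \<in> Vh" using u w by (auto simp: disc_div_free_def)
  have m: "(\<lambda>x. u x + c *\<^sub>R w x) \<in> Vh" by (rule fe_space_lincomb[OF V(3) uw])
  have s: "u \<in> sobolev D 1" "w \<in> sobolev D 1" "(\<lambda>x. u x + c *\<^sub>R w x) \<in> sobolev D 1"
    using uw m V(1) by auto
  have "l2_inner D (wdiv D (\<lambda>x. u x + c *\<^sub>R w x)) q = 0" if q: "q \<in> Qh" for q
  proof -
    have qL: "q \<in> L2 D" using q V(2) by auto
    have "AE x in lebesgue_on D. wdiv D (\<lambda>x. u x + c *\<^sub>R w x) x = wdiv D u x + c *\<^sub>R wdiv D w x"
      by (rule wdiv_lincomb_AE[OF sobolev_1_L2[OF s(3)] s(1,2)]) simp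
    then have "l2_inner D (wdiv D (\<lambda>x. u x + c *\<^sub>R w x)) q = l2_inner D (\<lambda>x. wdiv D u x + c *\<^sub>R wdiv D w x) q"
      by (rule l2_inner_cong_AE[OF wdiv_L2[OF s(3)] qL L2_lincomb[OF wdiv_L2[OF s(1)] wdiv_L2[OF s(2)]] qL]) simp
    also have "\<dots> = l2_inner D (wdiv D u) q + c * l2_inner D (wdiv D w) q"
      by (rule l2_inner_lincomb[OF wdiv_L2[OF s(1)] wdiv_L2[OF s(2)] qL])
    also have "\<dots> = 0" using u w q by (simp add: disc_div_free_def)
    finally show ?thesis .
  qed
  then show ?thesis using m by (simp add: disc_div_free_def)
qed

lemma disc_div_free_diff:
  assumes V: "Vh \<subseteq> sobolev D 1" "Qh \<subseteq> L2 D" "fe_space D M N Vh"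
    and u: "u \<in> disc_div_free D Vh Qh" and w: "w \<in> disc_div_free D Vh Qh"
  shows "(\<lambda>x. u x - w x) \<in> disc_div_free D Vh Qh"
  using disc_div_free_lincomb[OF assms, of "-1"] by simp

text \<open>Here \<open>w\<close> is the L2-projection and \<open>z\<close> the remainder, so the
  splitting holds at every point. For another splitting, w' - w = z - z' is both discretely
  divergence free and orthogonal to all such fields, hence null.\<close>

lemma disc_helmholtz_exists_unique:
  assumes M: "fitted_triangulation D M"
    and V: "Vh \<subseteq> sobolev D 1" "Qh \<subseteq> L2 D" "fe_space D M N Vh"
    and v: "v \<in> Vh"
  shows "\<exists>w\<in>disc_div_free D Vh Qh. \<exists>z\<in>disc_div_free_perp D Vh Qh.
    (\<forall>x. v x = w x + z x) \<and> l2_inner D w z = 0 \<and>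
    (\<forall>w'\<in>disc_div_free D Vh Qh. \<forall>z'\<in>disc_div_free_perp D Vh Qh.
       (AE x in lebesgue_on D. v x = w' x + z' x) \<longrightarrow>
       (AE x in lebesgue_on D. w' x = w x \<and> z' x = z x))"
proof -
  let ?X = "disc_div_free D Vh Qh" and ?Y = "disc_div_free_perp D Vh Qh"
  have VL: "Vh \<subseteq> L2 D" using V(1) sobolev_1_L2 by auto
  have XV: "?X \<subseteq> Vh" "?Y \<subseteq> Vh" by (auto simp: disc_div_free_def disc_div_free_perp_def)
  have X0: "(\<lambda>x. 0) \<in> ?X"
  proof -
    have "(\<lambda>x. 0) \<in> Vh" using V(3) by (simp add: fe_space_def)
    moreover have "l2_inner D (wdiv D (\<lambda>x. 0)) q = 0" if "q \<in> Qh" for q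
    proof -
      have s: "(\<lambda>x. 0 :: real^'d) \<in> sobolev D 1" by (rule subsetD[OF V(1) \<open>(\<lambda>x. 0) \<in> Vh\<close>])
      have qL: "q \<in> L2 D" using that V(2) by auto
      \<comment> \<open>Even the weak divergence of the zero field is a choice; writing 0 as 0 - 0,
        linearity forces it to vanish almost everywhere.\<close>
      have "AE x in lebesgue_on D. wdiv D (\<lambda>x. 0) x = wdiv D (\<lambda>x. 0) x + (- 1) *\<^sub>R wdiv D (\<lambda>x. 0) x"
        by (rule wdiv_lincomb_AE[OF L2_zero s s]) simp
      then have "AE x in lebesgue_on D. wdiv D (\<lambda>x. 0) x = 0" by simp
      then have "l2_inner D (wdiv D (\<lambda>x. 0)) q = l2_inner D (\<lambda>x. 0) q"
        by (rule l2_inner_cong_AE[OF wdiv_L2[OF s] qL L2_zero qL]) simp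
      then show ?thesis by (simp add: l2_inner_def)
    qed
    ultimately show ?thesis by (simp add: disc_div_free_def)
  qed
  have vL: "v \<in> L2 D" using v VL by auto
  obtain w where w: "w \<in> ?X" "\<And>u. u \<in> ?X \<Longrightarrow> l2_inner D (\<lambda>x. v x - w x) u = 0"
  proof (rule l2_projection_exists[of ?X D "card M * N" v])
    show "?X \<subseteq> L2 D" using XV VL by auto
    show "n \<le> card M * N" if "l2_orthonormal D n e" "\<And>i. i < n \<Longrightarrow> e i \<in> ?X" for n e
      using fe_space_orthonormal_bound[OF open_D M V(3) VL that(1)] that(2) XV by blast
  qed (use X0 disc_div_free_lincomb[OF V] vL in auto)
  define z where "z = (\<lambda>x. v x - w x)"
  have "(\<lambda>x. v x + (- 1) *\<^sub>R w x) \<in> Vh"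
    using fe_space_lincomb[OF V(3) v] w(1) XV by blast
  then have z: "z \<in> ?Y" using w(2) by (simp add: disc_div_free_perp_def z_def)
  have L: "x \<in> L2 D" if "x \<in> ?X \<or> x \<in> ?Y" for x using that XV VL by auto
  have wz: "l2_inner D w z = 0" using w(2)[OF w(1)] by (simp add: z_def l2_inner_commute)
  have uniq: "AE x in lebesgue_on D. w' x = w x \<and> z' x = z x"
    if w': "w' \<in> ?X" and z': "z' \<in> ?Y" and dec: "AE x in lebesgue_on D. v x = w' x + z' x" for w' z'
  proof -
    let ?d = "\<lambda>x. w' x - w x"
    have d: "?d \<in> ?X" by (rule disc_div_free_diff[OF V w' w(1)])
    have eq: "AE x in lebesgue_on D. ?d x = z x - z' x"
      using dec by eventually_elim (simp add: z_def algebra_simps)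
    have dL: "?d \<in> L2 D" "z \<in> L2 D" "z' \<in> L2 D" using L d z z' by auto
    have "l2_inner D ?d ?d = l2_inner D (\<lambda>x. z x - z' x) ?d"
      by (rule l2_inner_cong_AE[OF dL(1) dL(1) L2_diff[OF dL(2,3)] dL(1) eq]) simp
    also have "\<dots> = l2_inner D z ?d - l2_inner D z' ?d"
      by (rule l2_inner_diff[OF dL(2,3,1)])
    also have "\<dots> = 0" using z z' d by (simp add: disc_div_free_perp_def)
    finally have "AE x in lebesgue_on D. ?d x = 0" by (rule l2_inner_self_eq_0[OF dL(1)])
    then show ?thesis using eq by eventually_elim simp
  qed
  show ?thesis
    by (rule bexI[OF _ w(1)], rule bexI[OF _ z]) (use wz uniq in \<open>auto simp: z_def\<close>)
qed

section \<open>Stability of the decomposition in H1\<close>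

text \<open>Zero boundary values of \<eta> remove the boundary term, and \<open>orth\<close> allows
  any \<open>q\<close> to be subtracted from \<eta>. The approximation error of \<eta> thus measures
  how far the gradient is from being orthogonal to \<open>e\<close>.\<close>

lemma H10_duality_le_approximation:
  assumes \<eta>: "\<eta> \<in> H10 D" and e: "e \<in> sobolev D 1" and Q: "Qh \<subseteq> L2 D" "Qh \<noteq> {}"
    and orth: "\<And>q. q \<in> Qh \<Longrightarrow> l2_inner D (wdiv D e) q = 0"
    and B: "(INF q\<in>Qh. l2_norm D (\<lambda>x. \<eta> x - q x)) \<le> B"
  shows "\<bar>l2_inner D (wgrad D \<eta>) e\<bar> \<le> B * l2_norm D (wdiv D e)"
proof -
  let ?r = "\<bar>l2_inner D (wgrad D \<eta>) e\<bar>" and ?d = "l2_norm D (wdiv D e)"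
  have s: "\<eta> \<in> L2 D" using \<eta> sobolev_1_L2 by (auto simp: H10_def)
  have b: "?r \<le> l2_norm D (\<lambda>x. \<eta> x - q x) * ?d" if q: "q \<in> Qh" for q
  proof -
    have qL: "q \<in> L2 D" using q Q by auto
    have "l2_inner D (wgrad D \<eta>) e = - l2_inner D (\<lambda>x. \<eta> x - q x) (wdiv D e)"
      using integration_by_parts_H10[OF \<eta> e] orth[OF q] l2_inner_diff[OF s qL wdiv_L2[OF e]]
      by (simp add: l2_inner_commute[of D q])
    then show ?thesis using l2_inner_le_norm[OF L2_diff[OF s qL] wdiv_L2[OF e]] by simp
  qed
  show ?thesis
  proof (cases "?d = 0")
    case True
    then show ?thesis using b Q(2) by auto
  next
    case False
    then have d: "?d > 0" using l2_norm_nonneg[of D "wdiv D e"] by linarith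
    \<comment> \<open>The infimum need not be attained, so the bound, valid for each
      \<open>q\<close>, is divided by the norm of the divergence before the infimum is
      taken.\<close>
    have "?r / ?d \<le> (INF q\<in>Qh. l2_norm D (\<lambda>x. \<eta> x - q x))"
      using b d by (intro cINF_greatest Q(2)) (simp add: divide_le_eq)
    then have "?r / ?d \<le> B" using B by (rule order_trans)
    then show ?thesis using d by (simp add: divide_le_eq)
  qed
qed

text \<open>In units of the H1 norm of \<open>v\<close>: \<open>Cr * d\<close> bounds the H2 norm of
  \<eta>, \<open>K\<close> bounds \<open>C1\<close> times the H1 norm of \<open>u\<close> and hence
  \<open>p\<close>, the inner bracket of \<open>L\<close> bounds \<open>e\<close> in L2 up to a
  factor h, and \<open>L\<close> bounds w = e + p. Finally \<open>2 * (1 + L)\<close> bounds z = v -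
  w. The outer factors 2 come from the weakened triangle inequality; h has cancelled.\<close>

lemma disc_helmholtz_stable:
  assumes h: "h > 0" and V: "Vh \<subseteq> sobolev D 1" "Qh \<subseteq> L2 D" "fe_space D M N Vh" "Qh \<noteq> {}"
    and C: "0 \<le> C1" "0 \<le> C2" "0 \<le> C3" "0 \<le> Cr"
    and P: "fortin_projection D Vh Qh h C1 P" and approx: "pressure_approximation D Qh h C2"
    and inv: "inverse_inequality D Vh h C3"
    and reg: "\<And>g \<eta>. g \<in> L2 D \<Longrightarrow> dirichlet_solution D g \<eta> \<Longrightarrow>
      \<eta> \<in> sobolev D 2 \<and> sobolev_norm D 2 \<eta> \<le> Cr * l2_norm D g"
    and v: "v \<in> Vh" and w: "w \<in> disc_div_free D Vh Qh" and z: "z \<in> disc_div_free_perp D Vh Qh"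
    and dec: "AE x in lebesgue_on D. v x = w x + z x"
  defines "d \<equiv> real CARD('d)"
  defines "K \<equiv> C1 * (2 * (1 + Cr * d))"
  defines "L \<equiv> 2 * (C3 * (K + C2 * d * C3 * (Cr * d)) + K)"
  shows "sobolev_norm D 1 w + sobolev_norm D 1 z \<le> (L + 2 * (1 + L)) * sobolev_norm D 1 v"
proof -
  let ?H = "sobolev_norm D 1" and ?X = "disc_div_free D Vh Qh"
  have d: "0 \<le> d" by (simp add: d_def)
  have K: "0 \<le> K" using C d by (simp add: K_def)
  have XV: "x \<in> ?X \<Longrightarrow> x \<in> sobolev D 1" for x using V(1) by (auto simp: disc_div_free_def)
  have sv: "v \<in> sobolev D 1" "w \<in> sobolev D 1" "z \<in> sobolev D 1"
    using v w z V(1) by (auto simp: disc_div_free_def disc_div_free_perp_def)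
  note sL = sv[THEN sobolev_1_L2]
  obtain \<eta> where \<eta>: "dirichlet_solution D (wdiv D v) \<eta>"
    "\<And>\<phi>. \<phi> \<in> test_functions D \<Longrightarrow> l2_inner D (cgrad \<phi>) (wgrad D \<eta>) = - l2_inner D \<phi> (wdiv D v)"
    using dirichlet_existence[OF wdiv_L2[OF sv(1)]] by blast
  have \<eta>2: "\<eta> \<in> sobolev D 2" "sobolev_norm D 2 \<eta> \<le> Cr * l2_norm D (wdiv D v)"
    using reg[OF wdiv_L2[OF sv(1)] \<eta>(1)] by auto
  have \<eta>H: "\<eta> \<in> H10 D" using \<eta>(1) by (simp add: dirichlet_solution_def)
  define S where "S = sobolev_norm D 2 \<eta>"
  have S: "0 \<le> S" "S \<le> Cr * d * ?H v"
    using \<eta>2(2) mult_left_mono[OF l2_norm_wdiv_le[OF sv(1)] C(4)] by (auto simp: S_def d_def)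
  note gr = sobolev_2_wgrad(2,3)[OF \<eta>2(1), folded S_def]
  define u where "u = (\<lambda>x. v x - wgrad D \<eta> x)"
  have uL: "u \<in> L2 D" unfolding u_def by (intro L2_diff sL sobolev_1_L2 gr)
  have u_AE: "AE x in lebesgue_on D. u x = v x + (- 1) *\<^sub>R wgrad D \<eta> x" by (simp add: u_def)
  note u = sobolev_1_lincomb_AE[OF uL sv(1) gr(1) u_AE]
  have "?H u \<le> 2 * (?H v + Cr * d * ?H v)" using u(3) gr(2) S by simp
  then have Hu: "?H u \<le> 2 * (1 + Cr * d) * ?H v" by (simp add: algebra_simps)
  have CHu: "C1 * ?H u \<le> K * ?H v"
    using mult_left_mono[OF Hu C(1)] by (simp add: K_def mult.assoc)
  have div_grad: "AE x in lebesgue_on D. wdiv D (wgrad D \<eta>) x = wdiv D v x"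
    by (rule wdiv_wgrad_AE[OF gr(1) wdiv_L2[OF sv(1)]]) (rule \<eta>(2))
  have div_u: "AE x in lebesgue_on D. wdiv D u x = 0"
    using wdiv_lincomb_AE[OF uL sv(1) gr(1) u_AE] div_grad by eventually_elim simp
  define p where "p = P u"
  have pV: "p \<in> Vh" and p_orth: "\<And>q. q \<in> Qh \<Longrightarrow> l2_inner D (wdiv D (\<lambda>x. u x - p x)) q = 0"
    and up: "l2_norm D (\<lambda>x. u x - p x) \<le> C1 * h * ?H u" and Hp: "?H p \<le> C1 * ?H u"
    using P u(1) unfolding fortin_projection_def p_def by (auto simp: sobolev_norm_def[of D 0])
  have ps: "p \<in> sobolev D 1" using pV V(1) by auto
  note pL = sobolev_1_L2[OF ps]
  have upL: "(\<lambda>x. u x - p x) \<in> L2 D" by (intro L2_diff uL pL)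
  have ups: "(\<lambda>x. u x - p x) \<in> sobolev D 1"
    by (rule sobolev_1_lincomb_AE(1)[OF upL u(1) ps, of "-1"]) simp
  \<comment> \<open>The projection preserves the divergence tested with \<open>Qh\<close>, and that
    of \<open>u\<close> is zero; this is why the gradient was subtracted before projecting.\<close>
  have pX: "p \<in> ?X"
  proof -
    have "l2_inner D (wdiv D p) q = 0" if q: "q \<in> Qh" for q
    proof -
      have qL: "q \<in> L2 D" using q V(2) by auto
      have "AE x in lebesgue_on D. wdiv D (\<lambda>x. u x - p x) x = wdiv D u x + (- 1) *\<^sub>R wdiv D p x"
        by (rule wdiv_lincomb_AE[OF upL u(1) ps]) simp
      then have "AE x in lebesgue_on D. wdiv D p x = (- 1) *\<^sub>R wdiv D (\<lambda>x. u x - p x) x"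
        using div_u by eventually_elim simp
      then have "l2_inner D (wdiv D p) q = l2_inner D (\<lambda>x. (- 1) *\<^sub>R wdiv D (\<lambda>x. u x - p x) x) q"
        by (rule l2_inner_cong_AE[OF wdiv_L2[OF ps] qL L2_scaleR[OF wdiv_L2[OF ups]] qL]) simp
      then show ?thesis unfolding l2_inner_scaleR using p_orth[OF q] by simp
    qed
    then show ?thesis using pV by (simp add: disc_div_free_def)
  qed
  define e where "e = (\<lambda>x. w x - p x)"
  have eX: "e \<in> ?X" unfolding e_def by (rule disc_div_free_diff[OF V(1-3) w pX])
  note es = XV[OF eX]
  note eL = sobolev_1_L2[OF es]
  have He: "?H e \<le> C3 * inverse h * l2_norm D e"
    using inv eX by (auto simp: inverse_inequality_def disc_div_free_def)
  \<comment> \<open>The case \<open>m = 2\<close> of the approximation property: one power of h pays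
    for the inverse inequality applied to \<open>e\<close>, the other survives.\<close>
  have INF: "(INF q\<in>Qh. l2_norm D (\<lambda>x. \<eta> x - q x)) \<le> C2 * h\<^sup>2 * S"
    using approx \<eta>2(1) unfolding pressure_approximation_def S_def by blast
  \<comment> \<open>Orthogonality of \<open>z\<close> to \<open>e\<close> replaces the unknown
    \<open>w\<close> by the given \<open>v\<close>.\<close>
  have "l2_inner D w e = l2_inner D (\<lambda>x. v x - z x) e"
    by (rule l2_inner_cong_AE[OF sL(2) eL L2_diff[OF sL(1,3)] eL])
      (use dec in \<open>eventually_elim, simp\<close>, simp)
  also have "\<dots> = l2_inner D v e"
    using l2_inner_diff[OF sL(1,3) eL] z eX by (simp add: disc_div_free_perp_def)
  finally have we: "l2_inner D w e = l2_inner D v e" .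
  have "l2_inner D e e = l2_inner D w e - l2_inner D p e"
    by (subst (1) e_def) (rule l2_inner_diff[OF sL(2) pL eL])
  moreover have "l2_inner D u e = l2_inner D v e - l2_inner D (wgrad D \<eta>) e"
    unfolding u_def by (rule l2_inner_diff[OF sL(1) sobolev_1_L2[OF gr(1)] eL])
  moreover have "l2_inner D (\<lambda>x. u x - p x) e = l2_inner D u e - l2_inner D p e"
    by (rule l2_inner_diff[OF uL pL eL])
  ultimately have "(l2_norm D e)\<^sup>2 = l2_inner D (\<lambda>x. u x - p x) e + l2_inner D (wgrad D \<eta>) e"
    using we by (simp add: l2_norm_sq)
  also have "\<dots> \<le> l2_norm D (\<lambda>x. u x - p x) * l2_norm D e + C2 * h\<^sup>2 * S * l2_norm D (wdiv D e)"
  proof -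
    have "\<bar>l2_inner D (wgrad D \<eta>) e\<bar> \<le> C2 * h\<^sup>2 * S * l2_norm D (wdiv D e)"
      by (rule H10_duality_le_approximation[OF \<eta>H es V(2,4) _ INF])
        (use eX in \<open>simp add: disc_div_free_def\<close>)
    then show ?thesis using l2_inner_le_norm[OF upL eL] by linarith
  qed
  \<comment> \<open>The divergence of \<open>e\<close> costs a factor \<open>d\<close> and, by the
    inverse inequality, \<open>C3 / h\<close>; every term then carries one factor h and one norm of
    \<open>e\<close>, which can be cancelled.\<close>
  also have "\<dots> \<le> (h * (K * ?H v)) * l2_norm D e + C2 * h\<^sup>2 * S * (d * (C3 * inverse h * l2_norm D e))"
  proof (intro add_mono mult_right_mono mult_left_mono)
    show "l2_norm D (\<lambda>x. u x - p x) \<le> h * (K * ?H v)"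
      using up mult_left_mono[OF CHu less_imp_le[OF h]] by (simp add: mult_ac)
    show "l2_norm D (wdiv D e) \<le> d * (C3 * inverse h * l2_norm D e)"
      using l2_norm_wdiv_le[OF es, folded d_def] mult_left_mono[OF He d] by linarith
  qed (use C S h in auto)
  also have "\<dots> = l2_norm D e * (h * (K * ?H v + C2 * d * C3 * S))"
    using h by (simp add: field_simps power2_eq_square)
  finally have q: "l2_norm D e * l2_norm D e \<le> l2_norm D e * (h * (K * ?H v + C2 * d * C3 * S))"
    by (simp only: power2_eq_square)
  have "l2_norm D e \<le> h * (K * ?H v + C2 * d * C3 * S)"
  proof (cases "l2_norm D e = 0")
    case True
    then show ?thesis using h K C d S by simp
  next
    case False
    then have "0 < l2_norm D e" using l2_norm_nonneg[of D e] by linarith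
    then show ?thesis using q by (simp only: mult_le_cancel_left_pos)
  qed
  also have "\<dots> \<le> h * (K * ?H v + C2 * d * C3 * (Cr * d * ?H v))"
    using h C d S by (intro mult_left_mono add_left_mono) auto
  \<comment> \<open>The inverse inequality a second time: its 1/h meets the h gained for the L2 norm
    of \<open>e\<close>.\<close>
  finally have "C3 * inverse h * l2_norm D e \<le> C3 * inverse h * (h * (K * ?H v + C2 * d * C3 * (Cr * d * ?H v)))"
    using C h by (intro mult_left_mono) auto
  also have "\<dots> = C3 * (K + C2 * d * C3 * (Cr * d)) * ?H v"
    using h by (simp add: field_simps)
  finally have He': "?H e \<le> C3 * (K + C2 * d * C3 * (Cr * d)) * ?H v" using He by linarith
  have "?H w \<le> 2 * (?H e + \<bar>1\<bar> * ?H p)"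
    by (rule sobolev_1_lincomb_AE(3)[OF sL(2) es ps]) (simp add: e_def)
  also have "\<dots> \<le> 2 * (C3 * (K + C2 * d * C3 * (Cr * d)) * ?H v + K * ?H v)"
    using He' Hp CHu by simp
  also have "\<dots> = L * ?H v" by (simp add: L_def algebra_simps)
  finally have Hw: "?H w \<le> L * ?H v" .
  have "AE x in lebesgue_on D. z x = v x + (- 1) *\<^sub>R w x"
    using dec by eventually_elim simp
  then have "?H z \<le> 2 * (?H v + \<bar>- 1\<bar> * ?H w)"
    by (rule sobolev_1_lincomb_AE(3)[OF sL(3) sv(1,2)])
  then have "?H z \<le> 2 * (?H v + L * ?H v)" using Hw by simp
  then show ?thesis using Hw by (simp add: algebra_simps)
qed

end

theorem lemma4p2:
  fixes D :: "(real^'d::finite) set"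
    and H :: "real set"
    and M :: "real \<Rightarrow> (real^'d \<Rightarrow> real^'d) set"
    and V :: "real \<Rightarrow> (real^'d \<Rightarrow> real^'d) set"
    and Q :: "real \<Rightarrow> (real^'d \<Rightarrow> real) set"
  assumes dim: "CARD('d) \<in> {2, 3}"
    and domain: "open D" "bounded D" "D \<noteq> {}"
    and regularity: "stokes_regular D" "dirichlet_regular D"
    and mesh: "\<And>h. h \<in> H \<Longrightarrow> h > 0 \<and> fitted_triangulation D (M h) \<and> mesh_size (M h) = h"
      "quasi_uniform H M"
    and spaces: "\<And>h. h \<in> H \<Longrightarrow> V h \<subseteq> sobolev D 1 \<and> Q h \<subseteq> L2 D"
      "\<exists>N. \<forall>h\<in>H. fe_space D (M h) N (V h) \<and> fe_space D (M h) N (Q h)"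
    and prop1: "\<exists>C. \<forall>h\<in>H. \<exists>P. fortin_projection D (V h) (Q h) h C P"
    and prop2: "\<exists>C. \<forall>h\<in>H. pressure_approximation D (Q h) h C"
    and prop3: "\<exists>C. \<forall>h\<in>H. inverse_inequality D (V h) h C"
    and prop4: "\<exists>C. \<forall>h\<in>H. inf_sup_condition D (V h) (Q h) C"
  shows "(\<forall>h\<in>H. \<forall>v\<in>V h.
            \<exists>w\<in>disc_div_free D (V h) (Q h). \<exists>z\<in>disc_div_free_perp D (V h) (Q h).
              (\<forall>x. v x = w x + z x) \<and> l2_inner D w z = 0 \<and>
              (\<forall>w'\<in>disc_div_free D (V h) (Q h). \<forall>z'\<in>disc_div_free_perp D (V h) (Q h).
                 (AE x in lebesgue_on D. v x = w' x + z' x) \<longrightarrow>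
                 (AE x in lebesgue_on D. w' x = w x \<and> z' x = z x))) \<and>
         (\<exists>C. \<forall>h\<in>H. \<forall>v\<in>V h.
            \<forall>w\<in>disc_div_free D (V h) (Q h). \<forall>z\<in>disc_div_free_perp D (V h) (Q h).
              (AE x in lebesgue_on D. v x = w x + z x) \<longrightarrow>
              sobolev_norm D 1 w + sobolev_norm D 1 z \<le> C * sobolev_norm D 1 v)"
proof -
  interpret bounded_domain D by (unfold_locales) (use domain in auto)
  obtain N where N: "\<And>h. h \<in> H \<Longrightarrow> fe_space D (M h) N (V h)" "\<And>h. h \<in> H \<Longrightarrow> fe_space D (M h) N (Q h)"
    using spaces(2) by blast
  \<comment> \<open>It contains the zero function; without an element the infimum in the
    approximation property would carry no information.\<close>
  have Q0: "Q h \<noteq> {}" if "h \<in> H" for h using N(2)[OF that] by (auto simp: fe_space_def)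
  \<comment> \<open>The assumed constants may have either sign. Absolute values keep the bounds
    valid, as norms and powers of h are nonnegative, and they allow the estimates to be multiplied
    together.\<close>
  have mono: "a * x \<le> \<bar>a\<bar> * x" if "0 \<le> x" for a x :: real
    using that by (intro mult_right_mono) auto
  obtain C1 where C1: "\<And>h. h \<in> H \<Longrightarrow> \<exists>P. fortin_projection D (V h) (Q h) h \<bar>C1\<bar> P"
  proof -
    from prop1 obtain C where C: "\<And>h. h \<in> H \<Longrightarrow> \<exists>P. fortin_projection D (V h) (Q h) h C P" by blast
    have "fortin_projection D (V h) (Q h) h \<bar>C\<bar> P"
      if "h \<in> H" "fortin_projection D (V h) (Q h) h C P" for h P
    proof -
      have h: "0 \<le> h" using mesh(1)[OF that(1)] by simp
      have "C * h ^ (1 - m) * sobolev_norm D 1 v \<le> \<bar>C\<bar> * h ^ (1 - m) * sobolev_norm D 1 v" for m v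
        using h by (intro mult_right_mono) auto
      moreover have "C * sobolev_norm D 1 v \<le> \<bar>C\<bar> * sobolev_norm D 1 v" for v :: "real^'d \<Rightarrow> real^'d"
        by (rule mono) simp
      ultimately show ?thesis
        using that(2) unfolding fortin_projection_def by (meson order_trans)
    qed
    then show thesis using C that by blast
  qed
  obtain C2 where C2: "\<And>h. h \<in> H \<Longrightarrow> pressure_approximation D (Q h) h \<bar>C2\<bar>"
  proof -
    from prop2 obtain C where C: "\<And>h. h \<in> H \<Longrightarrow> pressure_approximation D (Q h) h C" by blast
    have "pressure_approximation D (Q h) h \<bar>C\<bar>" if "h \<in> H" for h
    proof -
      have h: "0 \<le> h" using mesh(1)[OF that] by simp
      have "C * h ^ m * sobolev_norm D m q \<le> \<bar>C\<bar> * h ^ m * sobolev_norm D m q" for m and q :: "real^'d \<Rightarrow> real"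
        using h by (intro mult_right_mono) auto
      then show ?thesis
        using C[OF that] unfolding pressure_approximation_def by (meson order_trans)
    qed
    then show thesis using that by blast
  qed
  obtain C3 where C3: "\<And>h. h \<in> H \<Longrightarrow> inverse_inequality D (V h) h \<bar>C3\<bar>"
  proof -
    from prop3 obtain C where C: "\<And>h. h \<in> H \<Longrightarrow> inverse_inequality D (V h) h C" by blast
    have "inverse_inequality D (V h) h \<bar>C\<bar>" if "h \<in> H" for h
    proof -
      have h: "0 \<le> h" using mesh(1)[OF that] by simp
      have "C * inverse h * l2_norm D v \<le> \<bar>C\<bar> * inverse h * l2_norm D v" for v :: "real^'d \<Rightarrow> real^'d"
        using h by (intro mult_right_mono) auto
      then show ?thesis
        using C[OF that] unfolding inverse_inequality_def by (meson order_trans)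
    qed
    then show thesis using that by blast
  qed
  obtain Cr where Cr: "\<And>g \<eta>. g \<in> L2 D \<Longrightarrow> dirichlet_solution D g \<eta> \<Longrightarrow>
      \<eta> \<in> sobolev D 2 \<and> sobolev_norm D 2 \<eta> \<le> \<bar>Cr\<bar> * l2_norm D g"
  proof -
    from regularity(2) obtain C where C: "\<And>g \<eta>. g \<in> L2 D \<Longrightarrow> dirichlet_solution D g \<eta> \<Longrightarrow>
      \<eta> \<in> sobolev D 2 \<and> sobolev_norm D 2 \<eta> \<le> C * l2_norm D g"
      unfolding dirichlet_regular_def by blast
    have "\<eta> \<in> sobolev D 2 \<and> sobolev_norm D 2 \<eta> \<le> \<bar>C\<bar> * l2_norm D g"
      if "g \<in> L2 D" "dirichlet_solution D g \<eta>" for g \<eta>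
      using C[OF that] mono[OF l2_norm_nonneg[of D g], of C] by linarith
    then show thesis using that by blast
  qed
  define d where "d = real CARD('d)"
  define K where "K = \<bar>C1\<bar> * (2 * (1 + \<bar>Cr\<bar> * d))"
  define L where "L = 2 * (\<bar>C3\<bar> * (K + \<bar>C2\<bar> * d * \<bar>C3\<bar> * (\<bar>Cr\<bar> * d)) + K)"
  have "\<exists>C. \<forall>h\<in>H. \<forall>v\<in>V h. \<forall>w\<in>disc_div_free D (V h) (Q h). \<forall>z\<in>disc_div_free_perp D (V h) (Q h).
      (AE x in lebesgue_on D. v x = w x + z x) \<longrightarrow>
      sobolev_norm D 1 w + sobolev_norm D 1 z \<le> C * sobolev_norm D 1 v"
  \<comment> \<open>The witness is built from the four constants and the dimension before any h is
    fixed, which is the claimed uniformity.\<close>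
  proof (intro exI[of _ "L + 2 * (1 + L)"] ballI impI)
    fix h v w z
    assume h: "h \<in> H" and *: "v \<in> V h" "w \<in> disc_div_free D (V h) (Q h)"
      "z \<in> disc_div_free_perp D (V h) (Q h)" "AE x in lebesgue_on D. v x = w x + z x"
    obtain P where P: "fortin_projection D (V h) (Q h) h \<bar>C1\<bar> P" using C1[OF h] by blast
    have h0: "h > 0" and VQ: "V h \<subseteq> sobolev D 1" "Q h \<subseteq> L2 D" using mesh(1)[OF h] spaces(1)[OF h] by auto
    show "sobolev_norm D 1 w + sobolev_norm D 1 z \<le> (L + 2 * (1 + L)) * sobolev_norm D 1 v"
      unfolding L_def K_def d_def
      by (rule disc_helmholtz_stable[OF h0 VQ N(1)[OF h] Q0[OF h] abs_ge_zero abs_ge_zero abs_ge_zero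
            abs_ge_zero P C2[OF h] C3[OF h] _ *]) (rule Cr)
  qed
  moreover have "\<forall>h\<in>H. \<forall>v\<in>V h.
            \<exists>w\<in>disc_div_free D (V h) (Q h). \<exists>z\<in>disc_div_free_perp D (V h) (Q h).
              (\<forall>x. v x = w x + z x) \<and> l2_inner D w z = 0 \<and>
              (\<forall>w'\<in>disc_div_free D (V h) (Q h). \<forall>z'\<in>disc_div_free_perp D (V h) (Q h).
                 (AE x in lebesgue_on D. v x = w' x + z' x) \<longrightarrow>
                 (AE x in lebesgue_on D. w' x = w x \<and> z' x = z x))"
  proof (intro ballI)
    fix h v assume h: "h \<in> H" and "v \<in> V h"
    then show "\<exists>w\<in>disc_div_free D (V h) (Q h). \<exists>z\<in>disc_div_free_perp D (V h) (Q h).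
              (\<forall>x. v x = w x + z x) \<and> l2_inner D w z = 0 \<and>
              (\<forall>w'\<in>disc_div_free D (V h) (Q h). \<forall>z'\<in>disc_div_free_perp D (V h) (Q h).
                 (AE x in lebesgue_on D. v x = w' x + z' x) \<longrightarrow>
                 (AE x in lebesgue_on D. w' x = w x \<and> z' x = z x))"
      using mesh(1)[OF h] spaces(1)[OF h] N(1)[OF h] by (intro disc_helmholtz_exists_unique) auto
  qed
  ultimately show ?thesis by blast
qed

end
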